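(* Let $d\in\mathbb{N}$. Let $(U_n)_{n\in\mathbb{Z}_+}$ and $(B_n)_{n\in\mathbb{Z}_+}$ be $\mathbb{R}^d$-valued and $\mathbb{R}^{d\times d}$-valued stochastic processes, respectively, defined on a probability space $(\Omega,\mathcal{F},\mathbb{P})$ and adapted to a filtration $(\mathcal{F}_n)_{n\in\mathbb{Z}_+}$. Suppose that $B_n$ is invertible for all sufficiently large $n\in\mathbb{N}$. Let $(Q_n)_{n\in\mathbb{N}}$ be a (deterministic) sequence in $\mathbb{R}^{d\times d}$ such that $Q_n\to 0$ as $n\to\infty$ and $Q_n$ is invertible for all sufficiently large $n\in\mathbb{N}$. Let $G\in\mathcal{F}_\infty:=\sigma(\bigcup_{k=0}^\infty\mathcal{F}_k)$ with $\mathbb{P}(G)>0$. Let $\mu$ be the $d$-dimensional normal distribution $\mathcal{N}_d(0,D)$ with mean vector $0\in\mathbb{R}^d$ and covariance matrix $D\in\mathbb{R}^{d\times d}$ ($D$ symmetric positive semidefinite). Assume that: (i) there exists an $\mathbb{R}^{d\times d}$-valued, $\mathcal{F}_\infty$-measurable random matrix $\eta$ such that $\mathbb{P}(G\cap\{\exists\,\eta^{-1}\})>0$ and $Q_nB_n^{-1}\to\eta$ in $\mathbb{P}_G$-probability as $n\to\infty$; (ii) $\lim_{K\to\infty}\sup_{n\in\mathbb{N}}\mathbb{P}_{G\cap\{\exists\,\eta^{-1}\}}(\|Q_nU_n\|>K)=0$; (iii) there exists an invertible matrix $P\in\mathbb{R}^{d\times d}$ with $\varrho(P)<1$ such that for each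 $r\in\mathbb{N}$, $B_nB_{n-r}^{-1}\to P^r$ in $\mathbb{P}_G$-probability as $n\to\infty$; (iv) for all $\theta\in\mathbb{R}^d$, $$\mathbb{E}_{\mathbb{P}}\bigl(e^{i\langle\theta,B_n\Delta U_n\rangle}\mid\mathcal{F}_{n-1}\bigr)\to\int_{\mathbb{R}^d}e^{i\langle\theta,x\rangle}\,\mu(dx)\quad\text{in }\mathbb{P}_{G\cap\{\exists\,\eta^{-1}\}}\text{-probability as }n\to\infty.$$ Then $$B_nU_n\to Z\quad\mathcal{F}_\infty\text{-mixing under }\mathbb{P}_{G\cap\{\exists\,\eta^{-1}\}}\text{ as }n\to\infty,$$ and $$Q_nU_n\to\eta Z\quad\mathcal{F}_\infty\text{-stably under }\mathbb{P}_{G\cap\{\exists\,\eta^{-1}\}}\text{ as }n\to\infty,$$ where $Z$ denotes a $d$-dimensional normally distributed random vector with mean vector $0\in\mathbb{R}^d$ and covariance matrix $\sum_{j=0}^\infty P^jD(P^j)^\top$, and $Z$ is $\mathbb{P}$-independent of $\mathcal{F}_\infty$.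
   Context: $\mathbb{Z}_+$ is the set of non-negative integers, $\mathbb{N}$ the set of positive integers. $\|\cdot\|$ and $\langle\cdot,\cdot\rangle$ are the Euclidean norm and inner product on $\mathbb{R}^d$; $\varrho(P)$ is the spectral radius of $P$. $\Delta U_0:=0$ and $\Delta U_n:=U_n-U_{n-1}$ for $n\in\mathbb{N}$. $\{\exists\,\eta^{-1}\}$ is the event that $\eta$ is invertible. For an event $A$ with $\mathbb{P}(A)>0$, $\mathbb{P}_A(\cdot):=\mathbb{P}(\cdot\cap A)/\mathbb{P}(A)$. Every random variable is defined on a (suitable) probability space $(\Omega,\mathcal{F},\mathbb{P})$; in particular this space is assumed to be rich enough to carry an i.i.d. sequence of random vectors with distribution $\mu$ independent of $\mathcal{F}_\infty$, and the vector $Z$. Stable and mixing convergence: let $\mathbb{Q}$ be a probability measure on $(\Omega,\mathcal{F})$, $\mathcal{G}\subset\mathcal{F}$ a sub-$\sigma$-field, and $X_n$ ($n\in\mathbb{N}$), $X$ be $\mathbb{R}^d$-valued random variables on $(\Omega,\mathcal{F})$. $X_n\to X$ $\mathcal{G}$-stably under $\mathbb{Q}$ as $n\to\infty$ if $\lim_{n\to\infty}\mathbb{E}_{\mathbb{Q}}(\xi\,\mathbb{E}_{\mathbb{Q}}(h(X_n)\mid\mathcal{G}))=\mathbb{E}_{\mathbb{Q}}(\xi\,\mathbb{E}_{\mathbb{Q}}(h(X)\mid\mathcal{G}))$ for all random variables $\xi:\Omega\to\mathbb{R}$ with $\mathbb{E}_{\mathbb{Q}}(|\xi|)<\infty$ and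 all bounded continuous $h:\mathbb{R}^d\to\mathbb{R}$ (equivalently, $\lim_n\mathbb{E}_{\mathbb{Q}}(\xi h(X_n))=\mathbb{E}_{\mathbb{Q}}(\xi h(X))$ for all $\mathcal{G}$-measurable $\mathbb{Q}$-integrable real $\xi$ and all bounded continuous $h$). $X_n\to X$ $\mathcal{G}$-mixing under $\mathbb{Q}$ if $X_n\to X$ $\mathcal{G}$-stably under $\mathbb{Q}$ and $\sigma(X)$ and $\mathcal{G}$ are independent under $\mathbb{Q}$. *)

theory Defs
  imports "HOL-Probability.Probability"
begin

section \<open>Matrices\<close>

text \<open>The power operation of the type class is componentwise on vectors, so matrix powers
  need their own recursion.\<close>

primrec matrix_power :: "real ^ 'd ^ 'd \<Rightarrow> nat \<Rightarrow> real ^ 'd ^ 'd" where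
  "matrix_power A 0 = mat 1"
| "matrix_power A (Suc k) = A ** matrix_power A k"

definition complex_eigenvalues :: "real ^ 'd ^ 'd \<Rightarrow> complex set" where
  "complex_eigenvalues A =
     {l. \<exists>v :: complex ^ 'd. v \<noteq> 0 \<and> (\<chi> i j. complex_of_real (A $ i $ j)) *v v = l *s v}"

definition spectral_radius :: "real ^ 'd ^ 'd \<Rightarrow> real" where
  "spectral_radius A = Max (norm ` complex_eigenvalues A)"

section \<open>Normal distributions\<close>

text \<open>Variance zero gives the point mass: covariance matrices may be singular.\<close>

definition normal_distribution :: "real \<Rightarrow> real \<Rightarrow> real measure" where
  "normal_distribution a v =
     (if v = 0 then return borel a
      else density lborel (\<lambda>x. ennreal (normal_density a (sqrt v) x)))"

definition mean_vector :: "(real ^ 'd) measure \<Rightarrow> real ^ 'd" where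
  "mean_vector \<mu> = (\<chi> i. \<integral>x. x $ i \<partial>\<mu>)"

definition covariance_matrix :: "(real ^ 'd) measure \<Rightarrow> real ^ 'd ^ 'd" where
  "covariance_matrix \<mu> =
     (\<chi> i j. \<integral>x. (x $ i - mean_vector \<mu> $ i) * (x $ j - mean_vector \<mu> $ j) \<partial>\<mu>)"

text \<open>A probability measure on \<open>real ^ 'd\<close> is normal if all its one-dimensional projections
  are (possibly degenerate) normal; \<open>m\<close> and \<open>D\<close> are its mean and covariance.\<close>

definition multivariate_normal ::
    "real ^ 'd \<Rightarrow> real ^ 'd ^ 'd \<Rightarrow> (real ^ 'd) measure \<Rightarrow> bool" where
  "multivariate_normal m D \<mu> \<longleftrightarrow>
     prob_space \<mu> \<and> sets \<mu> = sets borel \<and>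
     (\<forall>\<theta>. \<exists>a v. 0 \<le> v \<and> distr \<mu> borel (\<lambda>x. \<theta> \<bullet> x) = normal_distribution a v) \<and>
     mean_vector \<mu> = m \<and> covariance_matrix \<mu> = D"

section \<open>Processes, conditioning and independence\<close>

definition increment :: "(nat \<Rightarrow> 'a \<Rightarrow> real ^ 'd) \<Rightarrow> nat \<Rightarrow> 'a \<Rightarrow> real ^ 'd" where
  "increment U n \<omega> = (if n = 0 then 0 else U n \<omega> - U (n - 1) \<omega>)"

definition sigma_infinity :: "'a measure \<Rightarrow> (nat \<Rightarrow> 'a measure) \<Rightarrow> 'a measure" where
  "sigma_infinity M F = sigma (space M) (\<Union>k. sets (F k))"

definition invertible_event :: "'a measure \<Rightarrow> ('a \<Rightarrow> real ^ 'd ^ 'd) \<Rightarrow> 'a set" where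
  "invertible_event M \<eta> = {\<omega> \<in> space M. invertible (\<eta> \<omega>)}"

definition complex_cond_exp :: "'a measure \<Rightarrow> 'a measure \<Rightarrow> ('a \<Rightarrow> complex) \<Rightarrow> 'a \<Rightarrow> complex" where
  "complex_cond_exp M F f \<omega> =
     Complex (real_cond_exp M F (\<lambda>x. Re (f x)) \<omega>) (real_cond_exp M F (\<lambda>x. Im (f x)) \<omega>)"

text \<open>Independence of the \<open>\<sigma>\<close>-algebra generated by \<open>X\<close> and the \<open>\<sigma>\<close>-algebra \<open>G\<close>.\<close>

definition indep_of_algebra ::
    "'a measure \<Rightarrow> 'b measure \<Rightarrow> ('a \<Rightarrow> 'b) \<Rightarrow> 'a measure \<Rightarrow> bool" where
  "indep_of_algebra Q N X G \<longleftrightarrow>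
     prob_space.indep_set Q (sets (vimage_algebra (space Q) X N)) (sets G)"

section \<open>Modes of convergence\<close>

definition converges_in_prob ::
    "'a measure \<Rightarrow> (nat \<Rightarrow> 'a \<Rightarrow> 'b::metric_space) \<Rightarrow> ('a \<Rightarrow> 'b) \<Rightarrow> bool" where
  "converges_in_prob Q X Y \<longleftrightarrow>
     (\<forall>\<epsilon>>0. (\<lambda>n. measure Q {\<omega> \<in> space Q. dist (X n \<omega>) (Y \<omega>) > \<epsilon>}) \<longlonglongrightarrow> 0)"

text \<open>The weights \<open>\<xi>\<close> range over all \<open>Q\<close>-integrable random variables, not only over the
  \<open>G\<close>-measurable ones. The first conjuncts are the standing requirements on \<open>Q\<close>, \<open>G\<close>, \<open>X\<close>
  and \<open>Y\<close>; without them \<^const>\<open>real_cond_exp\<close> would take default values.\<close>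

definition converges_stably ::
    "'a measure \<Rightarrow> 'a measure \<Rightarrow> (nat \<Rightarrow> 'a \<Rightarrow> real ^ 'd) \<Rightarrow> ('a \<Rightarrow> real ^ 'd) \<Rightarrow> bool" where
  "converges_stably Q G X Y \<longleftrightarrow>
     prob_space Q \<and> subalgebra Q G \<and>
     (\<forall>n. X n \<in> borel_measurable Q) \<and> Y \<in> borel_measurable Q \<and>
     (\<forall>(\<xi> :: 'a \<Rightarrow> real) (h :: real ^ 'd \<Rightarrow> real).
        integrable Q \<xi> \<longrightarrow> continuous_on UNIV h \<longrightarrow> bounded (range h) \<longrightarrow>
        (\<lambda>n. \<integral>\<omega>. \<xi> \<omega> * real_cond_exp Q G (\<lambda>\<omega>'. h (X n \<omega>')) \<omega> \<partial>Q)
          \<longlonglongrightarrow> (\<integral>\<omega>. \<xi> \<omega> * real_cond_exp Q G (\<lambda>\<omega>'. h (Y \<omega>')) \<omega> \<partial>Q))"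

definition converges_mixing ::
    "'a measure \<Rightarrow> 'a measure \<Rightarrow> (nat \<Rightarrow> 'a \<Rightarrow> real ^ 'd) \<Rightarrow> ('a \<Rightarrow> real ^ 'd) \<Rightarrow> bool" where
  "converges_mixing Q G X Y \<longleftrightarrow> converges_stably Q G X Y \<and> indep_of_algebra Q borel Y G"

end

theory Submission
  imports Defs "HOL-Complex_Analysis.Complex_Analysis"
begin

text \<open>Put \<open>X\<^sub>n = B\<^sub>n U\<^sub>n\<close>, \<open>V\<^sub>n = B\<^sub>n \<Delta>U\<^sub>n\<close> and let \<open>N\<close> be the measure conditioned on \<open>A = G \<inter> {\<exists> \<eta>\<^sup>-\<^sup>1}\<close>.
  Since \<open>Q\<^sub>n B\<^sub>n\<^sup>-\<^sup>1 \<rightarrow> \<eta>\<close> with \<open>\<eta>\<close> invertible, tightness of \<open>Q\<^sub>n U\<^sub>n\<close> passes to \<open>X\<^sub>n\<close>, and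
  \<open>B\<^sub>n B\<^sub>n\<^sub>-\<^sub>1\<^sup>-\<^sup>1 \<rightarrow> P\<close> gives \<open>X\<^sub>n = P X\<^sub>n\<^sub>-\<^sub>1 + V\<^sub>n + o(1)\<close> in probability. For an \<open>\<F>\<^sub>\<infinity>\<close>-measurable
  integrable weight \<open>\<xi>\<close> let \<open>L\<^sub>n(\<theta>) = E\<^sub>N (\<xi> exp(i\<langle>\<theta>, X\<^sub>n\<rangle>))\<close>. Conditioning on \<open>\<F>\<^sub>n\<^sub>-\<^sub>1\<close>, which is
  legitimate after approximating \<open>\<xi> 1\<^sub>A\<close> by \<open>\<F>\<^sub>k\<close>-measurable weights, yields
  \<open>L\<^sub>n(\<theta>) = c(\<theta>) L\<^sub>n\<^sub>-\<^sub>1(P\<^sup>T \<theta>) + o(1)\<close> with \<open>c\<close> the characteristic function of \<open>\<mu>\<close>. Iterating \<open>r\<close> times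
  and using that \<open>L\<^sub>m\<close> is close to \<open>E\<^sub>N \<xi>\<close> near the origin, by tightness, while \<open>P\<^sup>r \<rightarrow> 0\<close>, we get
  \<open>L\<^sub>n(\<theta>) \<rightarrow> E\<^sub>N(\<xi>) \<Prod>\<^sub>j c((P\<^sup>j)\<^sup>T \<theta>)\<close>, and the product is the characteristic function of \<open>Z\<close>.
  Trigonometric polynomials then approximate bounded continuous functions. Applied to the pair
  \<open>(\<eta>, X\<^sub>n)\<close> this also gives the limit of \<open>Q\<^sub>n U\<^sub>n = \<eta> X\<^sub>n + o(1)\<close>.\<close>

text \<open>Hypothesis (iv) speaks of conditional expectations under \<open>M\<close>, the
  conclusion of a measure conditioned on an event of the limit sigma-field. Conditional expectations
  given \<open>F (n - 1)\<close> change with the measure, so the density of \<open>N\<close> is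
  moved into the weight and the cancellation takes place under \<open>M\<close>. Convergence in (iv)
  is given for each \<theta> separately. This suffices because the number r of iterations is fixed
  before n grows, so only finitely many arguments of the characteristic function occur; near the
  origin, tightness gives a neighbourhood that does not depend on n. Weights are signed or complex,
  so the weighted laws are not probability measures; tightness under \<open>N\<close> and uniform
  integrability of the weight take the place of weak convergence. Complex weights also settle the
  pair (\<eta>, X) without a second recursion: a factor exp(i<s, \<eta>>) is measurable for the
  limit sigma-field and is absorbed into the weight. Invertibility of \<eta> is what carries
  tightness from \<open>Q n *v U n\<close> to \<open>B n *v U n\<close>: a singular \<eta> could
  hide directions in which the latter is large.\<close>

no_notation fps_nth (infixl \<open>$\<close> 75)

section \<open>Real matrices\<close>

lemma bounded_bilinear_matrix_vector_mult: "bounded_bilinear ((*v) :: real ^ 'n ^ 'm \<Rightarrow> _)"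
  unfolding bilinear_conv_bounded_bilinear[symmetric] bilinear_def
  by (auto intro!: linearI simp: matrix_vector_right_distrib matrix_vector_mult_add_rdistrib
      matrix_vector_mult_scaleR scaleR_matrix_vector_assoc)

lemma bounded_bilinear_matrix_matrix_mult: "bounded_bilinear ((**) :: real ^ 'n ^ 'm \<Rightarrow> real ^ 'k ^ 'n \<Rightarrow> _)"
  unfolding bilinear_conv_bounded_bilinear[symmetric] bilinear_def
  by (auto intro!: linearI simp: vec_eq_iff matrix_matrix_mult_def algebra_simps sum.distrib sum_distrib_left)

lemma borel_measurable_bounded_bilinear:
  fixes prod :: "'b::{real_normed_vector, second_countable_topology} \<Rightarrow> 'c::{real_normed_vector, second_countable_topology} \<Rightarrow> 'd::real_normed_vector"
  assumes "bounded_bilinear prod" "f \<in> borel_measurable M" "g \<in> borel_measurable M"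
  shows "(\<lambda>x. prod (f x) (g x)) \<in> borel_measurable M"
  using assms(2,3)
  by (rule borel_measurable_continuous_Pair)
     (intro bounded_bilinear.continuous_on[OF assms(1)] continuous_intros)

lemmas measurable_matrix_vector_mult [measurable (raw)] =
  borel_measurable_bounded_bilinear[OF bounded_bilinear_matrix_vector_mult]

lemmas measurable_matrix_matrix_mult [measurable (raw)] =
  borel_measurable_bounded_bilinear[OF bounded_bilinear_matrix_matrix_mult]

lemma borel_measurable_vec_lambda:
  fixes f :: "'i::finite \<Rightarrow> 'a \<Rightarrow> 'b::euclidean_space"
  assumes "\<And>i. f i \<in> borel_measurable M"
  shows "(\<lambda>x. \<chi> i. f i x) \<in> borel_measurable M"
  using assms by (subst borel_measurable_euclidean_space) (auto simp: Basis_vec_def inner_axis)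

lemma continuous_on_det: "continuous_on UNIV (det :: real ^ 'd ^ 'd \<Rightarrow> real)"
  unfolding det_def[abs_def] by (intro continuous_intros)

lemma matrix_inv:
  assumes "invertible A"
  shows "A ** matrix_inv A = mat 1" "matrix_inv A ** A = mat 1"
  using assms someI_ex[of "\<lambda>A'. A ** A' = mat 1 \<and> A' ** A = mat 1"]
  by (auto simp: invertible_def matrix_inv_def)

text \<open>Cramer's rule, applied to the columns of the inverse. It exhibits the entries as
  quotients of polynomials in the entries of \<open>A\<close>, which is what makes inversion Borel
  measurable.\<close>

lemma matrix_inv_nth:
  fixes A :: "real ^ 'd ^ 'd"
  assumes "invertible A"
  shows "matrix_inv A $ k $ l = det (\<chi> i j. if j = k then axis l 1 $ i else A $ i $ j) / det A"
proof -
  have "A *v (matrix_inv A *v axis l 1) = axis l 1"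
    using matrix_inv(1)[OF assms] by (simp add: matrix_vector_mul_assoc)
  then have "matrix_inv A *v axis l 1 = (\<chi> k. det (\<chi> i j. if j = k then axis l 1 $ i else A $ i $ j) / det A)"
    using cramer[of A] assms invertible_det_nz[of A] by blast
  then have "(matrix_inv A *v axis l 1) $ k = det (\<chi> i j. if j = k then axis l 1 $ i else A $ i $ j) / det A"
    by simp
  then show ?thesis by (simp add: matrix_vector_mult_basis column_def)
qed

text \<open>On singular matrices \<^const>\<open>matrix_inv\<close> takes one fixed, unspecified value.\<close>

lemma measurable_matrix_inv [measurable]: "(matrix_inv :: real ^ 'd ^ 'd \<Rightarrow> _) \<in> borel_measurable borel"
proof -
  have det [measurable]: "(det :: real ^ 'd ^ 'd \<Rightarrow> real) \<in> borel_measurable borel"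
    by (intro borel_measurable_continuous_onI continuous_on_det)
  have cof [measurable]: "(\<lambda>A :: real ^ 'd ^ 'd. det (\<chi> i j. if j = k then axis l 1 $ i else A $ i $ j)) \<in> borel_measurable borel" for k l
  proof (intro borel_measurable_continuous_onI continuous_on_compose2[OF continuous_on_det])
    show "continuous_on UNIV (\<lambda>A :: real ^ 'd ^ 'd. \<chi> i j. if j = k then axis l 1 $ i else A $ i $ j)"
      by (intro continuous_on_vec_lambda, rename_tac i j, case_tac "j = k") (auto intro!: continuous_intros)
  qed auto
  have eq: "(matrix_inv :: real ^ 'd ^ 'd \<Rightarrow> _) = (\<lambda>A. if det A \<noteq> 0
      then (\<chi> k l. det (\<chi> i j. if j = k then axis l 1 $ i else A $ i $ j) / det A) else (SOME A. False))"
    (is "_ = (\<lambda>A. if _ then ?C A else _)")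
  proof
    fix A :: "real ^ 'd ^ 'd"
    show "matrix_inv A = (if det A \<noteq> 0 then ?C A else (SOME A. False))"
    proof (cases "invertible A")
      case True
      then show ?thesis using invertible_det_nz[of A] by (simp add: vec_eq_iff matrix_inv_nth)
    next
      case False
      then have "(\<lambda>A'. A ** A' = mat 1 \<and> A' ** A = mat 1) = (\<lambda>_. False)"
        by (auto simp: invertible_def fun_eq_iff)
      with False show ?thesis using invertible_det_nz[of A] by (simp add: matrix_inv_def)
    qed
  qed
  have "?C \<in> borel_measurable borel"
    by (intro borel_measurable_vec_lambda) measurable
  then show ?thesis unfolding eq by measurable
qed

lemma sets_invertible: "{A :: real ^ 'd ^ 'd. invertible A} \<in> sets borel"
proof -
  have "(det :: real ^ 'd ^ 'd \<Rightarrow> real) \<in> borel_measurable borel"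
    by (intro borel_measurable_continuous_onI continuous_on_det)
  from measurable_sets[OF this, of "- {0}"] show ?thesis
    by (simp add: vimage_def invertible_det_nz)
qed

lemma transpose_mult_inner: "(transpose A *v x) \<bullet> y = x \<bullet> (A *v y)" for A :: "real ^ 'n ^ 'm"
  by (metis dot_lmul_matrix transpose_matrix_vector transpose_transpose)

lemma transpose_matrix_power_Suc:
  "transpose (matrix_power P (Suc j)) *v x = transpose (matrix_power P j) *v (transpose P *v x)"
  by (simp add: matrix_transpose_mul matrix_vector_mul_assoc del: transpose_matrix_vector)

text \<open>Write R = Q B^-1 and x = B u, so that R x = Q u and x = E^-1 (Q u) - E^-1 (R - E) x. If
  R is close to E relative to the size of E^-1, the last term is at most half of |x| and is absorbed
  on the left. The constant \<open>c\<close> serves both bilinear products and enters that term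
  twice, whence the 2 c^2 in the hypothesis.\<close>

lemma norm_le_via_inverse:
  fixes E W B Q :: "real ^ 'd ^ 'd" and u :: "real ^ 'd"
  assumes c: "0 < c" "\<And>(A :: real ^ 'd ^ 'd) (x :: real ^ 'd). norm (A *v x) \<le> norm A * norm x * c"
    "\<And>(A :: real ^ 'd ^ 'd) (A' :: real ^ 'd ^ 'd). norm (A ** A') \<le> norm A * norm A' * c"
    and inv: "invertible E" "invertible B"
    and small: "dist (Q ** matrix_inv B) E * norm (matrix_inv E) \<le> 1 / (2 * c * c)"
  shows "norm (B *v u) \<le> (2 * c) * (norm (matrix_inv E) * norm (Q *v u))"
proof -
  let ?R = "Q ** matrix_inv B" and ?x = "B *v u"
  have Rx: "?R *v ?x = Q *v u"
    by (simp add: matrix_vector_mul_assoc matrix_mul_assoc[symmetric] matrix_inv(2)[OF inv(2)])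
  have "?x = matrix_inv E *v (E *v ?x)"
    by (simp add: matrix_vector_mul_assoc matrix_mul_assoc matrix_inv(2)[OF inv(1)])
  also have "\<dots> = matrix_inv E *v (Q *v u) - (matrix_inv E ** (?R - E)) *v ?x"
  proof -
    have "(matrix_inv E ** (?R - E)) *v ?x = matrix_inv E *v (?R *v ?x - E *v ?x)"
      by (simp only: matrix_vector_mul_assoc[symmetric] matrix_vector_mult_diff_rdistrib)
    then show ?thesis unfolding Rx by (simp add: matrix_vector_mult_diff_distrib)
  qed
  finally have "norm ?x \<le> norm (matrix_inv E *v (Q *v u)) + norm ((matrix_inv E ** (?R - E)) *v ?x)"
    by (metis norm_triangle_ineq4)
  also have "norm (matrix_inv E *v (Q *v u)) \<le> norm (matrix_inv E) * norm (Q *v u) * c" by (rule c)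
  also have "norm ((matrix_inv E ** (?R - E)) *v ?x) \<le> norm ?x / 2"
  proof -
    have "norm ((matrix_inv E ** (?R - E)) *v ?x) \<le> norm (matrix_inv E ** (?R - E)) * norm ?x * c" by (rule c)
    also have "\<dots> \<le> (norm (matrix_inv E) * norm (?R - E) * c) * norm ?x * c"
      using c(1,3) by (intro mult_right_mono) auto
    also have "\<dots> = (dist ?R E * norm (matrix_inv E)) * (c * c * norm ?x)" by (simp add: dist_norm)
    also have "\<dots> \<le> (1 / (2 * c * c)) * (c * c * norm ?x)"
      using small c(1) by (intro mult_right_mono) auto
    also have "\<dots> = norm ?x / 2" using c(1) by simp
    finally show ?thesis .
  qed
  finally have "norm ?x \<le> norm (matrix_inv E) * norm (Q *v u) * c + norm ?x / 2" by simp
  moreover have "(2 * c) * (norm (matrix_inv E) * norm (Q *v u)) = 2 * (norm (matrix_inv E) * norm (Q *v u) * c)"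
    by simp
  ultimately show ?thesis by linarith
qed

section \<open>Powers of a matrix of spectral radius less than one\<close>

lemma det_sub_scalar_eq_0_iff:
  fixes C :: "complex ^ 'd ^ 'd"
  shows "det (\<chi> i j. C $ i $ j - (if i = j then l else 0)) = 0 \<longleftrightarrow> (\<exists>v. v \<noteq> 0 \<and> C *v v = l *s v)"
proof -
  let ?M = "\<chi> i j. C $ i $ j - (if i = j then l else 0)"
  have "?M = C - mat l" by (simp add: vec_eq_iff mat_def)
  moreover have "mat l *v v = l *s v" for v :: "complex ^ 'd"
    by (simp add: vec_eq_iff matrix_vector_mult_def mat_def if_distrib[of "\<lambda>x. x * _"] cong: if_cong)
  ultimately have mult: "?M *v v = C *v v - l *s v" for v
    by (simp add: matrix_vector_mult_diff_rdistrib)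
  have "det ?M = 0 \<longleftrightarrow> \<not> (\<forall>x. ?M *v x = 0 \<longrightarrow> x = 0)"
    using invertible_det_nz[of ?M] invertible_left_inverse[of ?M] matrix_left_invertible_ker[of ?M]
    by blast
  then show ?thesis by (auto simp: mult)
qed

text \<open>Read off the eigenvalue equation at a coordinate where \<open>v\<close> has maximal
  modulus. The bound is crude, but it suffices to find a number that is not an eigenvalue.\<close>

lemma eigenvalue_norm_le:
  fixes C :: "complex ^ 'd ^ 'd"
  assumes "v \<noteq> 0" "C *v v = l *s v"
  shows "norm l \<le> (\<Sum>i\<in>UNIV. \<Sum>j\<in>UNIV. norm (C $ i $ j))"
proof -
  obtain i where i: "\<And>j. norm (v $ j) \<le> norm (v $ i)"
  proof -
    have "Max (range (\<lambda>j. norm (v $ j))) \<in> range (\<lambda>j. norm (v $ j))"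
      by (intro Max_in) auto
    then obtain i where "norm (v $ i) = Max (range (\<lambda>j. norm (v $ j)))"
      unfolding image_iff by metis
    then show ?thesis using that by (metis Max_ge finite_class.finite_UNIV finite_imageI rangeI)
  qed
  have pos: "norm (v $ i) > 0"
  proof (rule ccontr)
    assume "\<not> ?thesis"
    then have "v $ j = 0" for j using i[of j] by (metis norm_le_zero_iff linorder_not_le order.trans)
    with assms(1) show False by (simp add: vec_eq_iff)
  qed
  have "norm l * norm (v $ i) = norm (\<Sum>j\<in>UNIV. C $ i $ j * v $ j)"
    using arg_cong[OF assms(2), of "\<lambda>x. norm (x $ i)"]
    by (simp add: matrix_vector_mult_def norm_mult)
  also have "\<dots> \<le> (\<Sum>j\<in>UNIV. norm (C $ i $ j) * norm (v $ i))"
    by (rule order.trans[OF norm_sum]) (auto intro!: sum_mono mult_left_mono i simp: norm_mult)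
  also have "\<dots> = (\<Sum>j\<in>UNIV. norm (C $ i $ j)) * norm (v $ i)"
    by (simp add: sum_distrib_right)
  finally have "norm l \<le> (\<Sum>j\<in>UNIV. norm (C $ i $ j))" using pos by simp
  also have "\<dots> \<le> (\<Sum>i\<in>UNIV. \<Sum>j\<in>UNIV. norm (C $ i $ j))"
    by (rule member_le_sum) (auto intro: sum_nonneg)
  finally show ?thesis .
qed

text \<open>Finiteness makes the \<open>Max\<close> in \<open>spectral_radius\<close> a genuine
  upper bound for the eigenvalues. They are the roots of the characteristic polynomial, which is not
  the zero polynomial because eigenvalues are bounded.\<close>

lemma finite_eigenvalues:
  fixes C :: "complex ^ 'd ^ 'd"
  shows "finite {l. \<exists>v. v \<noteq> 0 \<and> C *v v = l *s v}"
proof -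
  define p where "p = det (\<chi> i j. [:C $ i $ j:] - (if i = j then [:0, 1:] else 0) :: complex poly ^ 'd ^ 'd)"
  have p: "poly p l = det (\<chi> i j. C $ i $ j - (if i = j then l else 0))" for l
    unfolding p_def det_def
    by (auto simp: poly_sum poly_prod intro!: sum.cong prod.cong)
  have roots: "{l. \<exists>v. v \<noteq> 0 \<and> C *v v = l *s v} = {l. poly p l = 0}"
    by (simp add: p det_sub_scalar_eq_0_iff)
  have "p \<noteq> 0"
  proof
    assume "p = 0"
    define K where "K = (\<Sum>i\<in>UNIV. \<Sum>j\<in>UNIV. norm (C $ i $ j))"
    from \<open>p = 0\<close> have "of_real (\<bar>K\<bar> + 1) \<in> {l. poly p l = 0}" by simp
    then obtain v where "v \<noteq> 0" "C *v v = of_real (\<bar>K\<bar> + 1) *s v" using roots by blast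
    from eigenvalue_norm_le[OF this] show False by (simp add: K_def)
  qed
  with roots show ?thesis by (simp add: poly_roots_finite)
qed

text \<open>The terms of a convergent series are bounded, so convergence at a point outside the
  closed unit disc forces geometric decay of the coefficients.\<close>

lemma power_bound_if_sums:
  fixes a :: "nat \<Rightarrow> complex"
  assumes "summable (\<lambda>n. a n * of_real r ^ n)" "r > 1"
  shows "\<exists>K. \<forall>n. norm (a n) \<le> K * (1 / r) ^ n"
proof -
  have "Bseq (\<lambda>n. a n * of_real r ^ n)"
    using assms(1) summable_LIMSEQ_zero convergentI convergent_imp_Bseq by blast
  then obtain K where K: "\<And>n. norm (a n * of_real r ^ n) \<le> K" by (metis BseqE)
  have "norm (a n) \<le> K * (1 / r) ^ n" for n
    using K[of n] assms(2) by (simp add: norm_mult norm_power power_divide field_simps)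
  then show ?thesis by blast
qed

lemma holomorphic_on_det:
  fixes M :: "complex \<Rightarrow> complex ^ 'd ^ 'd"
  assumes "\<And>i j. (\<lambda>z. M z $ i $ j) holomorphic_on A"
  shows "(\<lambda>z. det (M z)) holomorphic_on A"
  unfolding det_def by (intro holomorphic_intros assms)

text \<open>The entries of the resolvent \<open>(1 - z A)\<^sup>-\<^sup>1\<close> are holomorphic, by Cramer's rule, on a disc of
  radius larger than one, and their Taylor coefficients are the entries of the powers of \<open>A\<close>.\<close>

lemma matrix_power_entry_bound:
  fixes A :: "real ^ 'd ^ 'd"
  assumes "spectral_radius A < 1"
  shows "\<exists>q<1. q > 0 \<and> (\<forall>i j. \<exists>K. \<forall>n. \<bar>matrix_power A n $ i $ j\<bar> \<le> K * q ^ n)"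
proof -
  define C :: "complex ^ 'd ^ 'd" where "C = (\<chi> i j. complex_of_real (A $ i $ j))"
  \<comment> \<open>The floor 1/2 keeps \<rho> positive also for nilpotent \<open>A\<close>, so that
    the radius 1/\<rho> makes sense.\<close>
  define \<rho> where "\<rho> = max (spectral_radius A) (1/2)"
  have \<rho>: "0 < \<rho>" "\<rho> < 1" using assms by (auto simp: \<rho>_def)
  have eig: "norm l \<le> \<rho>" if "v \<noteq> 0" "C *v v = l *s v" for l v
  proof -
    have "l \<in> complex_eigenvalues A" using that by (auto simp: complex_eigenvalues_def C_def)
    moreover have "finite (complex_eigenvalues A)"
      unfolding complex_eigenvalues_def by (rule finite_eigenvalues)
    ultimately have "norm l \<le> spectral_radius A" unfolding spectral_radius_def by (intro Max_ge) auto
    then show ?thesis by (simp add: \<rho>_def)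
  qed
  define S where "S z = (\<chi> i j. (if i = j then 1 else 0) - z * C $ i $ j)" for z :: complex
  have S_mult: "S z *v v = v - z *s (C *v v)" for z v
  proof -
    have "S z = mat 1 - (\<chi> i j. z * C $ i $ j)" by (simp add: vec_eq_iff S_def mat_def)
    moreover have "(\<chi> i j. z * C $ i $ j) *v v = z *s (C *v v)"
      by (simp add: vec_eq_iff matrix_vector_mult_def sum_distrib_left mult.assoc)
    ultimately show ?thesis by (simp add: matrix_vector_mult_diff_rdistrib)
  qed
  have detS: "det (S z) \<noteq> 0" if z: "z \<in> ball 0 (1/\<rho>)" for z
  proof
    assume "det (S z) = 0"
    then obtain v where v: "v \<noteq> 0" "S z *v v = 0"
      using invertible_det_nz[of "S z"] invertible_left_inverse[of "S z"] matrix_left_invertible_ker[of "S z"]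
      by blast
    then have eq: "v = z *s (C *v v)" by (simp add: S_mult)
    have "z \<noteq> 0" using eq v(1) by auto
    have "C *v v = (1/z) *s v"
      using arg_cong[OF eq, of "\<lambda>x. (1/z) *s x"] \<open>z \<noteq> 0\<close> by (simp add: vector_smult_assoc)
    from eig[OF v(1) this] z \<open>z \<noteq> 0\<close> \<rho> show False
      by (simp add: norm_divide field_simps)
  qed
  define f where "f k l z = det (\<chi> i j. if j = k then axis l 1 $ i else S z $ i $ j) / det (S z)" for k l z
  have hol: "f k l holomorphic_on ball 0 (1/\<rho>)" for k l
  proof -
    have S: "(\<lambda>z. S z $ i $ j) holomorphic_on ball 0 (1/\<rho>)" for i j
      by (auto simp: S_def intro!: holomorphic_intros)
    have "(\<lambda>z. (\<chi> i j. if j = k then axis l 1 $ i else S z $ i $ j) $ i $ j) holomorphic_on ball 0 (1/\<rho>)" for i j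
      by (cases "j = k") (auto intro!: holomorphic_intros S)
    then show ?thesis
      unfolding f_def using detS by (intro holomorphic_on_divide holomorphic_on_det S) auto
  qed
  have f_eq: "f i l z - z * (\<Sum>k\<in>UNIV. C $ i $ k * f k l z) = (if i = l then 1 else 0)"
    if z: "z \<in> ball 0 (1/\<rho>)" for i l z
  proof -
    have "S z *v (\<chi> k. f k l z) = axis l 1"
      using cramer[OF detS[OF z], of "\<chi> k. f k l z" "axis l 1"] by (simp add: f_def)
    then have "(S z *v (\<chi> k. f k l z)) $ i = axis l 1 $ i" by simp
    then show ?thesis unfolding S_mult by (simp add: axis_def matrix_vector_mult_def)
  qed
  define a where "a k l = fps_expansion (f k l) 0" for k l
  have open0: "0 \<in> ball (0::complex) (1/\<rho>)" using \<rho> by simp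
  have a: "f k l has_fps_expansion a k l" for k l
    unfolding a_def by (rule has_fps_expansion_fps_expansion[OF _ open0 hol]) simp
  \<comment> \<open>The resolvent identity (1 - z C) f = 1, read as an identity of power series. Its
    coefficients say a_0 = 1 and a_(n+1) = C a_n, the recursion of the matrix powers.\<close>
  have rec: "a i l - fps_X * (\<Sum>k\<in>UNIV. fps_const (C $ i $ k) * a k l) = fps_const (if i = l then 1 else 0)" for i l
  proof (rule fps_expansion_unique_complex)
    show "(\<lambda>z. f i l z - z * (\<Sum>k\<in>UNIV. C $ i $ k * f k l z)) has_fps_expansion
        (a i l - fps_X * (\<Sum>k\<in>UNIV. fps_const (C $ i $ k) * a k l))"
      by (intro has_fps_expansion_diff a has_fps_expansion_mult has_fps_expansion_sum
          has_fps_expansion_fps_X has_fps_expansion_const)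
    have const: "(\<lambda>z::complex. (if i = l then 1 else 0)) has_fps_expansion fps_const (if i = l then 1 else 0)"
      by (rule has_fps_expansion_const)
    have ev: "\<forall>\<^sub>F z in nhds 0. (if i = l then 1 else 0) = f i l z - z * (\<Sum>k\<in>UNIV. C $ i $ k * f k l z)"
      using eventually_nhds_in_open[OF open_ball open0] by eventually_elim (simp only: f_eq)
    show "(\<lambda>z. f i l z - z * (\<Sum>k\<in>UNIV. C $ i $ k * f k l z)) has_fps_expansion
        fps_const (if i = l then 1 else 0)"
      by (rule has_fps_expansion_cong[THEN iffD1, OF ev refl const])
  qed
  have coeff: "fps_nth (a i l) n = complex_of_real (matrix_power A n $ i $ l)" for n i l
  proof (induction n arbitrary: i l)
    case 0
    have "fps_nth (a i l) 0 = (if i = l then 1 else 0)"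
      using arg_cong[OF rec[of i l], of "\<lambda>x. fps_nth x 0"] by simp
    then show ?case by (simp add: mat_def)
  next
    case (Suc n)
    have "fps_nth (a i l) (Suc n) = (\<Sum>k\<in>UNIV. C $ i $ k * fps_nth (a k l) n)"
      using arg_cong[OF rec[of i l], of "\<lambda>x. fps_nth x (Suc n)"] by (simp add: fps_sum_nth)
    then show ?case by (simp add: Suc.IH C_def matrix_matrix_mult_def)
  qed
  \<comment> \<open>Any radius strictly between 1 and 1/\<rho> would do; the decay rate is then q =
    1/r.\<close>
  define r where "r = (1 + 1/\<rho>) / 2"
  have r: "1 < r" "r < 1/\<rho>" using \<rho> by (auto simp: r_def field_simps)
  have "\<exists>K. \<forall>n. norm (complex_of_real (matrix_power A n $ i $ j)) \<le> K * (1/r) ^ n" for i j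
  proof (rule power_bound_if_sums)
    have "complex_of_real r \<in> ball 0 (1/\<rho>)" using r by simp
    from holomorphic_power_series[OF hol this, of i j]
    have "summable (\<lambda>n. (deriv ^^ n) (f i j) 0 / fact n * (complex_of_real r - 0) ^ n)"
      by (rule sums_summable)
    moreover have "(deriv ^^ n) (f i j) 0 / fact n = complex_of_real (matrix_power A n $ i $ j)" for n
      using coeff[of i j n] by (simp add: a_def fps_expansion_def)
    ultimately show "summable (\<lambda>n. complex_of_real (matrix_power A n $ i $ j) * complex_of_real r ^ n)"
      by simp
  qed (use r in simp)
  then show ?thesis using r by (intro exI[of _ "1/r"]) auto
qed

lemma norm_matrix_le_sum: "norm (A :: real ^ 'n ^ 'm) \<le> (\<Sum>i\<in>UNIV. \<Sum>j\<in>UNIV. \<bar>A $ i $ j\<bar>)"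
proof -
  have "norm A \<le> (\<Sum>i\<in>UNIV. norm (A $ i))" by (simp add: norm_vec_def L2_set_le_sum)
  also have "\<dots> \<le> (\<Sum>i\<in>UNIV. \<Sum>j\<in>UNIV. \<bar>A $ i $ j\<bar>)"
    by (intro sum_mono norm_le_l1_cart)
  finally show ?thesis .
qed

lemma matrix_power_norm_bound:
  fixes A :: "real ^ 'd ^ 'd"
  assumes "spectral_radius A < 1"
  obtains K q where "0 < q" "q < 1" "\<And>n. norm (matrix_power A n) \<le> K * q ^ n"
proof -
  obtain q where q: "0 < q" "q < 1" and "\<forall>i j. \<exists>K. \<forall>n. \<bar>matrix_power A n $ i $ j\<bar> \<le> K * q ^ n"
    using matrix_power_entry_bound[OF assms] by blast
  then obtain K where K: "\<And>i j n. \<bar>matrix_power A n $ i $ j\<bar> \<le> K i j * q ^ n" by metis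
  have "norm (matrix_power A n) \<le> (\<Sum>i\<in>UNIV. \<Sum>j\<in>UNIV. K i j) * q ^ n" for n
    by (rule order.trans[OF norm_matrix_le_sum]) (auto simp: sum_distrib_right intro!: sum_mono K)
  with q show ?thesis by (rule that)
qed

lemma norm_transpose: "norm (transpose A) = norm (A :: real ^ 'n ^ 'm)"
  unfolding norm_eq_sqrt_inner by (simp add: inner_vec_def transpose_def) (rule sum.swap)

text \<open>\<open>suminf\<close> is meaningful only for summable families. The powers of
  \<open>P\<close> decay like q^j, so the terms are O(q^(2j)).\<close>

lemma stationary_covariance_sums:
  fixes P D :: "real ^ 'd ^ 'd"
  assumes "spectral_radius P < 1"
  shows "(\<lambda>j. matrix_power P j ** D ** transpose (matrix_power P j)) sums
           (\<Sum>j. matrix_power P j ** D ** transpose (matrix_power P j))"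
proof -
  obtain K q where q: "0 < q" "q < 1" and K: "\<And>n. norm (matrix_power P n) \<le> K * q ^ n"
    using matrix_power_norm_bound[OF assms] by blast
  obtain c where c: "0 < c" "\<And>(A :: real ^ 'd ^ 'd) (B :: real ^ 'd ^ 'd). norm (A ** B) \<le> norm A * norm B * c"
    using bounded_bilinear.pos_bounded[OF bounded_bilinear_matrix_matrix_mult] by blast
  have bound: "norm (matrix_power P j ** D ** transpose (matrix_power P j)) \<le> (K^2 * norm D * c^2) * (q^2) ^ j" for j
  proof -
    let ?n = "norm (matrix_power P j)"
    have "norm (matrix_power P j ** D ** transpose (matrix_power P j))
        \<le> norm (matrix_power P j ** D) * ?n * c"
      using c(2)[of "matrix_power P j ** D" "transpose (matrix_power P j)"] by (simp add: norm_transpose)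
    also have "\<dots> \<le> (?n * norm D * c) * ?n * c"
      using c by (intro mult_right_mono) auto
    also have "\<dots> = ?n^2 * (norm D * c^2)" by (simp add: power2_eq_square)
    also have "\<dots> \<le> (K * q ^ j)^2 * (norm D * c^2)"
      using K by (intro mult_right_mono power_mono) auto
    also have "(K * q ^ j)^2 = K^2 * (q^2) ^ j"
      by (simp add: power_mult_distrib mult.commute flip: power_mult)
    also have "K^2 * (q^2) ^ j * (norm D * c^2) = (K^2 * norm D * c^2) * (q^2) ^ j" by simp
    finally show ?thesis .
  qed
  have "summable (\<lambda>j. (K^2 * norm D * c^2) * (q^2) ^ j)"
    using q by (intro summable_mult summable_geometric) (simp add: abs_square_less_1)
  then have "summable (\<lambda>j. matrix_power P j ** D ** transpose (matrix_power P j))"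
    by (rule summable_comparison_test') (rule bound)
  then show ?thesis by (rule summable_sums)
qed

lemma matrix_power_tendsto_0:
  assumes "spectral_radius P < 1"
  shows "(\<lambda>r. matrix_power P r) \<longlonglongrightarrow> 0"
proof -
  obtain K q where q: "0 < q" "q < 1" "\<And>n. norm (matrix_power P n) \<le> K * q ^ n"
    using matrix_power_norm_bound[OF assms] by blast
  have "(\<lambda>n. K * q ^ n) \<longlonglongrightarrow> 0"
    using q by (intro tendsto_mult_right_zero LIMSEQ_realpow_zero) auto
  then show ?thesis by (rule Lim_null_comparison[rotated]) (simp add: q)
qed

section \<open>Characteristic functions of normal distributions\<close>

text \<open>For v = 0 the law is a point mass. Otherwise standardisation reduces the characteristic
  function to that of the standard normal law, and the moments are known integrals against the
  density.\<close>

lemma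
  assumes v: "0 \<le> v"
  shows integrable_normal_distribution: "integrable (normal_distribution a v) (\<lambda>x. x)"
    and mean_normal_distribution: "(\<integral>x. x \<partial>normal_distribution a v) = a"
    and integrable_square_normal_distribution: "integrable (normal_distribution a v) (\<lambda>x. (x - a)\<^sup>2)"
    and variance_normal_distribution: "(\<integral>x. (x - a)\<^sup>2 \<partial>normal_distribution a v) = v"
    and char_normal_distribution:
      "char (normal_distribution a v) t = iexp (t * a) * of_real (exp (- (v * t\<^sup>2) / 2))"
proof -
  have "integrable (normal_distribution a v) (\<lambda>x. x) \<and>
    (\<integral>x. x \<partial>normal_distribution a v) = a \<and> integrable (normal_distribution a v) (\<lambda>x. (x - a)\<^sup>2) \<and>
    (\<integral>x. (x - a)\<^sup>2 \<partial>normal_distribution a v) = v \<and>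
    char (normal_distribution a v) t = iexp (t * a) * of_real (exp (- (v * t\<^sup>2) / 2))"
  proof (cases "v = 0")
    case True
    interpret prob_space "return borel a" by (rule prob_space_return) simp
    have int: "integrable (return borel a) f" if "f \<in> borel_measurable borel" for f :: "real \<Rightarrow> real"
      using that by (simp add: integrable_iff_bounded nn_integral_return)
    show ?thesis
      using True
      by (simp add: normal_distribution_def int integral_return char_def)
  next
    case False
    define s where "s = sqrt v"
    have s: "0 < s" "s\<^sup>2 = v" using v False by (auto simp: s_def)
    have N: "normal_distribution a v = density lborel (\<lambda>x. ennreal (normal_density a s x))"
      using False by (simp add: normal_distribution_def s_def)
    interpret prob_space "density lborel (\<lambda>x. ennreal (normal_density a s x))"
      by (rule prob_space_normal_density) (rule s)
    have "distributed (density lborel (\<lambda>x. ennreal (normal_density a s x))) lborel (\<lambda>x. x)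
        (\<lambda>x. ennreal (normal_density a s x))"
      by (auto simp: distributed_def distr_id2)
    then have "distributed (density lborel (\<lambda>x. ennreal (normal_density a s x))) lborel (\<lambda>x. (x - a) / s)
        (\<lambda>x. ennreal (std_normal_density x))"
      using normal_standard_normal_convert[OF s(1), of "\<lambda>x. x" a] by simp
    then have std: "std_normal_distribution = distr (normal_distribution a v) lborel (\<lambda>x. (x - a) / s)"
      by (simp add: distributed_def N)
    have eq: "iexp (t * x) = iexp (t * a) * iexp (t * s * ((x - a) / s))" for x
    proof -
      have "t * s * ((x - a) / s) = t * (x - a)" using s(1) by simp
      then have "complex_of_real (t * x) = of_real (t * a) + of_real (t * s * ((x - a) / s))"
        by (simp add: right_diff_distrib)
      then show ?thesis by (simp only: distrib_left exp_add)
    qed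
    have "char (normal_distribution a v) t = (\<integral>x. iexp (t * a) * iexp (t * s * ((x - a) / s)) \<partial>normal_distribution a v)"
      unfolding char_def by (rule Bochner_Integration.integral_cong[OF refl eq])
    also have "\<dots> = iexp (t * a) * (\<integral>x. iexp (t * s * x) \<partial>std_normal_distribution)"
      unfolding std by (subst integral_distr) (auto simp: N)
    also have "(\<integral>x. iexp (t * s * x) \<partial>std_normal_distribution) = of_real (exp (- (v * t\<^sup>2) / 2))"
      using fun_cong[OF char_std_normal_distribution, of "t * s"]
      by (simp add: char_def power_mult_distrib s(2) mult.commute)
    finally have "char (normal_distribution a v) t = iexp (t * a) * of_real (exp (- (v * t\<^sup>2) / 2))" .
    moreover have "integrable (normal_distribution a v) (\<lambda>x. x)" "(\<integral>x. x \<partial>normal_distribution a v) = a"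
      "integrable (normal_distribution a v) (\<lambda>x. (x - a)\<^sup>2)"
      unfolding N using s(1) integrable_normal_moment_nz_1[of s a] integral_normal_moment_nz_1[of s a]
        integrable_normal_moment[of s a 2]
      by (simp_all add: integrable_real_density integral_real_density)
    moreover have "(\<integral>x. (x - a)\<^sup>2 \<partial>normal_distribution a v) = v"
      unfolding N using s integral_normal_moment_even[of s a 1]
      by (simp add: integral_real_density fact_2)
    ultimately show ?thesis by (simp add: N)
  qed
  then show "integrable (normal_distribution a v) (\<lambda>x. x)"
    "(\<integral>x. x \<partial>normal_distribution a v) = a" "integrable (normal_distribution a v) (\<lambda>x. (x - a)\<^sup>2)"
    "(\<integral>x. (x - a)\<^sup>2 \<partial>normal_distribution a v) = v"
    "char (normal_distribution a v) t = iexp (t * a) * of_real (exp (- (v * t\<^sup>2) / 2))"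
    by blast+
qed

text \<open>The projection along \<theta> is normal with some unspecified parameters. Its first two
  moments, expanded in coordinates, identify them as 0 and the quadratic form of
  \<open>D\<close>.\<close>

lemma char_multivariate_normal:
  fixes \<mu> :: "(real ^ 'd) measure"
  assumes \<mu>: "multivariate_normal 0 D \<mu>"
  shows "(\<integral>x. cis (\<theta> \<bullet> x) \<partial>\<mu>) = of_real (exp (- (\<theta> \<bullet> (D *v \<theta>)) / 2))"
proof -
  interpret prob_space \<mu> using \<mu> by (simp add: multivariate_normal_def)
  have sets [measurable_cong]: "sets \<mu> = sets borel" using \<mu> by (simp add: multivariate_normal_def)
  have proj: "\<exists>a v. 0 \<le> v \<and> distr \<mu> borel (\<lambda>x. \<theta> \<bullet> x) = normal_distribution a v" for \<theta>
    using \<mu> by (simp add: multivariate_normal_def)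
  have mean: "(\<integral>x. x $ i \<partial>\<mu>) = 0" for i
    using \<mu> by (auto simp: multivariate_normal_def mean_vector_def vec_eq_iff)
  have cov: "(\<integral>x. x $ i * x $ j \<partial>\<mu>) = D $ i $ j" for i j
    using \<mu> by (auto simp: multivariate_normal_def covariance_matrix_def vec_eq_iff)
  \<comment> \<open>A non-integrable function has integral 0, so the equations for the moments carry
    no information until integrability is known. It comes from the coordinate projections, which are
    one-dimensional normal.\<close>
  have int: "integrable \<mu> (\<lambda>x. x $ i)" and int2: "integrable \<mu> (\<lambda>x. (x $ i)\<^sup>2)" for i
  proof -
    obtain a v where v: "0 \<le> v" and d: "distr \<mu> borel (\<lambda>x. x $ i) = normal_distribution a v"
      using proj[of "axis i 1"] by (auto simp: inner_axis')
    have "integrable (distr \<mu> borel (\<lambda>x. x $ i)) (\<lambda>x. x)"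
      unfolding d by (rule integrable_normal_distribution[OF v])
    then show i1: "integrable \<mu> (\<lambda>x. x $ i)" by (simp add: integrable_distr_eq)
    have "integrable (distr \<mu> borel (\<lambda>x. x $ i)) (\<lambda>x. (x - a)\<^sup>2)"
      unfolding d by (rule integrable_square_normal_distribution[OF v])
    then have "integrable \<mu> (\<lambda>x. (x $ i - a)\<^sup>2 + 2 * a * x $ i - a\<^sup>2)"
      using i1 by (simp add: integrable_distr_eq)
    then show "integrable \<mu> (\<lambda>x. (x $ i)\<^sup>2)" by (simp add: power2_diff mult_ac)
  qed
  have int_prod: "integrable \<mu> (\<lambda>x. x $ i * x $ j)" for i j
  proof (rule Bochner_Integration.integrable_bound)
    show "integrable \<mu> (\<lambda>x. (x $ i)\<^sup>2 + (x $ j)\<^sup>2)" using int2 by simp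
    have "\<bar>a * b\<bar> \<le> \<bar>a\<^sup>2 + b\<^sup>2\<bar>" for a b :: real
    proof -
      have "2 * (\<bar>a\<bar> * \<bar>b\<bar>) \<le> a\<^sup>2 + b\<^sup>2" using sum_squares_bound[of "\<bar>a\<bar>" "\<bar>b\<bar>"] by simp
      moreover have "0 \<le> \<bar>a\<bar> * \<bar>b\<bar>" by simp
      ultimately show ?thesis unfolding abs_mult by linarith
    qed
    then show "AE x in \<mu>. norm (x $ i * x $ j) \<le> norm ((x $ i)\<^sup>2 + (x $ j)\<^sup>2)" by simp
  qed measurable
  obtain a v where v: "0 \<le> v" and d: "distr \<mu> borel (\<lambda>x. \<theta> \<bullet> x) = normal_distribution a v"
    using proj by blast
  have "a = (\<integral>x. \<theta> \<bullet> x \<partial>\<mu>)"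
    using mean_normal_distribution[OF v, of a] by (simp add: d[symmetric] integral_distr)
  also have "\<dots> = 0" using int mean by (simp add: inner_vec_def)
  finally have a: "a = 0" .
  have "v = (\<integral>x. x\<^sup>2 \<partial>distr \<mu> borel (\<lambda>x. \<theta> \<bullet> x))"
    using variance_normal_distribution[OF v, of a] by (simp add: d a)
  also have "\<dots> = (\<integral>x. (\<theta> \<bullet> x)\<^sup>2 \<partial>\<mu>)" by (simp add: integral_distr)
  also have "\<dots> = (\<integral>x. (\<Sum>i\<in>UNIV. \<Sum>j\<in>UNIV. \<theta> $ i * \<theta> $ j * (x $ i * x $ j)) \<partial>\<mu>)"
    by (simp add: inner_vec_def power2_eq_square sum_product mult_ac)
  also have "\<dots> = (\<Sum>i\<in>UNIV. \<Sum>j\<in>UNIV. \<theta> $ i * \<theta> $ j * D $ i $ j)"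
    using int_prod cov by simp
  also have "\<dots> = \<theta> \<bullet> (D *v \<theta>)"
    by (simp add: inner_vec_def matrix_vector_mult_def sum_distrib_left mult_ac)
  finally have v': "v = \<theta> \<bullet> (D *v \<theta>)" .
  have "(\<integral>x. cis (\<theta> \<bullet> x) \<partial>\<mu>) = char (normal_distribution a v) 1"
    unfolding d[symmetric] char_def by (simp add: integral_distr cis_conv_exp)
  then show ?thesis using v unfolding v' a by (simp add: char_normal_distribution)
qed

text \<open>Moving a transpose across the inner product turns the quadratic form of D at A^T
  \<theta> into that of A D A^T at \<theta>. The exponents of the factors then add up to a partial
  sum of the covariance series.\<close>

lemma gaussian_char_product_limit:
  fixes P D :: "real ^ 'd ^ 'd"
  assumes "spectral_radius P < 1"
  defines "\<Sigma> \<equiv> \<Sum>j. matrix_power P j ** D ** transpose (matrix_power P j)"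
  defines "c \<equiv> \<lambda>\<theta>. complex_of_real (exp (- (\<theta> \<bullet> (D *v \<theta>)) / 2))"
  shows "(\<lambda>r. \<Prod>j<r. c (transpose (matrix_power P j) *v \<theta>)) \<longlonglongrightarrow> of_real (exp (- (\<theta> \<bullet> (\<Sigma> *v \<theta>)) / 2))"
proof -
  let ?S = "\<lambda>j. matrix_power P j ** D ** transpose (matrix_power P j)"
  have S: "(\<lambda>r. \<Sum>j<r. ?S j) \<longlonglongrightarrow> \<Sigma>"
    using stationary_covariance_sums[OF assms(1), of D] by (simp add: sums_def \<Sigma>_def)
  have quad: "(transpose A *v \<theta>) \<bullet> (D *v (transpose A *v \<theta>)) = \<theta> \<bullet> ((A ** D ** transpose A) *v \<theta>)" for A
    by (simp add: transpose_mult_inner matrix_vector_mul_assoc matrix_mul_assoc del: transpose_matrix_vector)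
  have "(\<Prod>j<r. c (transpose (matrix_power P j) *v \<theta>)) = of_real (exp (- (\<theta> \<bullet> ((\<Sum>j<r. ?S j) *v \<theta>)) / 2))" for r
  proof -
    have "(\<Sum>j<r. ?S j) *v \<theta> = (\<Sum>j<r. ?S j *v \<theta>)"
      by (induction r) (simp_all add: matrix_vector_mult_add_rdistrib)
    then have "(\<Prod>j<r. exp (- (\<theta> \<bullet> (?S j *v \<theta>)) / 2)) = exp (- (\<theta> \<bullet> ((\<Sum>j<r. ?S j) *v \<theta>)) / 2)"
      by (simp add: exp_sum[symmetric] inner_sum_right sum_divide_distrib sum_negf)
    then show ?thesis by (simp only: c_def quad of_real_prod[symmetric])
  qed
  moreover have "(\<lambda>r. (\<Sum>j<r. ?S j) *v \<theta>) \<longlonglongrightarrow> \<Sigma> *v \<theta>"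
    by (rule bounded_bilinear.tendsto[OF bounded_bilinear_matrix_vector_mult S tendsto_const])
  ultimately show ?thesis by (auto intro!: tendsto_intros)
qed

section \<open>Weighted integrals\<close>

context finite_measure
begin

text \<open>A single integrable function is uniformly integrable: cut the weight at level k. Where Y
  \<le> \<delta> the integral is at most \<delta> times the L1 norm of the weight; where Y >
  \<delta> it is at most C k \<delta> plus C times the tail \<open>T k\<close>. The same \<delta>
  serves as threshold and as probability, and it does not depend on Y, so Y may later vary with
  n.\<close>

lemma weighted_integral_small:
  fixes \<xi> :: "'a \<Rightarrow> 'b::{banach, second_countable_topology}"
  assumes \<xi>: "integrable M \<xi>" and \<epsilon>: "0 < \<epsilon>" and C: "0 \<le> C"
  obtains \<delta> where "0 < \<delta>"
    "\<And>Y. Y \<in> borel_measurable M \<Longrightarrow> AE x in M. 0 \<le> Y x \<and> Y x \<le> C \<Longrightarrow>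
       measure M {x \<in> space M. Y x > \<delta>} < \<delta> \<Longrightarrow> (\<integral>x. norm (\<xi> x) * Y x \<partial>M) < \<epsilon>"
proof -
  have [measurable]: "\<xi> \<in> borel_measurable M" using \<xi> by simp
  define T where "T k x = (if norm (\<xi> x) > real k then norm (\<xi> x) else 0)" for k x
  have T_int: "integrable M (T k)" for k
    by (rule Bochner_Integration.integrable_bound[OF \<xi>]) (auto simp: T_def[abs_def])
  have "(\<lambda>k. \<integral>x. T k x \<partial>M) \<longlonglongrightarrow> (\<integral>x. 0 \<partial>M)"
  proof (rule integral_dominated_convergence[where w="\<lambda>x. norm (\<xi> x)"])
    show "AE x in M. (\<lambda>k. T k x) \<longlonglongrightarrow> 0"
    proof (rule AE_I2)
      fix x
      obtain k0 :: nat where "norm (\<xi> x) \<le> real k0" using real_arch_simple by blast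
      then have "\<forall>\<^sub>F k in sequentially. T k x = 0"
        by (auto simp: T_def eventually_sequentially intro!: exI[of _ k0])
      then show "(\<lambda>k. T k x) \<longlonglongrightarrow> 0" by (rule tendsto_eventually)
    qed
    show "T k \<in> borel_measurable M" for k using T_int by simp
  qed (use \<xi> in \<open>auto simp: T_def\<close>)
  then have "(\<lambda>k. C * (\<integral>x. T k x \<partial>M)) \<longlonglongrightarrow> 0" by (auto intro: tendsto_mult_right_zero)
  then have "\<forall>\<^sub>F k in sequentially. C * (\<integral>x. T k x \<partial>M) < \<epsilon> / 3"
    using \<epsilon> by (auto dest: order_tendstoD(2)[of _ _ _ "\<epsilon> / 3"])
  then obtain k where k: "C * (\<integral>x. T k x \<partial>M) < \<epsilon> / 3" by (auto simp: eventually_sequentially)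
  define I where "I = (\<integral>x. norm (\<xi> x) \<partial>M)"
  have I: "0 \<le> I" by (simp add: I_def)
  \<comment> \<open>The two terms hold the first two contributions below \<epsilon>/3 each; the
    summand 1 prevents division by 0.\<close>
  define \<delta> where "\<delta> = min (\<epsilon> / (3 * (I + 1))) (\<epsilon> / (3 * (C * real k + 1)))"
  have \<delta>: "0 < \<delta>" using \<epsilon> I C by (auto simp: \<delta>_def intro!: divide_pos_pos add_nonneg_pos)
  have \<delta>1: "\<delta> * I \<le> \<epsilon> / 3"
  proof -
    have "\<delta> * I \<le> \<epsilon> / (3 * (I + 1)) * I" using I by (intro mult_right_mono) (auto simp: \<delta>_def)
    also have "\<dots> \<le> \<epsilon> / 3" using \<epsilon> I by (simp add: field_simps)
    finally show ?thesis .
  qed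
  have \<delta>2: "\<delta> * (C * real k) \<le> \<epsilon> / 3"
  proof -
    have Ck: "0 \<le> C * real k" using C by simp
    then have "\<delta> * (C * real k) \<le> \<epsilon> / (3 * (C * real k + 1)) * (C * real k)"
      by (intro mult_right_mono) (auto simp: \<delta>_def)
    also have "\<dots> \<le> \<epsilon> / 3" using \<epsilon> Ck
      by (simp add: divide_simps)
    finally show ?thesis .
  qed
  show ?thesis
  proof (rule that[OF \<delta>])
    fix Y assume Y [measurable]: "Y \<in> borel_measurable M"
      and bd: "AE x in M. 0 \<le> Y x \<and> Y x \<le> C" and small: "measure M {x \<in> space M. Y x > \<delta>} < \<delta>"
    let ?S = "{x \<in> space M. Y x > \<delta>}"
    have int_bound: "integrable M (\<lambda>x. \<delta> * norm (\<xi> x) + (C * real k) * indicator ?S x + C * T k x)"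
      using \<xi> T_int by (auto simp: fmeasurable_eq_sets less_top[symmetric])
    have int_Y: "integrable M (\<lambda>x. norm (\<xi> x) * Y x)"
    proof (rule Bochner_Integration.integrable_bound)
      show "integrable M (\<lambda>x. C * norm (\<xi> x))" using \<xi> by simp
      show "AE x in M. norm (norm (\<xi> x) * Y x) \<le> norm (C * norm (\<xi> x))"
        using bd by eventually_elim (auto simp: abs_mult mult.commute[of _ "norm _"] intro!: mult_left_mono)
    qed measurable
    have "(\<integral>x. norm (\<xi> x) * Y x \<partial>M) \<le> (\<integral>x. \<delta> * norm (\<xi> x) + (C * real k) * indicator ?S x + C * T k x \<partial>M)"
    proof (rule integral_mono_AE[OF int_Y int_bound])
      show "AE x in M. norm (\<xi> x) * Y x \<le> \<delta> * norm (\<xi> x) + (C * real k) * indicator ?S x + C * T k x"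
        using bd AE_space
      proof eventually_elim
        case (elim x)
        show ?case
        proof (cases "Y x > \<delta>")
          case False
          then have "norm (\<xi> x) * Y x \<le> \<delta> * norm (\<xi> x)" by (simp add: mult.commute mult_right_mono)
          moreover have "0 \<le> C * T k x" using C by (simp add: T_def)
          ultimately show ?thesis using False by simp
        next
          case True
          have le: "norm (\<xi> x) * Y x \<le> C * norm (\<xi> x)"
            using elim by (simp add: mult.commute mult_right_mono)
          have "C * norm (\<xi> x) \<le> C * real k + C * T k x"
            using C by (simp add: T_def mult_left_mono)
          moreover have "0 \<le> \<delta> * norm (\<xi> x)" using \<delta> by simp
          moreover have "indicator ?S x = (1::real)" using True elim by simp
          ultimately show ?thesis using le by simp
        qed
      qed
    qed
    also have "\<dots> = \<delta> * I + C * real k * measure M ?S + C * (\<integral>x. T k x \<partial>M)"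
      using \<xi> T_int by (simp add: I_def less_top[symmetric])
    also have "C * real k * measure M ?S \<le> \<delta> * (C * real k)"
      using small C by (simp add: mult.commute[of _ "C * real k"] mult_left_mono)
    finally show "(\<integral>x. norm (\<xi> x) * Y x \<partial>M) < \<epsilon>" using \<delta>1 \<delta>2 k by linarith
  qed
qed

lemma integrable_mult_bounded:
  fixes f g :: "'a \<Rightarrow> 'b::{real_normed_algebra, banach, second_countable_topology}"
  assumes "integrable M f" "g \<in> borel_measurable M" "AE x in M. norm (g x) \<le> C"
  shows "integrable M (\<lambda>x. f x * g x)"
proof (rule Bochner_Integration.integrable_bound)
  show "integrable M (\<lambda>x. C * norm (f x))" using assms(1) by simp
  show "(\<lambda>x. f x * g x) \<in> borel_measurable M" using assms by measurable
  show "AE x in M. norm (f x * g x) \<le> norm (C * norm (f x))"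
    using assms(3)
  proof eventually_elim
    case (elim x)
    have "norm (f x * g x) \<le> norm (g x) * norm (f x)"
      using norm_mult_ineq[of "f x" "g x"] by (simp add: mult.commute)
    also have "\<dots> \<le> C * norm (f x)" using elim by (simp add: mult_right_mono)
    also have "\<dots> \<le> norm (C * norm (f x))" by (simp add: abs_mult mult_right_mono)
    finally show ?case .
  qed
qed

text \<open>Replacing f by \<open>s m\<close> costs at most C times their L1 distance, uniformly in
  n, so m can be fixed before n tends to infinity.\<close>

lemma L1_limit_weights:
  fixes f :: "'a \<Rightarrow> complex"
  assumes f: "integrable M f" and s: "\<And>m. integrable M (s m)"
    and lim: "(\<lambda>m::nat. \<integral>x. norm (s m x - f x) \<partial>M) \<longlonglongrightarrow> 0"
    and D: "\<And>n. D n \<in> borel_measurable M" "\<And>n. AE x in M. norm (D n x) \<le> C"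
    and P: "\<And>m. (\<lambda>n::nat. \<integral>x. s m x * D n x \<partial>M) \<longlonglongrightarrow> 0"
  shows "(\<lambda>n. \<integral>x. f x * D n x \<partial>M) \<longlonglongrightarrow> 0"
proof (rule LIMSEQ_I)
  fix \<epsilon> :: real assume \<epsilon>: "0 < \<epsilon>"
  have "(\<lambda>m. (\<integral>x. norm (s m x - f x) \<partial>M) * C) \<longlonglongrightarrow> 0"
    using tendsto_mult_left_zero[OF lim] .
  then have "\<forall>\<^sub>F m in sequentially. (\<integral>x. norm (s m x - f x) \<partial>M) * C < \<epsilon> / 2"
    using \<epsilon> by (auto dest: order_tendstoD(2)[of _ _ _ "\<epsilon> / 2"])
  then obtain m where m: "(\<integral>x. norm (s m x - f x) \<partial>M) * C < \<epsilon> / 2" by (auto simp: eventually_sequentially)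
  obtain n0 where n0: "\<And>n. n \<ge> n0 \<Longrightarrow> norm (\<integral>x. s m x * D n x \<partial>M) < \<epsilon> / 2"
    using LIMSEQ_D[OF P[of m], of "\<epsilon> / 2"] \<epsilon> by auto
  show "\<exists>n0. \<forall>n\<ge>n0. norm ((\<integral>x. f x * D n x \<partial>M) - 0) < \<epsilon>"
  proof (intro exI allI impI)
    fix n assume n: "n \<ge> n0"
    have int: "integrable M (\<lambda>x. s m x - f x)" using f s by simp
    have "(\<integral>x. s m x * D n x \<partial>M) - (\<integral>x. f x * D n x \<partial>M) = (\<integral>x. (s m x - f x) * D n x \<partial>M)"
      using integrable_mult_bounded[OF f D] integrable_mult_bounded[OF s D] by (simp add: left_diff_distrib)
    also have "norm \<dots> \<le> (\<integral>x. norm ((s m x - f x) * D n x) \<partial>M)"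
      by (rule integral_norm_bound)
    also have "\<dots> \<le> (\<integral>x. norm (s m x - f x) * C \<partial>M)"
    proof (rule integral_mono_AE)
      show "AE x in M. norm ((s m x - f x) * D n x) \<le> norm (s m x - f x) * C"
        using D(2)[of n] by eventually_elim (simp add: norm_mult mult_left_mono)
    qed (use integrable_mult_bounded[OF int D] int in auto)
    also have "\<dots> = (\<integral>x. norm (s m x - f x) \<partial>M) * C" by simp
    finally show "norm ((\<integral>x. f x * D n x \<partial>M) - 0) < \<epsilon>" 
      using m n0[OF n] norm_triangle_sub[of "\<integral>x. f x * D n x \<partial>M" "\<integral>x. s m x * D n x \<partial>M"]
      by (simp add: norm_minus_commute)
  qed
qed

end


section \<open>Weights measurable with respect to the limit sigma-field\<close>

lemma indicator_union_L1:
  fixes A :: "nat \<Rightarrow> 'a set"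
  assumes M: "finite_measure M" and A: "\<And>i. A i \<in> sets M"
  shows "(\<lambda>m. \<integral>x. norm (indicator (\<Union>i<m. A i) x - indicator (\<Union>i. A i) x :: complex) \<partial>M) \<longlonglongrightarrow> 0"
proof -
  interpret finite_measure M by (rule M)
  have [measurable]: "A i \<in> sets M" for i by (rule A)
  have "(\<lambda>m. \<integral>x. norm (indicator (\<Union>i<m. A i) x - indicator (\<Union>i. A i) x :: complex) \<partial>M) \<longlonglongrightarrow> (\<integral>x. 0 \<partial>M)"
  proof (rule integral_dominated_convergence[where w="\<lambda>_. 1"])
    show "AE x in M. (\<lambda>m. norm (indicator (\<Union>i<m. A i) x - indicator (\<Union>i. A i) x :: complex)) \<longlonglongrightarrow> 0"
    proof (rule AE_I2)
      fix x
      show "(\<lambda>m. norm (indicator (\<Union>i<m. A i) x - indicator (\<Union>i. A i) x :: complex)) \<longlonglongrightarrow> 0"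
      proof (cases "x \<in> (\<Union>i. A i)")
        case True
        then obtain i where "x \<in> A i" by blast
        then have "\<forall>\<^sub>F m in sequentially. norm (indicator (\<Union>i<m. A i) x - indicator (\<Union>i. A i) x :: complex) = 0"
          by (auto simp: eventually_sequentially indicator_def intro!: exI[of _ "Suc i"])
        then show ?thesis by (rule tendsto_eventually)
      qed (simp add: indicator_def)
    qed
  qed (auto simp: indicator_def)
  then show ?thesis by simp
qed

lemma sets_sigma_infinity:
  assumes "\<And>n. sets (F n) \<subseteq> Pow (space M)"
  shows "sets (sigma_infinity M F) = sigma_sets (space M) (\<Union>k. sets (F k))"
  unfolding sigma_infinity_def using assms by (intro sets_measure_of) blast

lemma subalgebra_sigma_infinity:
  assumes "\<And>n. subalgebra M (F n)"
  shows "subalgebra M (sigma_infinity M F)"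
proof -
  have "(\<Union>k. sets (F k)) \<subseteq> sets M" using assms by (auto simp: subalgebra_def)
  then have "sets (sigma_infinity M F) \<subseteq> sets M"
    unfolding sigma_infinity_def by (intro sets.sigma_sets_subset sets_measure_of[THEN equalityD1, THEN subset_trans]) (auto dest: sets.sets_into_space)
  then show ?thesis by (simp add: subalgebra_def sigma_infinity_def space_measure_of_conv)
qed

text \<open>Since the \<open>D n\<close> are uniformly bounded, the events with vanishing integrals
  form a Dynkin class, and the union of the \<open>F k\<close> is an intersection-stable generator.
  From events the claim passes to integrable functions by linearity and L1 limits.\<close>

lemma sigma_infinity_weights_vanish:
  fixes \<xi> :: "'a \<Rightarrow> complex" and F :: "nat \<Rightarrow> 'a measure"
  assumes M: "prob_space M" and filt: "filtration (space M) F" and sub: "\<And>n. subalgebra M (F n)"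
    and D: "\<And>n. D n \<in> borel_measurable M" "\<And>n. AE x in M. norm (D n x) \<le> C"
    and null: "\<And>k E. E \<in> sets (F k) \<Longrightarrow> (\<lambda>n::nat. \<integral>x. indicator E x * D n x \<partial>M) \<longlonglongrightarrow> 0"
    and \<xi>: "integrable M \<xi>" "\<xi> \<in> borel_measurable (sigma_infinity M F)"
  shows "(\<lambda>n. \<integral>x. \<xi> x * D n x \<partial>M) \<longlonglongrightarrow> 0"
proof -
  interpret prob_space M by (rule M)
  interpret filtration "space M" F by (rule filt)
  let ?G = "\<Union>k. sets (F k)"
  let ?P = "\<lambda>E. (\<lambda>n. \<integral>x. indicator E x * D n x \<partial>M) \<longlonglongrightarrow> 0"
  have G_sub: "?G \<subseteq> Pow (space M)" using sets.sets_into_space space_F by fast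
  have sets_inf: "sets (sigma_infinity M F) = sigma_sets (space M) ?G"
    using G_sub by (intro sets_sigma_infinity) auto
  have subinf: "subalgebra M (sigma_infinity M F)" by (rule subalgebra_sigma_infinity) (rule sub)
  have in_M: "E \<in> sets M" if "E \<in> sigma_sets (space M) ?G" for E
    using subinf that sets_inf by (auto simp: subalgebra_def)
  have ind_int: "integrable M (indicator E :: _ \<Rightarrow> complex)" if "E \<in> sets M" for E
  proof -
    have "integrable M (\<lambda>x. indicator E x *\<^sub>R (1 :: complex))"
      using that by (intro integrable_scaleR_left) (simp add: less_top[symmetric])
    moreover have "(\<lambda>x. indicator E x *\<^sub>R (1 :: complex)) = indicator E"
      by (auto simp: indicator_def)
    ultimately show ?thesis by simp
  qed
  have ind: "?P E" if "E \<in> sigma_sets (space M) ?G" for E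
  proof -
    have "Int_stable ?G"
    proof (rule Int_stableI)
      fix a b assume "a \<in> ?G" "b \<in> ?G"
      then obtain i j where "a \<in> sets (F i)" "b \<in> sets (F j)" by blast
      then have "a \<in> sets (F (max i j))" "b \<in> sets (F (max i j))"
        using sets_F_mono[of i "max i j"] sets_F_mono[of j "max i j"] by auto
      then show "a \<inter> b \<in> ?G" by blast
    qed
    from this G_sub that show ?thesis
    proof (induction rule: sigma_sets_induct_disjoint)
      case (basic A)
      then show ?case using null by blast
    next
      case empty
      show ?case by simp
    next
      case (compl A)
      have "space M \<in> sets (F 0)" using sets.top[of "F 0"] space_F[of 0] by simp
      from tendsto_diff[OF null[OF this] compl(2)]
      have "(\<lambda>n. (\<integral>x. indicator (space M) x * D n x \<partial>M) - (\<integral>x. indicator A x * D n x \<partial>M)) \<longlonglongrightarrow> 0" by simp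
      moreover have "(\<integral>x. indicator (space M) x * D n x \<partial>M) - (\<integral>x. indicator A x * D n x \<partial>M)
          = (\<integral>x. indicator (space M - A) x * D n x \<partial>M)" for n
      proof -
        have "A \<in> sets M" using compl(1) by (rule in_M)
        then have "(\<integral>x. indicator (space M) x * D n x \<partial>M) - (\<integral>x. indicator A x * D n x \<partial>M)
          = (\<integral>x. indicator (space M) x * D n x - indicator A x * D n x \<partial>M)"
          by (intro Bochner_Integration.integral_diff[symmetric] integrable_mult_bounded[OF ind_int D]) auto
        also have "\<dots> = (\<integral>x. indicator (space M - A) x * D n x \<partial>M)"
          using \<open>A \<in> sets M\<close> by (intro Bochner_Integration.integral_cong) (auto simp: indicator_def)
        finally show ?thesis .
      qed
      ultimately show ?case by simp
    next
      case (union A)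
      have A: "A i \<in> sets M" for i using union(2) in_M by auto
      \<comment> \<open>Additivity covers the finite partial unions; they converge to the full union
        in L1, and \<open>L1_limit_weights\<close> interchanges the limits.\<close>
      have "?P (\<Union>i<m. A i)" for m
      proof -
        have "(\<lambda>n. \<Sum>i<m. \<integral>x. indicator (A i) x * D n x \<partial>M) \<longlonglongrightarrow> (\<Sum>i<m. 0)"
          by (intro tendsto_sum union)
        moreover have "(\<Sum>i<m. \<integral>x. indicator (A i) x * D n x \<partial>M) = (\<integral>x. indicator (\<Union>i<m. A i) x * D n x \<partial>M)" for n
        proof -
          have "(\<Sum>i<m. \<integral>x. indicator (A i) x * D n x \<partial>M) = (\<integral>x. (\<Sum>i<m. indicator (A i) x * D n x) \<partial>M)"
            by (intro Bochner_Integration.integral_sum[symmetric] integrable_mult_bounded[OF ind_int[OF A] D])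
          also have "\<dots> = (\<integral>x. indicator (\<Union>i<m. A i) x * D n x \<partial>M)"
            using union(1)
            by (subst indicator_UN_disjoint) (auto simp: sum_distrib_right disjoint_family_on_def)
          finally show ?thesis .
        qed
        ultimately show ?thesis by simp
      qed
      then show ?case
        using A by (intro L1_limit_weights[OF ind_int ind_int indicator_union_L1 D]) (auto intro: finite_measure_axioms)
    qed
  qed
  \<comment> \<open>The induction over integrable functions is run in the restricted measure, so
    that every event occurring in it lies in the limit sigma-field.\<close>
  have "integrable (restr_to_subalg M (sigma_infinity M F)) \<xi>"
    by (rule integrable_in_subalg[OF subinf \<xi>(2,1)])
  then show ?thesis
  proof induction
    case (base A c)
    then have A: "A \<in> sigma_sets (space M) ?G" by (simp add: sets_restr_to_subalg[OF subinf] sets_inf)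
    have "(\<integral>x. (indicator A x *\<^sub>R c) * D n x \<partial>M) = c * (\<integral>x. indicator A x * D n x \<partial>M)" for n
    proof -
      have "(indicator A x *\<^sub>R c) * D n x = c * (indicator A x * D n x)" for x
        by (simp add: indicator_def)
      then show ?thesis by simp
    qed
    then show ?case using tendsto_mult_right_zero[OF ind[OF A]] by simp
  next
    case (add f g)
    have "integrable M f" "integrable M g" using add integrable_from_subalg[OF subinf] by auto
    then have "(\<integral>x. (f x + g x) * D n x \<partial>M) = (\<integral>x. f x * D n x \<partial>M) + (\<integral>x. g x * D n x \<partial>M)" for n
      using integrable_mult_bounded[OF _ D] by (simp add: distrib_right)
    then show ?case using tendsto_add[OF add.IH] by simp
  next
    case (lim f s)
    have f: "integrable M f" and s: "\<And>i. integrable M (s i)"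
      using lim.hyps(1,4) by (auto intro: integrable_from_subalg[OF subinf])
    \<comment> \<open>The approximating functions satisfy |s m| \<le> 2 |f|, hence the dominating
      function 3 |f|.\<close>
    have "(\<lambda>m. \<integral>x. norm (s m x - f x) \<partial>M) \<longlonglongrightarrow> (\<integral>x. 0 \<partial>M)"
    proof (rule integral_dominated_convergence[where w="\<lambda>x. 3 * norm (f x)"])
      show "AE x in M. (\<lambda>m. norm (s m x - f x)) \<longlonglongrightarrow> 0"
        using lim.hyps(2) by (auto intro!: AE_I2 tendsto_norm_zero LIM_zero simp: space_restr_to_subalg)
      show "AE x in M. norm (norm (s m x - f x)) \<le> 3 * norm (f x)" for m
      proof (rule AE_I2)
        fix x assume "x \<in> space M"
        then have "norm (s m x) \<le> 2 * norm (f x)" using lim.hyps(3) by (simp add: space_restr_to_subalg)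
        then show "norm (norm (s m x - f x)) \<le> 3 * norm (f x)"
          using norm_triangle_ineq4[of "s m x" "f x"] by simp
      qed
    qed (use f s in auto)
    then have "(\<lambda>m. \<integral>x. norm (s m x - f x) \<partial>M) \<longlonglongrightarrow> 0" by simp
    then show ?case using lim.IH by (intro L1_limit_weights[OF f s _ D])
  qed
qed

section \<open>Weighted convergence from characteristic functions\<close>

text \<open>\<open>B n\<close> is invertible only for large n, so bounds on
  \<open>B n *v U n\<close> are available only eventually; hence no supremum over all n.\<close>

definition asymptotically_tight :: "'a measure \<Rightarrow> (nat \<Rightarrow> 'a \<Rightarrow> 'b::real_normed_vector) \<Rightarrow> bool" where
  "asymptotically_tight N X \<longleftrightarrow>
     (\<forall>\<epsilon>>0. \<exists>K. \<forall>\<^sub>F n in sequentially. measure N {x \<in> space N. norm (X n x) > K} < \<epsilon>)"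

section \<open>Trigonometric polynomials and uniform approximation on compact sets\<close>

inductive trig_poly :: "('e::real_inner \<Rightarrow> real) \<Rightarrow> bool" where
  cos: "trig_poly (\<lambda>x. c * cos (t \<bullet> x))"
| sin: "trig_poly (\<lambda>x. c * sin (t \<bullet> x))"
| add: "trig_poly f \<Longrightarrow> trig_poly g \<Longrightarrow> trig_poly (\<lambda>x. f x + g x)"

lemma trig_poly_const: "trig_poly (\<lambda>_. c)"
  using trig_poly.cos[of c 0] by simp

text \<open>By the product-to-sum formulas the span of the cosines and sines is an algebra, as the
  Stone-Weierstrass theorem requires.\<close>

lemma trig_poly_mult:
  assumes "trig_poly f" "trig_poly g"
  shows "trig_poly (\<lambda>x. f x * g x)"
  using assms(1)
proof induction
  case (cos c t)
  show ?case using assms(2)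
  proof induction
    case (cos d s)
    have "(\<lambda>x. c * cos (t \<bullet> x) * (d * cos (s \<bullet> x))) =
        (\<lambda>x. c * d / 2 * cos ((t - s) \<bullet> x) + c * d / 2 * cos ((t + s) \<bullet> x))"
      by (simp add: fun_eq_iff inner_simps cos_add cos_diff sin_add sin_diff field_simps)
    then show ?case by (simp only: trig_poly.intros)
  next
    case (sin d s)
    have "(\<lambda>x. c * cos (t \<bullet> x) * (d * sin (s \<bullet> x))) =
        (\<lambda>x. c * d / 2 * sin ((t + s) \<bullet> x) + (- c * d / 2) * sin ((t - s) \<bullet> x))"
      by (simp add: fun_eq_iff inner_simps cos_add cos_diff sin_add sin_diff field_simps)
    then show ?case by (simp only: trig_poly.intros)
  next
    case (add f g)
    then show ?case by (simp add: distrib_left trig_poly.add)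
  qed
next
  case (sin c t)
  show ?case using assms(2)
  proof induction
    case (cos d s)
    have "(\<lambda>x. c * sin (t \<bullet> x) * (d * cos (s \<bullet> x))) =
        (\<lambda>x. c * d / 2 * sin ((t + s) \<bullet> x) + c * d / 2 * sin ((t - s) \<bullet> x))"
      by (simp add: fun_eq_iff inner_simps cos_add cos_diff sin_add sin_diff field_simps)
    then show ?case by (simp only: trig_poly.intros)
  next
    case (sin d s)
    have "(\<lambda>x. c * sin (t \<bullet> x) * (d * sin (s \<bullet> x))) =
        (\<lambda>x. c * d / 2 * cos ((t - s) \<bullet> x) + (- c * d / 2) * cos ((t + s) \<bullet> x))"
      by (simp add: fun_eq_iff inner_simps cos_add cos_diff sin_add sin_diff field_simps)
    then show ?case by (simp only: trig_poly.intros)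
  next
    case (add f g)
    then show ?case by (simp add: distrib_left trig_poly.add)
  qed
next
  case (add f1 f2)
  then show ?case by (simp add: distrib_right trig_poly.add)
qed

lemma continuous_on_trig_poly: "trig_poly f \<Longrightarrow> continuous_on S f"
  by (induction rule: trig_poly.induct) (auto intro!: continuous_intros)

lemma trig_poly_bounded: "trig_poly f \<Longrightarrow> \<exists>B. \<forall>x. \<bar>f x\<bar> \<le> B"
proof (induction rule: trig_poly.induct)
  case (cos c t)
  then show ?case by (intro exI[of _ "\<bar>c\<bar>"]) (simp add: abs_mult mult_left_le)
next
  case (sin c t)
  then show ?case by (intro exI[of _ "\<bar>c\<bar>"]) (simp add: abs_mult mult_left_le)
next
  case (add f g)
  then obtain A B where "\<And>x. \<bar>f x\<bar> \<le> A" "\<And>x. \<bar>g x\<bar> \<le> B" by blast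
  then show ?case
    by (intro exI[of _ "A + B"]) (meson abs_triangle_ineq add_mono order.trans)
qed

text \<open>Some coordinate distinguishes the two points. Scaling it by \<open>r\<close> brings both
  values into [-1, 1], inside the interval [-pi/2, pi/2] on which the sine is injective.\<close>

lemma trig_poly_separates:
  fixes x y :: "'e::euclidean_space"
  assumes "x \<noteq> y"
  shows "\<exists>f. trig_poly f \<and> f x \<noteq> f y"
proof -
  obtain b where b: "x \<bullet> b \<noteq> y \<bullet> b" using assms by (metis euclidean_eqI)
  define r where "r = 1 / (1 + \<bar>x \<bullet> b\<bar> + \<bar>y \<bullet> b\<bar>)"
  have r: "0 < r" by (auto simp: r_def intro!: divide_pos_pos add_pos_nonneg)
  have "r * \<bar>x \<bullet> b\<bar> \<le> 1" "r * \<bar>y \<bullet> b\<bar> \<le> 1" by (auto simp: r_def divide_simps)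
  then have "\<bar>r * (x \<bullet> b)\<bar> \<le> 1" "\<bar>r * (y \<bullet> b)\<bar> \<le> 1" using r by (auto simp: abs_mult)
  then have "- (pi/2) \<le> r * (x \<bullet> b)" "r * (x \<bullet> b) \<le> pi/2" "- (pi/2) \<le> r * (y \<bullet> b)" "r * (y \<bullet> b) \<le> pi/2"
    using pi_gt3 by auto
  then have "sin (r * (x \<bullet> b)) \<noteq> sin (r * (y \<bullet> b))" using sin_inj_pi b r by fastforce
  then have "1 * sin ((r *\<^sub>R b) \<bullet> x) \<noteq> 1 * sin ((r *\<^sub>R b) \<bullet> y)" by (simp add: inner_commute)
  then show ?thesis using trig_poly.sin[of 1 "r *\<^sub>R b"] by blast
qed

lemma trig_poly_compose_polynomial:
  assumes "real_polynomial_function p" "trig_poly g"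
  shows "trig_poly (\<lambda>x. p (g x))"
  using assms(1)
proof (induction rule: real_polynomial_function.induct)
  case (linear f)
  then interpret bounded_linear f .
  have "f y = f 1 * y" for y using scaleR[of y 1] by (simp add: mult.commute)
  then have eq: "(\<lambda>x. f (g x)) = (\<lambda>x. f 1 * g x)" by blast
  show ?case unfolding eq by (intro trig_poly_mult trig_poly_const assms(2))
next
  case (const c)
  then show ?case by (rule trig_poly_const)
next
  case (add f g)
  then show ?case by (simp add: trig_poly.add)
next
  case (mult f g)
  then show ?case by (simp add: trig_poly_mult)
qed

text \<open>A trigonometric polynomial close to \<open>h\<close> on \<open>K\<close> may be large elsewhere. Clamping its values at
  \<open>C\<close> repairs this, and the clamping function is itself a uniform limit of polynomials on the range.\<close>

lemma trig_poly_approximation: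
  fixes h :: "'e::euclidean_space \<Rightarrow> real"
  assumes h: "continuous_on UNIV h" "\<And>x. \<bar>h x\<bar> \<le> C" and K: "compact K" and \<delta>: "0 < \<delta>"
  obtains f where "trig_poly f" "\<And>x. x \<in> K \<Longrightarrow> \<bar>f x - h x\<bar> < \<delta>" "\<And>x. \<bar>f x\<bar> \<le> C + \<delta>"
proof -
  have "\<exists>g. trig_poly g \<and> (\<forall>x\<in>K. \<bar>h x - g x\<bar> < \<delta> / 2)"
  proof (rule Stone_Weierstrass_HOL)
    show "\<And>x y. x \<in> K \<and> y \<in> K \<and> x \<noteq> y \<Longrightarrow> \<exists>f. trig_poly f \<and> f x \<noteq> f y"
      using trig_poly_separates by blast
    show "continuous_on K h" using h(1) continuous_on_subset by blast
  qed (use K \<delta> in \<open>auto intro: trig_poly_const continuous_on_trig_poly trig_poly.add trig_poly_mult\<close>)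
  then obtain g where g: "trig_poly g" "\<And>x. x \<in> K \<Longrightarrow> \<bar>h x - g x\<bar> < \<delta> / 2" by blast
  obtain B where B: "\<And>x. \<bar>g x\<bar> \<le> B" using trig_poly_bounded[OF g(1)] by blast
  have C: "0 \<le> C" using h(2)[of 0] by linarith
  define \<tau> where "\<tau> y = max (- C) (min C y)" for y :: real
  obtain p where p: "real_polynomial_function p" "\<And>y. y \<in> {-B..B} \<Longrightarrow> \<bar>\<tau> y - p y\<bar> < \<delta> / 2"
  proof -
    have "continuous_on {-B..B} \<tau>" unfolding \<tau>_def by (intro continuous_intros)
    from Stone_Weierstrass_real_polynomial_function[OF compact_Icc this half_gt_zero[OF \<delta>]]
    show ?thesis using that by blast
  qed
  have close: "\<bar>\<tau> (g x) - p (g x)\<bar> < \<delta> / 2" for x using B[of x] by (intro p(2)) auto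
  show ?thesis
  proof (rule that)
    show "trig_poly (\<lambda>x. p (g x))" by (rule trig_poly_compose_polynomial[OF p(1) g(1)])
    show "\<bar>p (g x) - h x\<bar> < \<delta>" if "x \<in> K" for x
    proof -
      \<comment> \<open>\<open>h x\<close> lies in the interval onto which \<tau> clamps, so
        clamping cannot increase the distance to it.\<close>
      have "\<bar>\<tau> (g x) - h x\<bar> \<le> \<bar>g x - h x\<bar>" using h(2)[of x] C by (auto simp: \<tau>_def max_def min_def)
      then show ?thesis using close[of x] g(2)[OF that] by linarith
    qed
    show "\<bar>p (g x)\<bar> \<le> C + \<delta>" for x
    proof -
      have "\<bar>\<tau> (g x)\<bar> \<le> C" using C by (auto simp: \<tau>_def)
      then show ?thesis using close[of x] \<delta> by linarith
    qed
  qed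
qed

lemma measurable_cis [measurable (raw)]: "f \<in> borel_measurable M \<Longrightarrow> (\<lambda>x. cis (f x)) \<in> borel_measurable M"
  unfolding cis_conv_exp by measurable

context finite_measure
begin

lemma integral_of_real_mult_cis:
  assumes \<xi>: "integrable M \<xi>" and [measurable]: "g \<in> borel_measurable M"
  shows "(\<integral>x. complex_of_real (\<xi> x) * cis (g x) \<partial>M)
    = Complex (\<integral>x. \<xi> x * cos (g x) \<partial>M) (\<integral>x. \<xi> x * sin (g x) \<partial>M)"
proof -
  have "integrable M (\<lambda>x. complex_of_real (\<xi> x) * cis (g x))"
    using \<xi> by (intro integrable_mult_bounded[where C=1]) auto
  from integral_Re[OF this] integral_Im[OF this] show ?thesis
    by (simp add: complex_eq_iff)
qed

lemma asymptotically_tight_const: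
  fixes X :: "'a \<Rightarrow> 'b::{real_normed_vector, second_countable_topology}"
  assumes [measurable]: "X \<in> borel_measurable M"
  shows "asymptotically_tight M (\<lambda>_. X)"
  unfolding asymptotically_tight_def
proof (intro allI impI)
  fix \<epsilon> :: real assume \<epsilon>: "0 < \<epsilon>"
  let ?A = "\<lambda>k::nat. {x \<in> space M. norm (X x) > real k}"
  have "(\<lambda>k. measure M (?A k)) \<longlonglongrightarrow> measure M (\<Inter>k. ?A k)"
    by (intro finite_Lim_measure_decseq) (auto simp: decseq_def)
  moreover have "(\<Inter>k. ?A k) = {}"
  proof -
    have "\<exists>k. \<not> norm (X x) > real k" for x using reals_Archimedean2[of "norm (X x)"] by (meson less_asym)
    then show ?thesis by blast
  qed
  ultimately have "(\<lambda>k. measure M (?A k)) \<longlonglongrightarrow> 0" by simp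
  then have "\<forall>\<^sub>F k in sequentially. measure M (?A k) < \<epsilon>" using \<epsilon> by (rule order_tendstoD)
  then obtain k where "measure M (?A k) < \<epsilon>" by (auto simp: eventually_sequentially)
  then show "\<exists>K. \<forall>\<^sub>F n in sequentially. measure M {x \<in> space M. norm (X x) > K} < \<epsilon>" by auto
qed

text \<open>For trigonometric polynomials the claim is a linear combination of real and imaginary
  parts of the hypothesis. A general h is replaced by a bounded trigonometric polynomial close to it
  on a ball; outside the ball tightness makes the probability small, and uniform integrability of
  \<xi> controls the error even though \<xi> may change sign.\<close>

lemma weighted_convergence_of_char:
  fixes X :: "nat \<Rightarrow> 'a \<Rightarrow> 'e::euclidean_space" and \<xi> :: "'a \<Rightarrow> real"
  assumes \<xi>: "integrable M \<xi>"
    and X [measurable]: "\<And>n. X n \<in> borel_measurable M" and Y [measurable]: "Y \<in> borel_measurable M"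
    and tight: "asymptotically_tight M X"
    and char: "\<And>t. (\<lambda>n. \<integral>x. of_real (\<xi> x) * cis (t \<bullet> X n x) \<partial>M) \<longlonglongrightarrow> (\<integral>x. of_real (\<xi> x) * cis (t \<bullet> Y x) \<partial>M)"
    and h: "continuous_on UNIV h" "\<And>x. \<bar>h x\<bar> \<le> C"
  shows "(\<lambda>n. \<integral>x. \<xi> x * h (X n x) \<partial>M) \<longlonglongrightarrow> (\<integral>x. \<xi> x * h (Y x) \<partial>M)"
proof -
  have [measurable]: "\<xi> \<in> borel_measurable M" using \<xi> by simp
  have hm [measurable]: "h \<in> borel_measurable borel" using h(1) by (rule borel_measurable_continuous_onI)
  have int: "integrable M (\<lambda>x. \<xi> x * f (V x))"
    if "f \<in> borel_measurable borel" "\<And>x. \<bar>f x\<bar> \<le> B" "V \<in> borel_measurable M" for f and V :: "'a \<Rightarrow> 'e" and B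
    using that by (intro integrable_mult_bounded[OF \<xi>, where C=B]) auto
  have cos_sin: "(\<lambda>n. \<integral>x. \<xi> x * cos (t \<bullet> X n x) \<partial>M) \<longlonglongrightarrow> (\<integral>x. \<xi> x * cos (t \<bullet> Y x) \<partial>M)"
    "(\<lambda>n. \<integral>x. \<xi> x * sin (t \<bullet> X n x) \<partial>M) \<longlonglongrightarrow> (\<integral>x. \<xi> x * sin (t \<bullet> Y x) \<partial>M)" for t
    using tendsto_Re[OF char[of t]] tendsto_Im[OF char[of t]]
    by (simp_all add: integral_of_real_mult_cis[OF \<xi>])
  have conv: "(\<lambda>n. \<integral>x. \<xi> x * f (X n x) \<partial>M) \<longlonglongrightarrow> (\<integral>x. \<xi> x * f (Y x) \<partial>M)" if "trig_poly f" for f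
    using that
  proof induction
    case (cos c t)
    then show ?case
      using tendsto_mult_left[OF cos_sin(1)[of t], of c] by (simp add: mult.left_commute)
  next
    case (sin c t)
    then show ?case
      using tendsto_mult_left[OF cos_sin(2)[of t], of c] by (simp add: mult.left_commute)
  next
    case (add f g)
    have "integrable M (\<lambda>x. \<xi> x * p (V x))" if p: "trig_poly p" and V: "V \<in> borel_measurable M"
      for p and V :: "'a \<Rightarrow> 'e"
    proof -
      obtain B where B: "\<And>x. \<bar>p x\<bar> \<le> B" using trig_poly_bounded[OF p] by blast
      have "p \<in> borel_measurable borel"
        by (rule borel_measurable_continuous_onI[OF continuous_on_trig_poly[OF p]])
      from int[OF this B V] show ?thesis .
    qed
    note this[OF add.hyps(1) X] this[OF add.hyps(2) X] this[OF add.hyps(1) Y] this[OF add.hyps(2) Y]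
    then show ?case using tendsto_add[OF add.IH] by (simp add: distrib_left)
  qed
  show ?thesis
  proof (rule LIMSEQ_I)
    fix \<epsilon> :: real assume "0 < \<epsilon>"
    then have \<epsilon>: "0 < \<epsilon> / 3" by simp
    have C: "0 \<le> C" using h(2)[of 0] by linarith
    obtain \<delta> where \<delta>: "0 < \<delta>" and small: "\<And>Y. Y \<in> borel_measurable M \<Longrightarrow>
        AE x in M. 0 \<le> Y x \<and> Y x \<le> 2 * C + 1 \<Longrightarrow>
        measure M {x \<in> space M. Y x > \<delta>} < \<delta> \<Longrightarrow> (\<integral>x. norm (\<xi> x) * Y x \<partial>M) < \<epsilon> / 3"
      using weighted_integral_small[OF \<xi> \<epsilon>, of "2 * C + 1"] C by auto
    obtain K1 where K1: "\<forall>\<^sub>F n in sequentially. measure M {x \<in> space M. norm (X n x) > K1} < \<delta>"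
      using tight \<delta> by (auto simp: asymptotically_tight_def)
    obtain K2 where K2: "measure M {x \<in> space M. norm (Y x) > K2} < \<delta>"
      using asymptotically_tight_const[OF Y] \<delta> by (auto simp: asymptotically_tight_def)
    define K where "K = max K1 K2"
    \<comment> \<open>The accuracy \<delta> is what \<open>small\<close> asks for on the ball. The
      cap 1 guarantees |f - h| \<le> 2 C + 1 everywhere, a bound that had to be fixed before
      \<delta> was known.\<close>
    obtain f where f: "trig_poly f" "\<And>x. x \<in> cball 0 K \<Longrightarrow> \<bar>f x - h x\<bar> < min \<delta> 1"
        "\<And>x. \<bar>f x\<bar> \<le> C + min \<delta> 1"
      using trig_poly_approximation[OF h compact_cball[of 0 K], of "min \<delta> 1"] \<delta> by (metis min_less_iff_conj zero_less_one)
    have fm [measurable]: "f \<in> borel_measurable borel"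
      using continuous_on_trig_poly[OF f(1)] by (rule borel_measurable_continuous_onI)
    have approx: "\<bar>(\<integral>x. \<xi> x * f (V x) \<partial>M) - (\<integral>x. \<xi> x * h (V x) \<partial>M)\<bar> < \<epsilon> / 3"
      if V [measurable]: "V \<in> borel_measurable M" and mV: "measure M {x \<in> space M. norm (V x) > K} < \<delta>" for V :: "'a \<Rightarrow> 'e"
    proof -
      have "(\<integral>x. \<xi> x * f (V x) \<partial>M) - (\<integral>x. \<xi> x * h (V x) \<partial>M) = (\<integral>x. \<xi> x * (f (V x) - h (V x)) \<partial>M)"
        using int[OF fm f(3) V] int[OF hm h(2) V] by (simp add: right_diff_distrib)
      also have "\<bar>\<dots>\<bar> \<le> (\<integral>x. norm (\<xi> x) * \<bar>f (V x) - h (V x)\<bar> \<partial>M)"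
        using integral_norm_bound[of M "\<lambda>x. \<xi> x * (f (V x) - h (V x))"] by (simp add: abs_mult)
      also have "\<dots> < \<epsilon> / 3"
      proof (rule small)
        have "\<bar>f y - h y\<bar> \<le> 2 * C + 1" for y using f(3)[of y] h(2)[of y] by linarith
        then show "AE x in M. 0 \<le> \<bar>f (V x) - h (V x)\<bar> \<and> \<bar>f (V x) - h (V x)\<bar> \<le> 2 * C + 1" by simp
        have "{x \<in> space M. \<bar>f (V x) - h (V x)\<bar> > \<delta>} \<subseteq> {x \<in> space M. norm (V x) > K}"
        proof (rule subsetI)
          fix x assume x: "x \<in> {x \<in> space M. \<bar>f (V x) - h (V x)\<bar> > \<delta>}"
          then have "V x \<notin> cball 0 K" using f(2)[of "V x"] by auto
          with x show "x \<in> {x \<in> space M. norm (V x) > K}" by simp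
        qed
        then have "measure M {x \<in> space M. \<bar>f (V x) - h (V x)\<bar> > \<delta>} \<le> measure M {x \<in> space M. norm (V x) > K}"
          by (intro finite_measure_mono) measurable
        then show "measure M {x \<in> space M. \<bar>f (V x) - h (V x)\<bar> > \<delta>} < \<delta>" using mV by simp
      qed measurable
      finally show ?thesis .
    qed
    have mono: "measure M {x \<in> space M. norm (V x) > K} < \<delta>"
      if [measurable]: "V \<in> borel_measurable M" and "measure M {x \<in> space M. norm (V x) > K'} < \<delta>" "K' \<le> K"
      for V :: "'a \<Rightarrow> 'e" and K'
    proof -
      have "{x \<in> space M. norm (V x) > K'} \<in> sets M" by measurable
      moreover have "{x \<in> space M. norm (V x) > K} \<subseteq> {x \<in> space M. norm (V x) > K'}"
        using that(3) by auto
      ultimately show ?thesis using finite_measure_mono that(2) by (meson le_less_trans)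
    qed
    have Yc: "\<bar>(\<integral>x. \<xi> x * f (Y x) \<partial>M) - (\<integral>x. \<xi> x * h (Y x) \<partial>M)\<bar> < \<epsilon> / 3"
      by (rule approx[OF Y mono[OF Y K2]]) (simp add: K_def)
    have "\<forall>\<^sub>F n in sequentially. \<bar>(\<integral>x. \<xi> x * f (X n x) \<partial>M) - (\<integral>x. \<xi> x * f (Y x) \<partial>M)\<bar> < \<epsilon> / 3"
      using tendstoD[OF conv[OF f(1)] \<epsilon>] by (simp add: dist_real_def)
    with K1 have "\<forall>\<^sub>F n in sequentially. norm ((\<integral>x. \<xi> x * h (X n x) \<partial>M) - (\<integral>x. \<xi> x * h (Y x) \<partial>M)) < \<epsilon>"
    proof eventually_elim
      case (elim n)
      have "\<bar>(\<integral>x. \<xi> x * f (X n x) \<partial>M) - (\<integral>x. \<xi> x * h (X n x) \<partial>M)\<bar> < \<epsilon> / 3"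
        by (rule approx[OF X mono[OF X elim(1)]]) (simp add: K_def)
      with Yc elim(2) show ?case unfolding real_norm_def by linarith
    qed
    then show "\<exists>no. \<forall>n\<ge>no. norm ((\<integral>x. \<xi> x * h (X n x) \<partial>M) - (\<integral>x. \<xi> x * h (Y x) \<partial>M)) < \<epsilon>"
      by (simp add: eventually_sequentially)
  qed
qed

end

section \<open>Boundedness and convergence in probability\<close>

text \<open>Intended for distances and norms, hence no absolute value. Real-valued bounds can be
  multiplied and compared even when they stem from different spaces.\<close>

definition vanishes_in_prob :: "'a measure \<Rightarrow> (nat \<Rightarrow> 'a \<Rightarrow> real) \<Rightarrow> bool" where
  "vanishes_in_prob N R \<longleftrightarrow> (\<forall>\<epsilon>>0. (\<lambda>n. measure N {x \<in> space N. R n x > \<epsilon>}) \<longlonglongrightarrow> 0)"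

lemma converges_in_prob_iff_vanishes:
  "converges_in_prob N X Y \<longleftrightarrow> vanishes_in_prob N (\<lambda>n x. dist (X n x) (Y x))"
  by (simp add: converges_in_prob_def vanishes_in_prob_def)

lemma asymptotically_tight_shift:
  assumes "asymptotically_tight N X"
  shows "asymptotically_tight N (\<lambda>n. X (n - k))"
  unfolding asymptotically_tight_def
proof (intro allI impI)
  fix \<epsilon> :: real assume "0 < \<epsilon>"
  then obtain K where K: "\<forall>\<^sub>F n in sequentially. measure N {x \<in> space N. norm (X n x) > K} < \<epsilon>"
    using assms by (auto simp: asymptotically_tight_def)
  have "\<forall>\<^sub>F n in sequentially. measure N {x \<in> space N. norm (X (n - k) x) > K} < \<epsilon>"
    using eventually_compose_filterlim[OF K filterlim_minus_const_nat_at_top] .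
  then show "\<exists>K. \<forall>\<^sub>F n in sequentially. measure N {x \<in> space N. norm (X (n - k) x) > K} < \<epsilon>" by blast
qed

context finite_measure
begin

lemma measure_le_add_AE:
  assumes "A \<in> sets M" "B \<in> sets M" "C \<in> sets M" "AE x in M. x \<in> A \<longrightarrow> x \<in> B \<or> x \<in> C"
  shows "measure M A \<le> measure M B + measure M C"
proof -
  have "measure M A \<le> measure M (B \<union> C)"
    using assms by (intro finite_measure_mono_AE) auto
  also have "\<dots> \<le> measure M B + measure M C"
    using assms by (intro measure_Un_le) auto
  finally show ?thesis .
qed

lemma vanishes_in_prob_mono:
  assumes S: "vanishes_in_prob M S" "\<And>n. S n \<in> borel_measurable M"
    and le: "\<forall>\<^sub>F n in sequentially. AE x in M. R n x \<le> S n x"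
  shows "vanishes_in_prob M R"
  unfolding vanishes_in_prob_def
proof (intro allI impI)
  fix \<epsilon> :: real assume \<epsilon>: "0 < \<epsilon>"
  have "(\<lambda>n. measure M {x \<in> space M. S n x > \<epsilon>}) \<longlonglongrightarrow> 0"
    using S(1) \<epsilon> by (simp add: vanishes_in_prob_def)
  then show "(\<lambda>n. measure M {x \<in> space M. R n x > \<epsilon>}) \<longlonglongrightarrow> 0"
  proof (rule tendsto_sandwich[OF _ _ tendsto_const, rotated -1])
    show "\<forall>\<^sub>F n in sequentially. measure M {x \<in> space M. R n x > \<epsilon>} \<le> measure M {x \<in> space M. S n x > \<epsilon>}"
      using le
    proof eventually_elim
      case (elim n)
      have [measurable]: "S n \<in> borel_measurable M" by (rule S)
      have "{x \<in> space M. S n x > \<epsilon>} \<in> sets M" by measurable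
      then show ?case using elim by (intro finite_measure_mono_AE) auto
    qed
  qed simp
qed

text \<open>Off an event of small probability the norm of T is at most a fixed L > 0, and there the
  product exceeds \<epsilon> only if R exceeds \<epsilon>/L.\<close>

lemma vanishes_in_prob_tight_mult:
  fixes T :: "nat \<Rightarrow> 'a \<Rightarrow> 'b::{real_normed_vector, second_countable_topology}"
  assumes R: "vanishes_in_prob M R" and T: "asymptotically_tight M T"
    and [measurable]: "\<And>n. R n \<in> borel_measurable M" "\<And>n. T n \<in> borel_measurable M"
    and nonneg: "\<And>n x. 0 \<le> R n x"
  shows "vanishes_in_prob M (\<lambda>n x. R n x * norm (T n x))"
  unfolding vanishes_in_prob_def
proof (intro allI impI)
  fix \<epsilon> :: real assume \<epsilon>: "0 < \<epsilon>"
  show "(\<lambda>n. measure M {x \<in> space M. R n x * norm (T n x) > \<epsilon>}) \<longlonglongrightarrow> 0"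
  proof (rule tendstoI)
    fix \<delta> :: real assume "0 < \<delta>"
    then have \<delta>: "0 < \<delta> / 2" by simp
    obtain K where K: "\<forall>\<^sub>F n in sequentially. measure M {x \<in> space M. norm (T n x) > K} < \<delta> / 2"
      using T \<delta> unfolding asymptotically_tight_def by blast
    define L where "L = max K 1"
    have L: "0 < L" "K \<le> L" by (auto simp: L_def)
    have "(\<lambda>n. measure M {x \<in> space M. R n x > \<epsilon> / L}) \<longlonglongrightarrow> 0"
      using R \<epsilon> L by (simp add: vanishes_in_prob_def)
    then have "\<forall>\<^sub>F n in sequentially. measure M {x \<in> space M. R n x > \<epsilon> / L} < \<delta> / 2"
      using \<delta> by (rule order_tendstoD)
    with K show "\<forall>\<^sub>F n in sequentially. dist (measure M {x \<in> space M. R n x * norm (T n x) > \<epsilon>}) 0 < \<delta>"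
    proof eventually_elim
      case (elim n)
      have "measure M {x \<in> space M. R n x * norm (T n x) > \<epsilon>}
          \<le> measure M {x \<in> space M. norm (T n x) > K} + measure M {x \<in> space M. R n x > \<epsilon> / L}"
      proof (rule measure_le_add_AE)
        have "norm (T n x) > K \<or> R n x > \<epsilon> / L" if gt: "R n x * norm (T n x) > \<epsilon>" for x
        proof (rule ccontr)
          assume "\<not> ?thesis"
          then have "R n x * norm (T n x) \<le> \<epsilon> / L * L"
            using L \<epsilon> nonneg[of n x] by (intro mult_mono) auto
          with gt L show False by simp
        qed
        then show "AE x in M. x \<in> {x \<in> space M. R n x * norm (T n x) > \<epsilon>} \<longrightarrow>
            x \<in> {x \<in> space M. norm (T n x) > K} \<or> x \<in> {x \<in> space M. R n x > \<epsilon> / L}" by auto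
      qed measurable
      with elim show ?case by (simp add: dist_real_def)
    qed
  qed
qed

lemma vanishes_in_prob_cmult:
  assumes R: "vanishes_in_prob M R" and c: "0 \<le> c"
  shows "vanishes_in_prob M (\<lambda>n x. c * R n x)"
proof (cases "c = 0")
  case True
  then show ?thesis by (simp add: vanishes_in_prob_def)
next
  case False
  with c have "0 < c" by simp
  then have "c * r > \<epsilon> \<longleftrightarrow> r > \<epsilon> / c" for r \<epsilon> by (simp add: field_simps)
  with R \<open>0 < c\<close> show ?thesis by (simp add: vanishes_in_prob_def)
qed

lemma asymptotically_tight_mult:
  fixes S :: "nat \<Rightarrow> 'a \<Rightarrow> 'b::{real_normed_vector, second_countable_topology}"
    and T :: "nat \<Rightarrow> 'a \<Rightarrow> 'c::{real_normed_vector, second_countable_topology}"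
  assumes S: "asymptotically_tight M S" and T: "asymptotically_tight M T"
    and [measurable]: "\<And>n. S n \<in> borel_measurable M" "\<And>n. T n \<in> borel_measurable M"
  shows "asymptotically_tight M (\<lambda>n x. norm (S n x) * norm (T n x))"
  unfolding asymptotically_tight_def
proof (intro allI impI)
  fix \<delta> :: real assume "0 < \<delta>"
  then have \<delta>: "0 < \<delta> / 2" by simp
  obtain K where K: "\<forall>\<^sub>F n in sequentially. measure M {x \<in> space M. norm (S n x) > K} < \<delta> / 2"
    using S \<delta> unfolding asymptotically_tight_def by blast
  obtain L where L: "\<forall>\<^sub>F n in sequentially. measure M {x \<in> space M. norm (T n x) > L} < \<delta> / 2"
    using T \<delta> unfolding asymptotically_tight_def by blast
  from K L have "\<forall>\<^sub>F n in sequentially.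
      measure M {x \<in> space M. norm (norm (S n x) * norm (T n x)) > \<bar>K\<bar> * \<bar>L\<bar>} < \<delta>"
  proof eventually_elim
    case (elim n)
    have "measure M {x \<in> space M. norm (norm (S n x) * norm (T n x)) > \<bar>K\<bar> * \<bar>L\<bar>}
        \<le> measure M {x \<in> space M. norm (S n x) > K} + measure M {x \<in> space M. norm (T n x) > L}"
    proof (rule measure_le_add_AE)
      have "norm (S n x) > K \<or> norm (T n x) > L" if gt: "norm (norm (S n x) * norm (T n x)) > \<bar>K\<bar> * \<bar>L\<bar>" for x
      proof (rule ccontr)
        assume "\<not> ?thesis"
        then have "norm (S n x) * norm (T n x) \<le> \<bar>K\<bar> * \<bar>L\<bar>" by (intro mult_mono) auto
        with gt show False by simp
      qed
      then show "AE x in M. x \<in> {x \<in> space M. norm (norm (S n x) * norm (T n x)) > \<bar>K\<bar> * \<bar>L\<bar>} \<longrightarrow>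
          x \<in> {x \<in> space M. norm (S n x) > K} \<or> x \<in> {x \<in> space M. norm (T n x) > L}" by auto
    qed measurable
    with elim show ?case by simp
  qed
  then show "\<exists>K. \<forall>\<^sub>F n in sequentially. measure M {x \<in> space M. norm (norm (S n x) * norm (T n x)) > K} < \<delta>"
    by blast
qed

text \<open>The domination may fail where R > r, but the probability of that event tends to 0. The
  lemma is made for \<open>norm_le_via_inverse\<close>, whose smallness hypothesis becomes the
  condition R \<le> r.\<close>

lemma asymptotically_tight_dominated:
  fixes X :: "nat \<Rightarrow> 'a \<Rightarrow> 'b::{real_normed_vector, second_countable_topology}"
    and Y :: "nat \<Rightarrow> 'a \<Rightarrow> 'c::{real_normed_vector, second_countable_topology}"
  assumes Y: "asymptotically_tight M Y" and R: "vanishes_in_prob M R" and r: "0 < r" and c: "0 \<le> c"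
    and [measurable]: "\<And>n. X n \<in> borel_measurable M" "\<And>n. Y n \<in> borel_measurable M" "\<And>n. R n \<in> borel_measurable M"
    and le: "\<forall>\<^sub>F n in sequentially. AE x in M. R n x \<le> r \<longrightarrow> norm (X n x) \<le> c * norm (Y n x)"
  shows "asymptotically_tight M X"
  unfolding asymptotically_tight_def
proof (intro allI impI)
  fix \<delta> :: real assume "0 < \<delta>"
  then have \<delta>: "0 < \<delta> / 2" by simp
  obtain K where K: "\<forall>\<^sub>F n in sequentially. measure M {x \<in> space M. norm (Y n x) > K} < \<delta> / 2"
    using Y \<delta> unfolding asymptotically_tight_def by blast
  have "(\<lambda>n. measure M {x \<in> space M. R n x > r}) \<longlonglongrightarrow> 0"
    using R r by (simp add: vanishes_in_prob_def)
  then have "\<forall>\<^sub>F n in sequentially. measure M {x \<in> space M. R n x > r} < \<delta> / 2"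
    using \<delta> by (rule order_tendstoD)
  with K le have "\<forall>\<^sub>F n in sequentially. measure M {x \<in> space M. norm (X n x) > c * K} < \<delta>"
  proof eventually_elim
    case (elim n)
    have "measure M {x \<in> space M. norm (X n x) > c * K}
        \<le> measure M {x \<in> space M. norm (Y n x) > K} + measure M {x \<in> space M. R n x > r}"
    proof (rule measure_le_add_AE)
      show "AE x in M. x \<in> {x \<in> space M. norm (X n x) > c * K} \<longrightarrow>
          x \<in> {x \<in> space M. norm (Y n x) > K} \<or> x \<in> {x \<in> space M. R n x > r}"
        using elim(2)
      proof eventually_elim
        case (elim x)
        have "norm (X n x) \<le> c * K" if "norm (Y n x) \<le> K" "R n x \<le> r"
          using elim that mult_left_mono[OF that(1) c] by linarith
        then show ?case by force
      qed
    qed measurable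
    with elim show ?case by simp
  qed
  then show "\<exists>K. \<forall>\<^sub>F n in sequentially. measure M {x \<in> space M. norm (X n x) > K} < \<delta>"
    by blast
qed

lemma asymptotically_tight_Pair:
  fixes X :: "nat \<Rightarrow> 'a \<Rightarrow> 'b::{real_normed_vector, second_countable_topology}"
    and Y :: "nat \<Rightarrow> 'a \<Rightarrow> 'c::{real_normed_vector, second_countable_topology}"
  assumes X: "asymptotically_tight M X" and Y: "asymptotically_tight M Y"
    and [measurable]: "\<And>n. X n \<in> borel_measurable M" "\<And>n. Y n \<in> borel_measurable M"
  shows "asymptotically_tight M (\<lambda>n x. (X n x, Y n x))"
  unfolding asymptotically_tight_def
proof (intro allI impI)
  fix \<delta> :: real assume "0 < \<delta>"
  then have \<delta>: "0 < \<delta> / 2" by simp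
  obtain K where K: "\<forall>\<^sub>F n in sequentially. measure M {x \<in> space M. norm (X n x) > K} < \<delta> / 2"
    using X \<delta> unfolding asymptotically_tight_def by blast
  obtain L where L: "\<forall>\<^sub>F n in sequentially. measure M {x \<in> space M. norm (Y n x) > L} < \<delta> / 2"
    using Y \<delta> unfolding asymptotically_tight_def by blast
  from K L have "\<forall>\<^sub>F n in sequentially. measure M {x \<in> space M. norm (X n x, Y n x) > K + L} < \<delta>"
  proof eventually_elim
    case (elim n)
    have "measure M {x \<in> space M. norm (X n x, Y n x) > K + L}
        \<le> measure M {x \<in> space M. norm (X n x) > K} + measure M {x \<in> space M. norm (Y n x) > L}"
    proof (rule measure_le_add_AE)
      have "norm (X n x) > K \<or> norm (Y n x) > L" if "norm (X n x, Y n x) > K + L" for x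
        using that norm_Pair_le[of "X n x" "Y n x"] by linarith
      then show "AE x in M. x \<in> {x \<in> space M. norm (X n x, Y n x) > K + L} \<longrightarrow>
          x \<in> {x \<in> space M. norm (X n x) > K} \<or> x \<in> {x \<in> space M. norm (Y n x) > L}" by auto
    qed measurable
    with elim show ?case by simp
  qed
  then show "\<exists>K. \<forall>\<^sub>F n in sequentially. measure M {x \<in> space M. norm (X n x, Y n x) > K} < \<delta>"
    by blast
qed

text \<open>Boundedness of f and g together with uniform integrability of \<xi> upgrades convergence
  in probability to convergence of weighted integrals. It serves to exchange phases that differ by
  o(1).\<close>

lemma weighted_integral_diff_tendsto_0:
  fixes \<xi> :: "'a \<Rightarrow> complex"
  assumes \<xi>: "integrable M \<xi>"
    and [measurable]: "\<And>n. f n \<in> borel_measurable M" "\<And>n. g n \<in> borel_measurable M"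
    and bd: "\<And>n. AE x in M. norm (f n x) \<le> C" "\<And>n. AE x in M. norm (g n x) \<le> C"
    and van: "vanishes_in_prob M (\<lambda>n x. norm (f n x - g n x))"
  shows "(\<lambda>n. (\<integral>x. \<xi> x * f n x \<partial>M) - (\<integral>x. \<xi> x * g n x \<partial>M)) \<longlonglongrightarrow> 0"
proof (rule tendstoI)
  fix \<epsilon> :: real assume \<epsilon>: "0 < \<epsilon>"
  obtain \<delta> where \<delta>: "0 < \<delta>" and small: "\<And>Y. Y \<in> borel_measurable M \<Longrightarrow>
      AE x in M. 0 \<le> Y x \<and> Y x \<le> 2 * \<bar>C\<bar> \<Longrightarrow>
      measure M {x \<in> space M. Y x > \<delta>} < \<delta> \<Longrightarrow> (\<integral>x. norm (\<xi> x) * Y x \<partial>M) < \<epsilon>"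
    using weighted_integral_small[OF \<xi> \<epsilon>, of "2 * \<bar>C\<bar>"] by auto
  have "(\<lambda>n. measure M {x \<in> space M. norm (f n x - g n x) > \<delta>}) \<longlonglongrightarrow> 0"
    using van \<delta> by (simp add: vanishes_in_prob_def)
  then have "\<forall>\<^sub>F n in sequentially. measure M {x \<in> space M. norm (f n x - g n x) > \<delta>} < \<delta>"
    using \<delta> by (rule order_tendstoD)
  then show "\<forall>\<^sub>F n in sequentially. dist ((\<integral>x. \<xi> x * f n x \<partial>M) - (\<integral>x. \<xi> x * g n x \<partial>M)) 0 < \<epsilon>"
  proof eventually_elim
    case (elim n)
    have "(\<integral>x. \<xi> x * f n x \<partial>M) - (\<integral>x. \<xi> x * g n x \<partial>M) = (\<integral>x. \<xi> x * (f n x - g n x) \<partial>M)"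
      using integrable_mult_bounded[OF \<xi> _ bd(1)] integrable_mult_bounded[OF \<xi> _ bd(2)]
      by (simp add: right_diff_distrib)
    also have "norm \<dots> \<le> (\<integral>x. norm (\<xi> x) * norm (f n x - g n x) \<partial>M)"
      using integral_norm_bound[of M "\<lambda>x. \<xi> x * (f n x - g n x)"] by (simp add: norm_mult)
    also have "\<dots> < \<epsilon>"
    proof (rule small)
      show "AE x in M. 0 \<le> norm (f n x - g n x) \<and> norm (f n x - g n x) \<le> 2 * \<bar>C\<bar>"
        using bd(1)[of n] bd(2)[of n]
      proof eventually_elim
        case (elim x)
        then show ?case using norm_triangle_ineq4[of "f n x" "g n x"] by simp
      qed
    qed (use elim in measurable)
    finally show ?case by (simp add: dist_norm)
  qed
qed

end

lemma norm_cis_diff_le: "norm (cis a - cis b) \<le> \<bar>a - b\<bar>"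
proof -
  have "cis a - cis b = cis b * (iexp (a - b) - 1)"
    by (simp add: cis_conv_exp[symmetric] right_diff_distrib cis_mult flip: of_real_diff)
  then have "norm (cis a - cis b) = norm (iexp (a - b) - 1)" by (simp add: norm_mult)
  also have "\<dots> \<le> \<bar>a - b\<bar>" using iexp_approx1[of "a - b" 0] by simp
  finally show ?thesis .
qed

lemma asymptotically_tight_if_SUP_tendsto_0:
  assumes N: "prob_space N"
    and lim: "((\<lambda>K::real. SUP n\<in>{1..}. measure N {x \<in> space N. norm (X n x) > K}) \<longlongrightarrow> 0) at_top"
  shows "asymptotically_tight N X"
  unfolding asymptotically_tight_def
proof (intro allI impI)
  interpret prob_space N by (rule N)
  fix \<epsilon> :: real assume "0 < \<epsilon>"
  with lim have "\<forall>\<^sub>F K in at_top. (SUP n\<in>{1..}. measure N {x \<in> space N. norm (X n x) > K}) < \<epsilon>"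
    by (rule order_tendstoD)
  then obtain K where K: "(SUP n\<in>{1..}. measure N {x \<in> space N. norm (X n x) > K}) < \<epsilon>"
    by (auto simp: eventually_at_top_linorder)
  have "measure N {x \<in> space N. norm (X n x) > K} < \<epsilon>" if "n \<ge> 1" for n
  proof -
    \<comment> \<open>A real supremum bounds its terms only if the family is bounded above;
      probabilities are at most 1.\<close>
    have "measure N {x \<in> space N. norm (X n x) > K} \<le> (SUP n\<in>{1..}. measure N {x \<in> space N. norm (X n x) > K})"
      using that by (intro cSUP_upper bdd_aboveI[of _ 1]) auto
    with K show ?thesis by simp
  qed
  then show "\<exists>K. \<forall>\<^sub>F n in sequentially. measure N {x \<in> space N. norm (X n x) > K} < \<epsilon>"
    by (auto simp: eventually_sequentially)
qed

section \<open>Conditioning on the past\<close>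

lemma complex_cond_exp_measurable:
  "complex_cond_exp M F f \<in> borel_measurable F" "complex_cond_exp M F f \<in> borel_measurable M"
  unfolding complex_cond_exp_def[abs_def] Complex_eq by measurable

text \<open>Real and imaginary parts are conditioned separately and each stays within [-1, 1],
  whence the constant 2. Only a uniform bound matters.\<close>

lemma (in finite_measure_subalgebra) norm_complex_cond_exp_le:
  assumes [measurable]: "f \<in> borel_measurable M" and f: "\<And>x. norm (f x) \<le> 1"
  shows "AE x in M. norm (complex_cond_exp M F f x) \<le> 2"
proof -
  have bd: "\<bar>Re (f x)\<bar> \<le> 1" "\<bar>Im (f x)\<bar> \<le> 1" for x
    using f[of x] abs_Re_le_cmod[of "f x"] abs_Im_le_cmod[of "f x"] by linarith+
  have int: "integrable M (\<lambda>x. Re (f x))" "integrable M (\<lambda>x. Im (f x))"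
    using bd by (auto intro!: integrable_const_bound[where B=1])
  have "AE x in M. real_cond_exp M F (\<lambda>x. Re (f x)) x \<le> 1" "AE x in M. real_cond_exp M F (\<lambda>x. Re (f x)) x \<ge> -1"
    "AE x in M. real_cond_exp M F (\<lambda>x. Im (f x)) x \<le> 1" "AE x in M. real_cond_exp M F (\<lambda>x. Im (f x)) x \<ge> -1"
  proof -
    have "Re (f x) \<le> 1" "Re (f x) \<ge> -1" "Im (f x) \<le> 1" "Im (f x) \<ge> -1" for x
      using bd[of x] by linarith+
    then show "AE x in M. real_cond_exp M F (\<lambda>x. Re (f x)) x \<le> 1" "AE x in M. real_cond_exp M F (\<lambda>x. Re (f x)) x \<ge> -1"
      "AE x in M. real_cond_exp M F (\<lambda>x. Im (f x)) x \<le> 1" "AE x in M. real_cond_exp M F (\<lambda>x. Im (f x)) x \<ge> -1"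
      by (intro real_cond_exp_le_c real_cond_exp_ge_c int AE_I2; simp)+
  qed
  then show ?thesis
  proof eventually_elim
    case (elim x)
    then show ?case
      using cmod_le[of "complex_cond_exp M F f x"] by (simp add: complex_cond_exp_def)
  qed
qed

text \<open>Splitting both factors into real and imaginary parts leaves four real products, and the
  real pull-out identity applies to each.\<close>

lemma (in finite_measure_subalgebra) integral_mult_complex_cond_exp:
  assumes f: "f \<in> borel_measurable F" "\<And>x. norm (f x) \<le> 1"
    and g [measurable]: "g \<in> borel_measurable M" and g1: "\<And>x. norm (g x) \<le> 1"
  shows "(\<integral>x. f x * complex_cond_exp M F g x \<partial>M) = (\<integral>x. f x * g x \<partial>M)"
proof -
  have fM [measurable]: "f \<in> borel_measurable M" by (rule measurable_from_subalg[OF subalg f(1)])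
  have Ref: "(\<lambda>x. Re (f x)) \<in> borel_measurable F" "(\<lambda>x. Im (f x)) \<in> borel_measurable F"
    using f(1) by measurable
  have bd: "\<bar>Re (f x)\<bar> \<le> 1" "\<bar>Im (f x)\<bar> \<le> 1" "\<bar>Re (g x)\<bar> \<le> 1" "\<bar>Im (g x)\<bar> \<le> 1" for x
    using f(2)[of x] g1[of x] abs_Re_le_cmod[of "f x"] abs_Im_le_cmod[of "f x"]
      abs_Re_le_cmod[of "g x"] abs_Im_le_cmod[of "g x"] by linarith+
  have int: "integrable M (\<lambda>x. a x * b x)"
    if [measurable]: "a \<in> borel_measurable M" "b \<in> borel_measurable M" and "\<And>x. \<bar>a x\<bar> \<le> 1" "\<And>x. \<bar>b x\<bar> \<le> 1"
    for a b :: "'a \<Rightarrow> real"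
    using mult_mono[OF that(3,4)] by (intro integrable_const_bound[where B=1]) (auto simp: abs_mult)
  have eq: "integrable M (\<lambda>x. a x * real_cond_exp M F b x)"
    "(\<integral>x. a x * real_cond_exp M F b x \<partial>M) = (\<integral>x. a x * b x \<partial>M)" "integrable M (\<lambda>x. a x * b x)"
    if a: "a \<in> borel_measurable F" and b: "b \<in> borel_measurable M" and "\<And>x. \<bar>a x\<bar> \<le> 1" "\<And>x. \<bar>b x\<bar> \<le> 1"
    for a b :: "'a \<Rightarrow> real"
    using real_cond_exp_intg[OF int[OF measurable_from_subalg[OF subalg a] b that(3,4)] a b]
      int[OF measurable_from_subalg[OF subalg a] b that(3,4)] by auto
  note E = eq[OF Ref(1) _ bd(1) bd(3)] eq[OF Ref(1) _ bd(1) bd(4)] eq[OF Ref(2) _ bd(2) bd(3)] eq[OF Ref(2) _ bd(2) bd(4)]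
  have [measurable]: "complex_cond_exp M F g \<in> borel_measurable M" by (rule complex_cond_exp_measurable)
  have i1: "integrable M (\<lambda>x. f x * g x)"
    using mult_mono[OF f(2) g1] by (intro integrable_const_bound[where B=1]) (auto simp: norm_mult)
  have i2: "integrable M (\<lambda>x. f x * complex_cond_exp M F g x)"
  proof (rule integrable_mult_bounded)
    show "integrable M f" using f(2) by (intro integrable_const_bound[where B=1]) auto
  qed (use norm_complex_cond_exp_le[OF g g1] in auto)
  show ?thesis
    unfolding complex_eq_iff integral_Re[OF i1, symmetric] integral_Re[OF i2, symmetric]
      integral_Im[OF i1, symmetric] integral_Im[OF i2, symmetric]
    using E by (simp add: complex_cond_exp_def)
qed

text \<open>For an event E in \<open>F k\<close> and n > k both its indicator and \<open>T n\<close>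
  are \<open>F (n - 1)\<close>-measurable, so the integral is exactly 0. General weights follow by
  \<open>sigma_infinity_weights_vanish\<close>, with the uniform bound 3 = 1 + 2 in which the 2
  comes from \<open>norm_complex_cond_exp_le\<close>.\<close>

lemma cond_exp_increment_vanishes:
  fixes \<xi> :: "'a \<Rightarrow> complex" and F :: "nat \<Rightarrow> 'a measure"
  assumes M: "prob_space M" and filt: "filtration (space M) F" and sub: "\<And>n. subalgebra M (F n)"
    and \<xi>: "integrable M \<xi>" "\<xi> \<in> borel_measurable (sigma_infinity M F)"
    and T: "\<And>n. T n \<in> borel_measurable (F (n - 1))" "\<And>n x. norm (T n x) \<le> 1"
    and Y: "\<And>n. Y n \<in> borel_measurable M" "\<And>n x. norm (Y n x) \<le> 1"
  shows "(\<lambda>n. \<integral>x. \<xi> x * (T n x * (Y n x - complex_cond_exp M (F (n - 1)) (Y n) x)) \<partial>M) \<longlonglongrightarrow> 0"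
proof (rule sigma_infinity_weights_vanish[OF M filt sub _ _ _ \<xi>])
  interpret prob_space M by (rule M)
  interpret filtration "space M" F by (rule filt)
  have fms: "finite_measure_subalgebra M (F n)" for n
    using sub by (simp add: finite_measure_subalgebra_def finite_measure_subalgebra_axioms_def finite_measure_axioms)
  have [measurable]: "T n \<in> borel_measurable M" "Y n \<in> borel_measurable M"
    "complex_cond_exp M (F (n - 1)) (Y n) \<in> borel_measurable M" for n
    using measurable_from_subalg[OF sub T(1)] Y complex_cond_exp_measurable by auto
  show "(\<lambda>x. T n x * (Y n x - complex_cond_exp M (F (n - 1)) (Y n) x)) \<in> borel_measurable M" for n
    by measurable
  show "AE x in M. norm (T n x * (Y n x - complex_cond_exp M (F (n - 1)) (Y n) x)) \<le> 3" for n
    using finite_measure_subalgebra.norm_complex_cond_exp_le[OF fms[of "n - 1"] Y(1,2)[of n]]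
  proof eventually_elim
    case (elim x)
    have "norm (Y n x - complex_cond_exp M (F (n - 1)) (Y n) x) \<le> 3"
      using Y(2)[of n x] elim norm_triangle_ineq4[of "Y n x" "complex_cond_exp M (F (n - 1)) (Y n) x"] by linarith
    then show ?case using mult_mono[OF T(2)[of n x]] by (fastforce simp: norm_mult)
  qed
  fix k E assume E: "E \<in> sets (F k)"
  have "(\<integral>x. indicator E x * (T n x * (Y n x - complex_cond_exp M (F (n - 1)) (Y n) x)) \<partial>M) = 0"
    if n: "n \<ge> Suc k" for n
  proof -
    have "k \<le> n - 1" using n by simp
    then have E': "E \<in> sets (F (n - 1))" using E sets_F_mono by blast
    then have EM [measurable]: "E \<in> sets M" using sub[of "n - 1"] by (auto simp: subalgebra_def)
    let ?f = "\<lambda>x. indicator E x * T n x"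
    have f: "?f \<in> borel_measurable (F (n - 1))" "norm (?f x) \<le> 1" for x
      using E' T by (auto simp: indicator_def intro!: borel_measurable_times borel_measurable_indicator)
    have f1: "integrable M ?f" using f(2) by (intro integrable_const_bound[where B=1]) auto
    have i1: "integrable M (\<lambda>x. ?f x * Y n x)"
      using Y by (intro integrable_mult_bounded[OF f1, where C=1]) auto
    have i2: "integrable M (\<lambda>x. ?f x * complex_cond_exp M (F (n - 1)) (Y n) x)"
      by (rule integrable_mult_bounded[OF f1 _ finite_measure_subalgebra.norm_complex_cond_exp_le[OF fms Y]]) measurable
    have "(\<integral>x. indicator E x * (T n x * (Y n x - complex_cond_exp M (F (n - 1)) (Y n) x)) \<partial>M)
      = (\<integral>x. ?f x * Y n x \<partial>M) - (\<integral>x. ?f x * complex_cond_exp M (F (n - 1)) (Y n) x \<partial>M)"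
      using i1 i2 by (simp add: right_diff_distrib mult.assoc)
    then show ?thesis
      using finite_measure_subalgebra.integral_mult_complex_cond_exp[OF fms f Y] by simp
  qed
  then show "(\<lambda>n. \<integral>x. indicator E x * (T n x * (Y n x - complex_cond_exp M (F (n - 1)) (Y n) x)) \<partial>M) \<longlonglongrightarrow> 0"
    by (intro tendsto_eventually) (auto simp: eventually_sequentially)
qed

section \<open>Conditioning on an event\<close>

context prob_space
begin

lemma uniform_measure_eq_density:
  assumes "0 < measure M A"
  shows "uniform_measure M A = density M (\<lambda>x. ennreal (indicator A x / measure M A))"
proof -
  have "indicator A x / emeasure M A = ennreal (indicator A x / measure M A)" for x
    using assms divide_ennreal[of 1 "measure M A"] by (simp add: emeasure_eq_measure indicator_def)
  then show ?thesis unfolding uniform_measure_def by simp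
qed

lemma
  fixes f :: "'a \<Rightarrow> complex"
  assumes A: "A \<in> sets M" "0 < measure M A" and f: "f \<in> borel_measurable M"
  shows integrable_uniform_measure:
      "integrable (uniform_measure M A) f \<longleftrightarrow> integrable M (\<lambda>x. of_real (indicator A x / measure M A) * f x)"
    and integral_uniform_measure:
      "integral\<^sup>L (uniform_measure M A) f = (\<integral>x. of_real (indicator A x / measure M A) * f x \<partial>M)"
  using A f by (simp_all add: uniform_measure_eq_density integrable_density integral_density scaleR_conv_of_real)

text \<open>Conditioning on the smaller event inflates probabilities by a fixed factor at most. This
  carries the limits assumed under conditioning on G over to the intersection with the invertibility
  event.\<close>

lemma measure_uniform_subset_le:
  assumes "A \<subseteq> G" "0 < measure M A" "G \<in> sets M" "S \<in> sets M" "A \<in> sets M"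
  shows "measure (uniform_measure M A) S \<le> measure (uniform_measure M G) S * (measure M G / measure M A)"
proof -
  have G: "0 < measure M G" using assms finite_measure_mono[of A G] by linarith
  have "measure (uniform_measure M A) S = measure M (A \<inter> S) / measure M A"
    using assms by (intro measure_uniform_measure) (auto simp: emeasure_eq_measure)
  moreover have "measure (uniform_measure M G) S = measure M (G \<inter> S) / measure M G"
    using assms G by (intro measure_uniform_measure) (auto simp: emeasure_eq_measure)
  moreover have "measure M (A \<inter> S) \<le> measure M (G \<inter> S)"
    using assms by (intro finite_measure_mono) auto
  ultimately show ?thesis using G assms(2) by (simp add: divide_right_mono)
qed

lemma vanishes_in_prob_uniform_subset:
  assumes "A \<subseteq> G" "0 < measure M A" "G \<in> sets M" "A \<in> sets M"
    and [measurable]: "\<And>n. R n \<in> borel_measurable M"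
    and R: "vanishes_in_prob (uniform_measure M G) R"
  shows "vanishes_in_prob (uniform_measure M A) R"
  unfolding vanishes_in_prob_def
proof (intro allI impI)
  fix \<epsilon> :: real assume "0 < \<epsilon>"
  then have "(\<lambda>n. measure (uniform_measure M G) {x \<in> space M. R n x > \<epsilon>}) \<longlonglongrightarrow> 0"
    using R by (simp add: vanishes_in_prob_def)
  then have "(\<lambda>n. measure (uniform_measure M G) {x \<in> space M. R n x > \<epsilon>} * (measure M G / measure M A)) \<longlonglongrightarrow> 0"
    by (rule tendsto_mult_left_zero)
  then show "(\<lambda>n. measure (uniform_measure M A) {x \<in> space (uniform_measure M A). R n x > \<epsilon>}) \<longlonglongrightarrow> 0"
  proof (rule tendsto_sandwich[OF _ _ tendsto_const, rotated -1])
    have "{x \<in> space M. R n x > \<epsilon>} \<in> sets M" for n by measurable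
    then show "\<forall>\<^sub>F n in sequentially. measure (uniform_measure M A) {x \<in> space (uniform_measure M A). R n x > \<epsilon>}
        \<le> measure (uniform_measure M G) {x \<in> space M. R n x > \<epsilon>} * (measure M G / measure M A)"
      using assms(1-4) by (intro always_eventually allI) (simp only: space_uniform_measure measure_uniform_subset_le)
  qed simp
qed

text \<open>For b in H the event A \<inter> b is again in H, so P(a \<inter> A \<inter> b) = P(a)
  P(A \<inter> b), and division by P(A) gives the product rule. The same identity without b shows
  that the law of Z is unchanged.\<close>

lemma indep_of_algebra_uniform_measure:
  assumes H: "subalgebra M H" and A: "A \<in> sets H" "0 < measure M A"
    and Z [measurable]: "Z \<in> borel_measurable M" and indep: "indep_of_algebra M borel Z H"
  shows "indep_of_algebra (uniform_measure M A) borel Z H"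
    and "distr (uniform_measure M A) borel Z = distr M borel Z"
proof -
  let ?N = "uniform_measure M A"
  have HM: "sets H \<subseteq> sets M" using H by (simp add: subalgebra_def)
  then have AM [measurable]: "A \<in> sets M" using A by auto
  have N: "measure ?N S = measure M (A \<inter> S) / measure M A" if "S \<in> sets M" for S
    using A that by (intro measure_uniform_measure) (auto simp: emeasure_eq_measure)
  interpret N: prob_space ?N
    using A by (intro prob_space_uniform_measure) (auto simp: emeasure_eq_measure)
  let ?V = "sets (vimage_algebra (space M) Z borel)"
  have V: "?V \<subseteq> sets M" by (auto simp: sets_vimage_algebra2)
  have prod: "measure M (a \<inter> b) = measure M a * measure M b" if "a \<in> ?V" "b \<in> sets H" for a b
    using indep that unfolding indep_of_algebra_def by (rule indep_setD)
  have marg: "measure ?N a = measure M a" if "a \<in> ?V" for a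
    using prod[OF that A(1)] N[of a] V that A(2) by (auto simp: Int_commute)
  have "N.indep_set ?V (sets H)"
  proof (rule N.indep_setI)
    fix a b assume a: "a \<in> ?V" and b: "b \<in> sets H"
    have "measure ?N (a \<inter> b) = measure M (a \<inter> (A \<inter> b)) / measure M A"
      using a b V HM by (subst N) (auto simp: Int_ac)
    also have "\<dots> = measure M a * measure M (A \<inter> b) / measure M A"
      using prod[OF a, of "A \<inter> b"] A(1) b by simp
    also have "\<dots> = measure ?N a * measure ?N b"
      using N[of b] b HM marg[OF a] by auto
    finally show "measure ?N (a \<inter> b) = measure ?N a * measure ?N b" .
  qed (use V HM in auto)
  then show "indep_of_algebra ?N borel Z H" by (simp add: indep_of_algebra_def)
  show "distr ?N borel Z = distr M borel Z"
  proof (rule measure_eqI)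
    fix S assume "S \<in> sets (distr ?N borel Z)"
    then have S: "S \<in> sets borel" by simp
    then have "Z -` S \<inter> space M \<in> ?V" by (auto simp: sets_vimage_algebra2)
    then show "emeasure (distr ?N borel Z) S = emeasure (distr M borel Z) S"
      using marg S by (simp add: emeasure_distr N.emeasure_eq_measure emeasure_eq_measure)
  qed simp
qed

lemma integral_mult_indep_of_algebra:
  fixes \<xi> :: "'a \<Rightarrow> complex" and Z :: "'a \<Rightarrow> 'b::topological_space"
  assumes H: "subalgebra M H" and Z [measurable]: "Z \<in> borel_measurable M"
    and indep: "indep_of_algebra M borel Z H"
    and \<xi>: "integrable M \<xi>" "\<xi> \<in> borel_measurable H"
    and g: "g \<in> borel_measurable borel" "\<And>z. norm (g z) \<le> 1"
  shows "(\<integral>x. \<xi> x * g (Z x) \<partial>M) = (\<integral>x. \<xi> x \<partial>M) * (\<integral>x. g (Z x) \<partial>M)"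
proof (rule indep_var_lebesgue_integral)
  have [measurable]: "g \<in> borel_measurable borel" by (rule g)
  let ?V = "vimage_algebra (space M) Z borel"
  have spH: "space H = space M" and HM: "sets H \<subseteq> sets M" using H by (auto simp: subalgebra_def)
  have gZ: "(\<lambda>x. g (Z x)) \<in> borel_measurable ?V"
    by (rule measurable_compose[OF measurable_vimage_algebra1 g(1)]) simp
  have V: "sets ?V \<subseteq> sets M" by (auto simp: sets_vimage_algebra2)
  show "indep_var borel \<xi> borel (\<lambda>x. g (Z x))"
    unfolding indep_var_eq
  proof (intro conjI indep_setI)
    have s1: "sigma_sets (space M) {\<xi> -` A \<inter> space M |A. A \<in> sets borel} \<subseteq> sets H"
      using sets.sigma_sets_subset[of "{\<xi> -` A \<inter> space M |A. A \<in> sets borel}" H] measurable_sets[OF \<xi>(2)] spH by auto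
    have s2: "sigma_sets (space M) {(\<lambda>x. g (Z x)) -` A \<inter> space M |A. A \<in> sets borel} \<subseteq> sets ?V"
      using sets.sigma_sets_subset[of "{(\<lambda>x. g (Z x)) -` A \<inter> space M |A. A \<in> sets borel}" ?V] measurable_sets[OF gZ] by auto
    show "sigma_sets (space M) {\<xi> -` A \<inter> space M |A. A \<in> sets borel} \<subseteq> events" using s1 HM by blast
    show "sigma_sets (space M) {(\<lambda>x. g (Z x)) -` A \<inter> space M |A. A \<in> sets borel} \<subseteq> events" using s2 V by blast
    fix a b assume "a \<in> sigma_sets (space M) {\<xi> -` A \<inter> space M |A. A \<in> sets borel}"
      "b \<in> sigma_sets (space M) {(\<lambda>x. g (Z x)) -` A \<inter> space M |A. A \<in> sets borel}"
    then have "b \<in> sets ?V" "a \<in> sets H" using s1 s2 by auto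
    then have "prob (b \<inter> a) = prob b * prob a"
      using indep unfolding indep_of_algebra_def by (intro indep_setD)
    then show "prob (a \<inter> b) = prob a * prob b" by (simp add: Int_commute mult.commute)
  qed (use \<xi> in measurable)
  show "integrable M (\<lambda>x. g (Z x))" using g(2) by (intro integrable_const_bound[where B=1]) auto
qed (rule \<xi>)

text \<open>Conditional expectation is self-adjoint: it can be moved from h(X) to the weight. So it
  is enough to test with H-measurable weights and with no conditioning of h(X).\<close>

lemma converges_stablyI:
  fixes X :: "nat \<Rightarrow> 'a \<Rightarrow> real ^ 'd"
  assumes H: "subalgebra M H"
    and X [measurable]: "\<And>n. X n \<in> borel_measurable M" and Y [measurable]: "Y \<in> borel_measurable M"
    and conv: "\<And>(\<xi> :: 'a \<Rightarrow> real) h C. integrable M \<xi> \<Longrightarrow> \<xi> \<in> borel_measurable H \<Longrightarrow>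
      continuous_on UNIV h \<Longrightarrow> (\<And>x. \<bar>h x\<bar> \<le> C) \<Longrightarrow>
      (\<lambda>n. \<integral>x. \<xi> x * h (X n x) \<partial>M) \<longlonglongrightarrow> (\<integral>x. \<xi> x * h (Y x) \<partial>M)"
  shows "converges_stably M H X Y"
  unfolding converges_stably_def
proof (intro conjI allI impI)
  interpret finite_measure_subalgebra M H by unfold_locales (rule H)
  fix \<xi> :: "'a \<Rightarrow> real" and h :: "real ^ 'd \<Rightarrow> real"
  assume \<xi>: "integrable M \<xi>" and h: "continuous_on UNIV h" and bd: "bounded (range h)"
  have [measurable]: "\<xi> \<in> borel_measurable M" using \<xi> by simp
  have [measurable]: "h \<in> borel_measurable borel" using h by (rule borel_measurable_continuous_onI)
  obtain C where C: "\<And>x. \<bar>h x\<bar> \<le> C" using bd by (auto simp: bounded_iff)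
  let ?\<xi> = "real_cond_exp M H \<xi>"
  have swap: "(\<integral>x. \<xi> x * real_cond_exp M H (\<lambda>x. h (V x)) x \<partial>M) = (\<integral>x. ?\<xi> x * h (V x) \<partial>M)"
    if V [measurable]: "V \<in> borel_measurable M" for V
  proof -
    have hV: "integrable M (\<lambda>x. h (V x))" using C by (intro integrable_const_bound[where B=C]) auto
    have "h (V x) \<le> C" "h (V x) \<ge> - C" for x using C[of "V x"] by linarith+
    then have "AE x in M. real_cond_exp M H (\<lambda>x. h (V x)) x \<le> C" "AE x in M. real_cond_exp M H (\<lambda>x. h (V x)) x \<ge> - C"
      by (intro real_cond_exp_le_c real_cond_exp_ge_c hV AE_I2; simp)+
    then have "AE x in M. norm (real_cond_exp M H (\<lambda>x. h (V x)) x) \<le> C"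
      by eventually_elim auto
    then have int: "integrable M (\<lambda>x. \<xi> x * real_cond_exp M H (\<lambda>x. h (V x)) x)"
      by (intro integrable_mult_bounded[OF \<xi>]) auto
    have "(\<integral>x. \<xi> x * real_cond_exp M H (\<lambda>x. h (V x)) x \<partial>M)
        = (\<integral>x. real_cond_exp M H (\<lambda>x. h (V x)) x * ?\<xi> x \<partial>M)"
      using real_cond_exp_intg(2)[of "real_cond_exp M H (\<lambda>x. h (V x))" \<xi>] int by (simp add: mult.commute)
    also have "\<dots> = (\<integral>x. ?\<xi> x * h (V x) \<partial>M)"
    proof -
      have "integrable M (\<lambda>x. ?\<xi> x * h (V x))"
        using C by (intro integrable_mult_bounded[OF real_cond_exp_int(1)[OF \<xi>], where C=C]) auto
      from real_cond_exp_intg(2)[OF this] show ?thesis by (simp add: mult.commute)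
    qed
    finally show ?thesis .
  qed
  show "(\<lambda>n. \<integral>x. \<xi> x * real_cond_exp M H (\<lambda>x. h (X n x)) x \<partial>M)
      \<longlonglongrightarrow> (\<integral>x. \<xi> x * real_cond_exp M H (\<lambda>x. h (Y x)) x \<partial>M)"
    unfolding swap[OF X] swap[OF Y]
    by (rule conv[OF real_cond_exp_int(1)[OF \<xi>] _ h C]) simp
qed (use H X Y in \<open>auto intro: prob_space_axioms\<close>)

end

section \<open>The limit theorem\<close>

text \<open>For fixed r the error of r iterations vanishes as n grows. Choose r so large that
  (P^r)^T \<theta> lies in the neighbourhood of 0 from \<open>equi\<close> and the finite product is
  near \<Phi>. As r is fixed before n, the threshold for n in \<open>equi\<close> may depend on
  \<theta>, and the truncation in n - r is harmless.\<close>

lemma affine_recursion_limit: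
  fixes L :: "nat \<Rightarrow> real ^ 'd \<Rightarrow> complex" and P :: "real ^ 'd ^ 'd"
  assumes step: "\<And>\<theta>. (\<lambda>n. L n \<theta> - c \<theta> * L (n - 1) (transpose P *v \<theta>)) \<longlonglongrightarrow> 0"
    and equi: "\<And>\<epsilon>. 0 < \<epsilon> \<Longrightarrow> \<exists>\<delta>>0. \<forall>\<theta>. norm \<theta> < \<delta> \<longrightarrow> (\<forall>\<^sub>F n in sequentially. norm (L n \<theta> - L0) < \<epsilon>)"
    and P: "(\<lambda>r. matrix_power P r) \<longlonglongrightarrow> 0"
    and prod: "(\<lambda>r. \<Prod>j<r. c (transpose (matrix_power P j) *v \<theta>)) \<longlonglongrightarrow> \<Phi>"
  shows "(\<lambda>n. L n \<theta>) \<longlonglongrightarrow> L0 * \<Phi>"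
proof -
  let ?v = "\<lambda>j \<theta>. transpose (matrix_power P j) *v \<theta>"
  let ?c = "\<lambda>r \<theta>. \<Prod>j<r. c (?v j \<theta>)"
  have iter: "(\<lambda>n. L n \<theta> - ?c r \<theta> * L (n - r) (?v r \<theta>)) \<longlonglongrightarrow> 0" for r \<theta>
  proof (induction r arbitrary: \<theta>)
    case 0
    show ?case by simp
  next
    case (Suc r)
    have "(\<lambda>n. L (n - 1) (transpose P *v \<theta>)
        - ?c r (transpose P *v \<theta>) * L (n - 1 - r) (?v r (transpose P *v \<theta>))) \<longlonglongrightarrow> 0"
      using filterlim_compose[OF Suc[of "transpose P *v \<theta>"] filterlim_minus_const_nat_at_top[of 1]] by simp
    from tendsto_add[OF step tendsto_mult_right_zero[OF this]]
    have "(\<lambda>n. L n \<theta> - c \<theta> * L (n - 1) (transpose P *v \<theta>) + c \<theta> * (L (n - 1) (transpose P *v \<theta>)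
        - ?c r (transpose P *v \<theta>) * L (n - 1 - r) (?v r (transpose P *v \<theta>)))) \<longlonglongrightarrow> 0" by simp
    \<comment> \<open>The product is peeled at its first factor, because the recursion acts on
      \<theta> by P^T before the remaining r iterations start.\<close>
    moreover have "?c (Suc r) \<theta> = c \<theta> * ?c r (transpose P *v \<theta>)"
      unfolding prod.lessThan_Suc_shift transpose_matrix_power_Suc by simp
    ultimately show ?case
      unfolding transpose_matrix_power_Suc by (simp add: right_diff_distrib mult.assoc)
  qed
  have v: "(\<lambda>r. norm (?v r \<theta>)) \<longlonglongrightarrow> 0"
  proof -
    have "(\<lambda>r. transpose (matrix_power P r)) \<longlonglongrightarrow> 0"
      using P by (subst tendsto_norm_zero_iff[symmetric]) (simp add: norm_transpose tendsto_norm_zero)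
    from bounded_bilinear.tendsto[OF bounded_bilinear_matrix_vector_mult this tendsto_const[of \<theta>]]
    show ?thesis by (simp add: tendsto_norm_zero)
  qed
  show ?thesis
  proof (rule tendstoI)
    fix \<epsilon> :: real assume "0 < \<epsilon>"
    then have \<epsilon>: "0 < \<epsilon> / 3" by simp
    \<comment> \<open>The bound must be uniform in r: the neighbourhood \<delta> depends on C, and r
      is chosen only after \<delta>.\<close>
    have "\<exists>C>0. \<forall>r. norm (?c r \<theta>) \<le> C"
      using convergent_imp_Bseq[OF convergentI[OF prod]] by (auto elim!: BseqE)
    then obtain C where C: "0 < C" "\<And>r. norm (?c r \<theta>) \<le> C" by blast
    obtain \<delta> where \<delta>: "0 < \<delta>" and close: "\<And>\<theta>. norm \<theta> < \<delta> \<Longrightarrow>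
        \<forall>\<^sub>F n in sequentially. norm (L n \<theta> - L0) < \<epsilon> / 3 / C"
      using equi[of "\<epsilon> / 3 / C"] \<epsilon> C(1) by auto
    have "\<forall>\<^sub>F r in sequentially. norm (?v r \<theta>) < \<delta>" using v \<delta> by (rule order_tendstoD)
    moreover have "(\<lambda>r. norm (?c r \<theta> * L0 - L0 * \<Phi>)) \<longlonglongrightarrow> 0"
      using tendsto_mult_right[OF prod, of L0] by (intro tendsto_norm_zero LIM_zero) (simp add: mult.commute)
    then have "\<forall>\<^sub>F r in sequentially. norm (?c r \<theta> * L0 - L0 * \<Phi>) < \<epsilon> / 3" using \<epsilon> by (rule order_tendstoD)
    ultimately have "\<forall>\<^sub>F r in sequentially. norm (?v r \<theta>) < \<delta> \<and> norm (?c r \<theta> * L0 - L0 * \<Phi>) < \<epsilon> / 3"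
      by eventually_elim simp
    then obtain r where r: "norm (?v r \<theta>) < \<delta>" "norm (?c r \<theta> * L0 - L0 * \<Phi>) < \<epsilon> / 3"
      by (auto simp: eventually_sequentially)
    have "\<forall>\<^sub>F n in sequentially. norm (L n \<theta> - ?c r \<theta> * L (n - r) (?v r \<theta>)) < \<epsilon> / 3"
      using tendstoD[OF iter \<epsilon>] by (simp add: dist_norm)
    moreover have "\<forall>\<^sub>F n in sequentially. norm (L (n - r) (?v r \<theta>) - L0) < \<epsilon> / 3 / C"
      using eventually_compose_filterlim[OF close[OF r(1)] filterlim_minus_const_nat_at_top] .
    ultimately show "\<forall>\<^sub>F n in sequentially. dist (L n \<theta>) (L0 * \<Phi>) < \<epsilon>"
    proof eventually_elim
      case (elim n)
      have "norm (?c r \<theta> * (L (n - r) (?v r \<theta>) - L0)) \<le> C * norm (L (n - r) (?v r \<theta>) - L0)"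
        using C(2) by (simp add: norm_mult mult_right_mono)
      also have "\<dots> < \<epsilon> / 3" using elim(2) C(1) by (simp add: pos_less_divide_eq mult.commute)
      finally have a: "norm (?c r \<theta> * (L (n - r) (?v r \<theta>) - L0)) < \<epsilon> / 3" .
      have "L n \<theta> - L0 * \<Phi> = (L n \<theta> - ?c r \<theta> * L (n - r) (?v r \<theta>))
          + ?c r \<theta> * (L (n - r) (?v r \<theta>) - L0) + (?c r \<theta> * L0 - L0 * \<Phi>)"
        by (simp add: right_diff_distrib)
      also have "norm \<dots> \<le> norm (L n \<theta> - ?c r \<theta> * L (n - r) (?v r \<theta>))
          + norm (?c r \<theta> * (L (n - r) (?v r \<theta>) - L0)) + norm (?c r \<theta> * L0 - L0 * \<Phi>)"
        by (rule norm_triangle_le, rule add_right_mono, rule norm_triangle_ineq)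
      finally show ?case using elim(1) a r(2) by (simp add: dist_norm)
    qed
  qed
qed

context finite_measure
begin

text \<open>The distance of exp(i<\<theta>, X>) from 1 is at most |\<theta>| |X|, which for
  |\<theta>| < \<delta>/L exceeds \<delta> only where |X| > L. By tightness this has probability
  below \<delta> for large n.\<close>

lemma weighted_char_near_0:
  fixes \<xi> :: "'a \<Rightarrow> complex" and X :: "nat \<Rightarrow> 'a \<Rightarrow> 'e::euclidean_space"
  assumes \<xi>: "integrable M \<xi>" and [measurable]: "\<And>n. X n \<in> borel_measurable M"
    and tight: "asymptotically_tight M X" and \<epsilon>: "0 < \<epsilon>"
  shows "\<exists>\<delta>>0. \<forall>\<theta>. norm \<theta> < \<delta> \<longrightarrow>
    (\<forall>\<^sub>F n in sequentially. norm ((\<integral>x. \<xi> x * cis (\<theta> \<bullet> X n x) \<partial>M) - (\<integral>x. \<xi> x \<partial>M)) < \<epsilon>)"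
proof -
  obtain \<delta> where \<delta>: "0 < \<delta>" and small: "\<And>Y. Y \<in> borel_measurable M \<Longrightarrow>
      AE x in M. 0 \<le> Y x \<and> Y x \<le> 2 \<Longrightarrow>
      measure M {x \<in> space M. Y x > \<delta>} < \<delta> \<Longrightarrow> (\<integral>x. norm (\<xi> x) * Y x \<partial>M) < \<epsilon>"
    using weighted_integral_small[OF \<xi> \<epsilon>, of 2] by auto
  obtain K where K: "\<forall>\<^sub>F n in sequentially. measure M {x \<in> space M. norm (X n x) > K} < \<delta>"
    using tight \<delta> unfolding asymptotically_tight_def by blast
  define L where "L = max K 1"
  have L: "0 < L" "K \<le> L" by (auto simp: L_def)
  have "\<forall>\<^sub>F n in sequentially. norm ((\<integral>x. \<xi> x * cis (\<theta> \<bullet> X n x) \<partial>M) - (\<integral>x. \<xi> x \<partial>M)) < \<epsilon>"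
    if \<theta>: "norm \<theta> < \<delta> / L" for \<theta>
    using K
  proof eventually_elim
    case (elim n)
    have int: "integrable M (\<lambda>x. \<xi> x * cis (\<theta> \<bullet> X n x))"
      by (rule integrable_mult_bounded[OF \<xi>, where C=1]) auto
    have "(\<integral>x. \<xi> x * cis (\<theta> \<bullet> X n x) \<partial>M) - (\<integral>x. \<xi> x \<partial>M) = (\<integral>x. \<xi> x * (cis (\<theta> \<bullet> X n x) - cis 0) \<partial>M)"
      using int \<xi> by (simp add: right_diff_distrib)
    also have "norm \<dots> \<le> (\<integral>x. norm (\<xi> x) * norm (cis (\<theta> \<bullet> X n x) - cis 0) \<partial>M)"
      using integral_norm_bound[of M "\<lambda>x. \<xi> x * (cis (\<theta> \<bullet> X n x) - cis 0)"] by (simp add: norm_mult)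
    also have "\<dots> < \<epsilon>"
    proof (rule small)
      have "norm (cis a - cis 0) \<le> 2" for a using norm_triangle_ineq4[of "cis a" "cis 0"] by simp
      then show "AE x in M. 0 \<le> norm (cis (\<theta> \<bullet> X n x) - cis 0) \<and> norm (cis (\<theta> \<bullet> X n x) - cis 0) \<le> 2" by simp
      have "{x \<in> space M. norm (cis (\<theta> \<bullet> X n x) - cis 0) > \<delta>} \<subseteq> {x \<in> space M. norm (X n x) > K}"
      proof (rule subsetI)
        fix x assume x: "x \<in> {x \<in> space M. norm (cis (\<theta> \<bullet> X n x) - cis 0) > \<delta>}"
        have "norm (cis (\<theta> \<bullet> X n x) - cis 0) \<le> norm \<theta> * norm (X n x)"
          using norm_cis_diff_le[of "\<theta> \<bullet> X n x" 0] Cauchy_Schwarz_ineq2[of \<theta> "X n x"] by simp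
        also have "\<dots> \<le> \<delta> / L * norm (X n x)" using \<theta> by (intro mult_right_mono) auto
        finally have "\<delta> < \<delta> / L * norm (X n x)" using x by simp
        then have "L < norm (X n x)" using \<delta> L by (simp add: field_simps)
        with x L show "x \<in> {x \<in> space M. norm (X n x) > K}" by simp
      qed
      then have "measure M {x \<in> space M. norm (cis (\<theta> \<bullet> X n x) - cis 0) > \<delta>} \<le> measure M {x \<in> space M. norm (X n x) > K}"
        by (intro finite_measure_mono) measurable
      then show "measure M {x \<in> space M. norm (cis (\<theta> \<bullet> X n x) - cis 0) > \<delta>} < \<delta>" using elim by simp
    qed measurable
    finally show ?case .
  qed
  then show ?thesis using \<delta> L by (intro exI[of _ "\<delta> / L"]) auto
qed

end

text \<open>The conditional expectation belongs to \<open>M\<close>, the integrals to the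
  conditioned measure. The density of the latter is measurable for the limit sigma-field, so as part
  of the weight it allows \<open>Y n\<close> to be replaced by its conditional expectation under
  \<open>M\<close>; afterwards that expectation is replaced by its limit c under the conditioned
  measure.\<close>

lemma cond_char_step:
  fixes \<xi> :: "'a \<Rightarrow> complex" and F :: "nat \<Rightarrow> 'a measure"
  assumes M: "prob_space M" and filt: "filtration (space M) F" and sub: "\<And>n. subalgebra M (F n)"
    and A: "A \<in> sets (sigma_infinity M F)" "0 < measure M A"
    and \<xi>: "integrable (uniform_measure M A) \<xi>" "\<xi> \<in> borel_measurable (sigma_infinity M F)"
    and T: "\<And>n. T n \<in> borel_measurable (F (n - 1))" "\<And>n x. norm (T n x) \<le> 1"
    and Y: "\<And>n. Y n \<in> borel_measurable M" "\<And>n x. norm (Y n x) \<le> 1"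
    and c: "vanishes_in_prob (uniform_measure M A) (\<lambda>n x. norm (complex_cond_exp M (F (n - 1)) (Y n) x - c))"
  shows "(\<lambda>n. (\<integral>x. \<xi> x * (T n x * Y n x) \<partial>uniform_measure M A) - c * (\<integral>x. \<xi> x * T n x \<partial>uniform_measure M A)) \<longlonglongrightarrow> 0"
proof -
  interpret M: prob_space M by (rule M)
  let ?N = "uniform_measure M A"
  let ?W = "\<lambda>n. complex_cond_exp M (F (n - 1)) (Y n)"
  have subinf: "subalgebra M (sigma_infinity M F)" by (rule subalgebra_sigma_infinity) (rule sub)
  have AM [measurable]: "A \<in> sets M" using A(1) subinf by (auto simp: subalgebra_def)
  interpret N: prob_space ?N
    using A(2) by (intro prob_space_uniform_measure) (auto simp: M.emeasure_eq_measure)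
  have [measurable]: "T n \<in> borel_measurable M" "Y n \<in> borel_measurable M" "?W n \<in> borel_measurable M" for n
    using measurable_from_subalg[OF sub T(1)] Y complex_cond_exp_measurable by auto
  have \<xi>M [measurable]: "\<xi> \<in> borel_measurable M" by (rule measurable_from_subalg[OF subinf \<xi>(2)])
  note \<xi>N = \<xi>(1)
  have W2: "AE x in ?N. norm (?W n x) \<le> 2" for n
  proof -
    have "finite_measure_subalgebra M (F (n - 1))"
      using sub by (simp add: finite_measure_subalgebra_def finite_measure_subalgebra_axioms_def M.finite_measure_axioms)
    from finite_measure_subalgebra.norm_complex_cond_exp_le[OF this Y(1,2)[of n]] show ?thesis
      by (intro AE_uniform_measureI AM) auto
  qed
  \<comment> \<open>The maximum provides one common bound for \<open>T n * ?W n\<close> and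
    \<open>T n * c\<close>, the form in which \<open>weighted_integral_diff_tendsto_0\<close> takes
    it.\<close>
  have TW: "AE x in ?N. norm (T n x * ?W n x) \<le> max 2 (norm c)" for n
    using W2[of n]
  proof eventually_elim
    case (elim x)
    then show ?case using mult_mono[OF T(2)[of n x] elim] by (simp add: norm_mult)
  qed
  have Tc: "AE x in ?N. norm (T n x * c) \<le> max 2 (norm c)" for n
    using mult_right_mono[OF T(2)[of n], of "norm c"] by (intro AE_I2) (simp add: norm_mult le_max_iff_disj)
  have TY: "AE x in ?N. norm (T n x * Y n x) \<le> 1" for n
    using mult_mono[OF T(2)[of n] Y(2)[of n]] by (intro AE_I2) (simp add: norm_mult)
  have *: "(\<lambda>n. \<integral>x. (of_real (indicator A x / measure M A) * \<xi> x) * (T n x * (Y n x - ?W n x)) \<partial>M) \<longlonglongrightarrow> 0"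
  proof (rule cond_exp_increment_vanishes[OF M filt sub _ _ T Y])
    show "integrable M (\<lambda>x. of_real (indicator A x / measure M A) * \<xi> x)"
      using \<xi>N M.integrable_uniform_measure[OF AM A(2) \<xi>M] by simp
    show "(\<lambda>x. of_real (indicator A x / measure M A) * \<xi> x) \<in> borel_measurable (sigma_infinity M F)"
      using A(1) \<xi>(2) by measurable
  qed
  have "(\<lambda>n. \<integral>x. \<xi> x * (T n x * (Y n x - ?W n x)) \<partial>?N) \<longlonglongrightarrow> 0"
  proof -
    have "(\<lambda>x. \<xi> x * (T n x * (Y n x - ?W n x))) \<in> borel_measurable M" for n by measurable
    then show ?thesis
      using * by (simp only: M.integral_uniform_measure[OF AM A(2)] mult.assoc)
  qed
  moreover have "(\<integral>x. \<xi> x * (T n x * (Y n x - ?W n x)) \<partial>?N)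
      = (\<integral>x. \<xi> x * (T n x * Y n x) \<partial>?N) - (\<integral>x. \<xi> x * (T n x * ?W n x) \<partial>?N)" for n
  proof -
    have "integrable ?N (\<lambda>x. \<xi> x * (T n x * ?W n x))"
      by (rule N.integrable_mult_bounded[OF \<xi>N _ TW]) measurable
    moreover have "integrable ?N (\<lambda>x. \<xi> x * (T n x * Y n x))"
      by (rule N.integrable_mult_bounded[OF \<xi>N _ TY]) measurable
    ultimately show ?thesis by (simp add: right_diff_distrib)
  qed
  ultimately have 1: "(\<lambda>n. (\<integral>x. \<xi> x * (T n x * Y n x) \<partial>?N) - (\<integral>x. \<xi> x * (T n x * ?W n x) \<partial>?N)) \<longlonglongrightarrow> 0"
    by simp
  have 2: "(\<lambda>n. (\<integral>x. \<xi> x * (T n x * ?W n x) \<partial>?N) - (\<integral>x. \<xi> x * (T n x * c) \<partial>?N)) \<longlonglongrightarrow> 0"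
  proof (rule N.weighted_integral_diff_tendsto_0[OF \<xi>N _ _ TW Tc])
    show "vanishes_in_prob ?N (\<lambda>n x. norm (T n x * ?W n x - T n x * c))"
    proof (rule N.vanishes_in_prob_mono)
      show "vanishes_in_prob ?N (\<lambda>n x. norm (?W n x - c))" by (rule c)
      have "norm (T n x * ?W n x - T n x * c) \<le> norm (?W n x - c)" for n x
        using mult_right_mono[OF T(2)[of n x], of "norm (?W n x - c)"]
        by (simp add: right_diff_distrib[symmetric] norm_mult)
      then show "\<forall>\<^sub>F n in sequentially. AE x in ?N. norm (T n x * ?W n x - T n x * c) \<le> norm (?W n x - c)"
        by simp
    qed measurable
  qed measurable
  have "(\<integral>x. \<xi> x * (T n x * c) \<partial>?N) = c * (\<integral>x. \<xi> x * T n x \<partial>?N)" for n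
    by (simp add: mult.assoc[symmetric] mult.commute[of c])
  with tendsto_add[OF 1 2] show ?thesis by simp
qed

theorem corollary1p8:
  fixes M :: "'a measure"
    and F :: "nat \<Rightarrow> 'a measure"
    and U :: "nat \<Rightarrow> 'a \<Rightarrow> real ^ 'd"
    and B :: "nat \<Rightarrow> 'a \<Rightarrow> real ^ 'd ^ 'd"
    and Q :: "nat \<Rightarrow> real ^ 'd ^ 'd"
    and G :: "'a set"
    and D P :: "real ^ 'd ^ 'd"
    and \<mu> :: "(real ^ 'd) measure"
    and \<eta> :: "'a \<Rightarrow> real ^ 'd ^ 'd"
    and Z :: "'a \<Rightarrow> real ^ 'd"
  assumes "prob_space M"
    and "filtration (space M) F" and "\<And>n. subalgebra M (F n)"
    and "\<And>n. U n \<in> borel_measurable (F n)"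
    and "\<And>n. B n \<in> borel_measurable (F n)"
    and "\<forall>\<^sub>F n in sequentially. AE \<omega> in M. invertible (B n \<omega>)"
    and "Q \<longlonglongrightarrow> 0"
    and "\<forall>\<^sub>F n in sequentially. invertible (Q n)"
    and "G \<in> sets (sigma_infinity M F)" and "measure M G > 0"
    and "transpose D = D" and "\<And>x. 0 \<le> x \<bullet> (D *v x)"
    and "multivariate_normal 0 D \<mu>"
    and rich: "\<exists>\<zeta> :: nat \<Rightarrow> 'a \<Rightarrow> real ^ 'd.
          prob_space.indep_vars M (\<lambda>_. borel) \<zeta> UNIV \<and>
          (\<forall>j. distr M borel (\<zeta> j) = \<mu>) \<and>
          indep_of_algebra M (\<Pi>\<^sub>M j\<in>UNIV. borel) (\<lambda>\<omega> j. \<zeta> j \<omega>) (sigma_infinity M F)"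
    and i: "\<eta> \<in> borel_measurable (sigma_infinity M F)"
      "measure M (G \<inter> invertible_event M \<eta>) > 0"
      "converges_in_prob (uniform_measure M G) (\<lambda>n \<omega>. Q n ** matrix_inv (B n \<omega>)) \<eta>"
    and ii: "((\<lambda>K::real. SUP n\<in>{1..}.
          measure (uniform_measure M (G \<inter> invertible_event M \<eta>))
            {\<omega> \<in> space M. norm (Q n *v U n \<omega>) > K}) \<longlongrightarrow> 0) at_top"
    and iii: "invertible P" "spectral_radius P < 1"
      "\<And>r. r \<ge> 1 \<Longrightarrow> converges_in_prob (uniform_measure M G)
          (\<lambda>n \<omega>. B n \<omega> ** matrix_inv (B (n - r) \<omega>)) (\<lambda>_. matrix_power P r)"
    and iv: "\<And>\<theta> :: real ^ 'd.
          converges_in_prob (uniform_measure M (G \<inter> invertible_event M \<eta>))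
            (\<lambda>n. complex_cond_exp M (F (n - 1))
              (\<lambda>\<omega>. exp (\<i> * complex_of_real (\<theta> \<bullet> (B n \<omega> *v increment U n \<omega>)))))
            (\<lambda>_. \<integral>x. exp (\<i> * complex_of_real (\<theta> \<bullet> x)) \<partial>\<mu>)"
    and Z: "Z \<in> borel_measurable M"
      "multivariate_normal 0
         (\<Sum>j. matrix_power P j ** D ** transpose (matrix_power P j)) (distr M borel Z)"
      "indep_of_algebra M borel Z (sigma_infinity M F)"
  shows "converges_mixing (uniform_measure M (G \<inter> invertible_event M \<eta>)) (sigma_infinity M F)
           (\<lambda>n \<omega>. B n \<omega> *v U n \<omega>) Z
       \<and> converges_stably (uniform_measure M (G \<inter> invertible_event M \<eta>)) (sigma_infinity M F)
           (\<lambda>n \<omega>. Q n *v U n \<omega>) (\<lambda>\<omega>. \<eta> \<omega> *v Z \<omega>)"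
proof -
  interpret M: prob_space M by (rule assms(1))
  interpret filtration "space M" F by (rule assms(2))
  note filt = assms(2) and sub = assms(3) and inv = assms(6)
  define H where "H = sigma_infinity M F"
  define A where "A = G \<inter> invertible_event M \<eta>"
  define N where "N = uniform_measure M A"
  define X where "X n \<omega> = B n \<omega> *v U n \<omega>" for n \<omega>
  define V where "V n \<omega> = B n \<omega> *v increment U n \<omega>" for n \<omega>
  define R where "R n \<omega> = Q n ** matrix_inv (B n \<omega>)" for n \<omega>
  define S where "S n \<omega> = Q n *v U n \<omega>" for n \<omega>
  define \<Sigma> where "\<Sigma> = (\<Sum>j. matrix_power P j ** D ** transpose (matrix_power P j))"
  define c where "c \<theta> = complex_of_real (exp (- (\<theta> \<bullet> (D *v \<theta>)) / 2))" for \<theta>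

  \<comment> \<open>The conditioned measure and measurability\<close>
  have subH: "subalgebra M H" unfolding H_def by (rule subalgebra_sigma_infinity) (rule sub)
  have HM: "sets H \<subseteq> sets M" and spH: "space H = space M" using subH by (auto simp: subalgebra_def)
  have \<eta>H: "\<eta> \<in> borel_measurable H" using i(1) by (simp add: H_def)
  have AH: "A \<in> sets H"
  proof -
    have "invertible_event M \<eta> = \<eta> -` {E. invertible E} \<inter> space H"
      by (auto simp: invertible_event_def spH)
    then show ?thesis
      using measurable_sets[OF \<eta>H sets_invertible] assms(9) by (simp add: A_def H_def)
  qed
  then have AM [measurable]: "A \<in> sets M" using HM by blast
  have GM: "G \<in> sets M" using assms(9) HM by (auto simp: H_def)
  have A0: "0 < measure M A" using i(2) by (simp add: A_def)
  have AG: "A \<subseteq> G" by (auto simp: A_def)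
  interpret N: prob_space N
    unfolding N_def using A0 by (intro prob_space_uniform_measure) (auto simp: M.emeasure_eq_measure)
  have setsN [measurable_cong]: "sets N = sets M" and spN: "space N = space M" by (auto simp: N_def)
  have subN: "subalgebra N H" using subH by (simp add: subalgebra_def setsN spN)
  have AE_N: "AE \<omega> in N. p \<omega>" if "AE \<omega> in M. p \<omega>" for p
    unfolding N_def using that by (intro AE_uniform_measureI AM) auto

  have UF: "U n \<in> borel_measurable (F n)" and BF: "B n \<in> borel_measurable (F n)" for n
    by (rule assms)+
  have [measurable]: "U n \<in> borel_measurable M" "B n \<in> borel_measurable M" "\<eta> \<in> borel_measurable M" for n
    using measurable_from_subalg[OF sub UF] measurable_from_subalg[OF sub BF] measurable_from_subalg[OF subH \<eta>H] by auto
  have [measurable]: "increment U n \<in> borel_measurable M" for n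
    unfolding increment_def[abs_def] by (cases "n = 0") auto
  have XF: "X n \<in> borel_measurable (F n)" for n
    unfolding X_def using UF BF by measurable
  have [measurable]: "X n \<in> borel_measurable M" "V n \<in> borel_measurable M" "R n \<in> borel_measurable M"
    "S n \<in> borel_measurable M" for n
    unfolding X_def V_def R_def S_def by measurable
  have [measurable]: "Z \<in> borel_measurable M" by (rule Z(1))

  obtain c1 where c1: "0 < c1" "\<And>(A :: real ^ 'd ^ 'd) (x :: real ^ 'd). norm (A *v x) \<le> norm A * norm x * c1"
    using bounded_bilinear.pos_bounded[OF bounded_bilinear_matrix_vector_mult] by blast
  obtain c2 where c2: "0 < c2" "\<And>(A :: real ^ 'd ^ 'd) (A' :: real ^ 'd ^ 'd). norm (A ** A') \<le> norm A * norm A' * c2"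
    using bounded_bilinear.pos_bounded[OF bounded_bilinear_matrix_matrix_mult] by blast
  \<comment> \<open>One constant for both kinds of product, as \<open>norm_le_via_inverse\<close>
    expects.\<close>
  define k where "k = max c1 c2"
  have k: "0 < k" "\<And>(A :: real ^ 'd ^ 'd) (x :: real ^ 'd). norm (A *v x) \<le> norm A * norm x * k"
    "\<And>(A :: real ^ 'd ^ 'd) (A' :: real ^ 'd ^ 'd). norm (A ** A') \<le> norm A * norm A' * k"
  proof -
    show "0 < k" using c1(1) by (simp add: k_def)
    show "norm (A *v x) \<le> norm A * norm x * k" for A :: "real ^ 'd ^ 'd" and x :: "real ^ 'd"
      by (rule order.trans[OF c1(2)]) (auto intro!: mult_left_mono simp: k_def)
    show "norm (A ** A') \<le> norm A * norm A' * k" for A A' :: "real ^ 'd ^ 'd"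
      by (rule order.trans[OF c2(2)]) (auto intro!: mult_left_mono simp: k_def)
  qed

  \<comment> \<open>Tightness of \<open>B n *v U n\<close>\<close>
  have invN: "\<forall>\<^sub>F n in sequentially. AE \<omega> in N. invertible (B n \<omega>)"
    using inv by eventually_elim (rule AE_N)
  have inv\<eta>: "AE \<omega> in N. invertible (\<eta> \<omega>)"
    unfolding N_def by (intro AE_uniform_measureI AM) (auto simp: A_def invertible_event_def)
  have vanR: "vanishes_in_prob N (\<lambda>n \<omega>. dist (R n \<omega>) (\<eta> \<omega>))"
    unfolding N_def
    using i(3) by (intro M.vanishes_in_prob_uniform_subset[OF AG A0 GM AM])
      (auto simp: converges_in_prob_iff_vanishes R_def)
  have tightS: "asymptotically_tight N S"
    using ii by (intro asymptotically_tight_if_SUP_tendsto_0 N.prob_space_axioms)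
      (simp add: S_def spN, simp add: N_def A_def)
  \<comment> \<open>The bound |X n| \<le> 2 k |\<eta>^-1| |S n| holds once |R n - \<eta>|
    |\<eta>^-1| is below the threshold. The factor |\<eta>^-1| may be unbounded, but a single random
    matrix is tight.\<close>
  have tightX: "asymptotically_tight N X"
  proof (rule N.asymptotically_tight_dominated)
    show "asymptotically_tight N (\<lambda>n \<omega>. norm (matrix_inv (\<eta> \<omega>)) * norm (S n \<omega>))"
      by (rule N.asymptotically_tight_mult[OF N.asymptotically_tight_const tightS]) measurable
    show "vanishes_in_prob N (\<lambda>n \<omega>. dist (R n \<omega>) (\<eta> \<omega>) * norm (matrix_inv (\<eta> \<omega>)))"
      by (rule N.vanishes_in_prob_tight_mult[OF vanR N.asymptotically_tight_const _ _ zero_le_dist]) measurable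
    show "0 < 1 / (2 * k * k)" "0 \<le> 2 * k" using k(1) by auto
    show "\<forall>\<^sub>F n in sequentially. AE \<omega> in N.
        dist (R n \<omega>) (\<eta> \<omega>) * norm (matrix_inv (\<eta> \<omega>)) \<le> 1 / (2 * k * k) \<longrightarrow>
        norm (X n \<omega>) \<le> 2 * k * norm (norm (matrix_inv (\<eta> \<omega>)) * norm (S n \<omega>))"
      using invN
    proof eventually_elim
      case (elim n)
      from elim inv\<eta> show ?case
      proof eventually_elim
        case (elim \<omega>)
        then show ?case
          using norm_le_via_inverse[OF k elim(2,1), of "Q n" "U n \<omega>"] by (simp add: R_def X_def S_def)
      qed
    qed
  qed measurable

  \<comment> \<open>One step of the recursion for the weighted characteristic functions\<close>
  have char\<mu>: "(\<integral>x. exp (\<i> * complex_of_real (\<theta> \<bullet> x)) \<partial>\<mu>) = c \<theta>" for \<theta>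
    using char_multivariate_normal[OF assms(13), of \<theta>] by (simp add: c_def cis_conv_exp)

  have step: "(\<lambda>n. (\<integral>\<omega>. \<xi> \<omega> * cis (\<theta> \<bullet> X n \<omega>) \<partial>N)
      - c \<theta> * (\<integral>\<omega>. \<xi> \<omega> * cis ((transpose P *v \<theta>) \<bullet> X (n - 1) \<omega>) \<partial>N)) \<longlonglongrightarrow> 0"
    if \<xi>: "integrable N \<xi>" "\<xi> \<in> borel_measurable H" for \<xi> \<theta>
  proof -
    \<comment> \<open>The phase of \<open>X n\<close> is split, up to o(1), into a part known at
      time n - 1 and the phase of \<open>V n\<close>. Only the second factor \<open>?Y n\<close> is
      averaged given the past.\<close>
    let ?T = "\<lambda>n \<omega>. cis ((transpose P *v \<theta>) \<bullet> X (n - 1) \<omega>)" and ?Y = "\<lambda>n \<omega>. cis (\<theta> \<bullet> V n \<omega>)"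
    have 1: "(\<lambda>n. (\<integral>\<omega>. \<xi> \<omega> * (?T n \<omega> * ?Y n \<omega>) \<partial>N) - c \<theta> * (\<integral>\<omega>. \<xi> \<omega> * ?T n \<omega> \<partial>N)) \<longlonglongrightarrow> 0"
      unfolding N_def
    proof (rule cond_char_step[OF M.prob_space_axioms filt sub])
      show "A \<in> sets (sigma_infinity M F)" "\<xi> \<in> borel_measurable (sigma_infinity M F)"
        using AH \<xi>(2) by (simp_all add: H_def)
      show "integrable (uniform_measure M A) \<xi>" using \<xi>(1) by (simp add: N_def)
      show "?T n \<in> borel_measurable (F (n - 1))" for n using XF[of "n - 1"] by measurable
      show "vanishes_in_prob (uniform_measure M A)
          (\<lambda>n \<omega>. norm (complex_cond_exp M (F (n - 1)) (?Y n) \<omega> - c \<theta>))"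
        using iv[of \<theta>] by (simp add: converges_in_prob_iff_vanishes char\<mu> dist_norm A_def V_def cis_conv_exp)
    qed (use A0 in simp_all)
    \<comment> \<open>With C = B_n B_(n-1)^-1 one has B_n U_(n-1) = C X_(n-1), so the phases differ
      by the inner product of \<theta> with (C - P) X_(n-1): a matrix vanishing in probability,
      applied to a tight vector.\<close>
    have 2: "(\<lambda>n. (\<integral>\<omega>. \<xi> \<omega> * cis (\<theta> \<bullet> X n \<omega>) \<partial>N) - (\<integral>\<omega>. \<xi> \<omega> * (?T n \<omega> * ?Y n \<omega>) \<partial>N)) \<longlonglongrightarrow> 0"
    proof (rule N.weighted_integral_diff_tendsto_0[OF \<xi>(1), where C=1])
      have van: "vanishes_in_prob N (\<lambda>n \<omega>. dist (B n \<omega> ** matrix_inv (B (n - 1) \<omega>)) P)"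
        unfolding N_def
        using iii(3)[of 1] by (intro M.vanishes_in_prob_uniform_subset[OF AG A0 GM AM])
          (auto simp: converges_in_prob_iff_vanishes)
      let ?D = "\<lambda>n \<omega>. dist (B n \<omega> ** matrix_inv (B (n - 1) \<omega>)) P * norm (X (n - 1) \<omega>)"
      have "vanishes_in_prob N ?D"
        by (rule N.vanishes_in_prob_tight_mult[OF van asymptotically_tight_shift[OF tightX] _ _ zero_le_dist]) measurable
      then have vanD: "vanishes_in_prob N (\<lambda>n \<omega>. (norm \<theta> * k) * ?D n \<omega>)"
        using k(1) by (intro N.vanishes_in_prob_cmult) auto
      show "vanishes_in_prob N (\<lambda>n \<omega>. norm (cis (\<theta> \<bullet> X n \<omega>) - ?T n \<omega> * ?Y n \<omega>))"
      proof (rule N.vanishes_in_prob_mono[OF vanD])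
        have "\<forall>\<^sub>F n in sequentially. AE \<omega> in N. invertible (B (n - 1) \<omega>)"
          using eventually_compose_filterlim[OF invN filterlim_minus_const_nat_at_top] .
        with eventually_ge_at_top[of 1]
        show "\<forall>\<^sub>F n in sequentially. AE \<omega> in N. norm (cis (\<theta> \<bullet> X n \<omega>) - ?T n \<omega> * ?Y n \<omega>) \<le> (norm \<theta> * k) * ?D n \<omega>"
        proof eventually_elim
          case (elim n)
          from elim(2) show ?case
          proof eventually_elim
            case (elim \<omega>)
            let ?C = "B n \<omega> ** matrix_inv (B (n - 1) \<omega>)"
            have "?C *v X (n - 1) \<omega> = B n \<omega> *v U (n - 1) \<omega>"
              by (simp only: X_def matrix_vector_mul_assoc matrix_mul_assoc[symmetric] matrix_inv(2)[OF elim] matrix_mul_rid)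
            moreover have "X n \<omega> = B n \<omega> *v U (n - 1) \<omega> + V n \<omega>"
              using \<open>1 \<le> n\<close> by (simp add: X_def V_def increment_def matrix_vector_mult_diff_distrib)
            ultimately have X: "X n \<omega> = (?C - P) *v X (n - 1) \<omega> + P *v X (n - 1) \<omega> + V n \<omega>"
              by (simp add: matrix_vector_mult_diff_rdistrib)
            have "norm (cis (\<theta> \<bullet> X n \<omega>) - ?T n \<omega> * ?Y n \<omega>)
                \<le> \<bar>\<theta> \<bullet> X n \<omega> - ((transpose P *v \<theta>) \<bullet> X (n - 1) \<omega> + \<theta> \<bullet> V n \<omega>)\<bar>"
              unfolding cis_mult by (rule norm_cis_diff_le)
            also have "\<theta> \<bullet> X n \<omega> - ((transpose P *v \<theta>) \<bullet> X (n - 1) \<omega> + \<theta> \<bullet> V n \<omega>)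
                = \<theta> \<bullet> ((?C - P) *v X (n - 1) \<omega>)"
              unfolding X transpose_mult_inner by (simp add: inner_add_right)
            also have "\<bar>\<dots>\<bar> \<le> norm \<theta> * norm ((?C - P) *v X (n - 1) \<omega>)" by (rule Cauchy_Schwarz_ineq2)
            also have "\<dots> \<le> norm \<theta> * (norm (?C - P) * norm (X (n - 1) \<omega>) * k)"
              by (intro mult_left_mono k) simp
            also have "\<dots> = (norm \<theta> * k) * ?D n \<omega>" by (simp add: dist_norm)
            finally show ?case .
          qed
        qed
      qed measurable
    qed (auto simp: norm_mult)
    from tendsto_add[OF 2 1] show ?thesis by simp
  qed

  \<comment> \<open>Limits of the weighted characteristic functions\<close>
  have indepN: "indep_of_algebra N borel Z H" and distrN: "distr N borel Z = distr M borel Z"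
    using M.indep_of_algebra_uniform_measure[OF subH AH A0 Z(1)] Z(3) by (simp_all add: N_def H_def)
  \<comment> \<open>Conditioning on an event of \<open>H\<close> leaves the law of \<open>Z\<close>
    unchanged, so the Gaussian formula under \<open>M\<close> applies.\<close>
  have charZ: "(\<integral>\<omega>. cis (\<theta> \<bullet> Z \<omega>) \<partial>N) = of_real (exp (- (\<theta> \<bullet> (\<Sigma> *v \<theta>)) / 2))" for \<theta>
  proof -
    have "(\<integral>\<omega>. cis (\<theta> \<bullet> Z \<omega>) \<partial>N) = (\<integral>z. cis (\<theta> \<bullet> z) \<partial>distr N borel Z)"
      by (subst integral_distr) measurable
    then show ?thesis unfolding distrN using char_multivariate_normal[OF Z(2)] by (simp add: \<Sigma>_def)
  qed

  have charX: "(\<lambda>n. \<integral>\<omega>. \<xi> \<omega> * cis (\<theta> \<bullet> X n \<omega>) \<partial>N) \<longlonglongrightarrow> (\<integral>\<omega>. \<xi> \<omega> * cis (\<theta> \<bullet> Z \<omega>) \<partial>N)"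
    if \<xi>: "integrable N \<xi>" "\<xi> \<in> borel_measurable H" for \<xi> \<theta>
  proof -
    have "(\<lambda>n. \<integral>\<omega>. \<xi> \<omega> * cis (\<theta> \<bullet> X n \<omega>) \<partial>N) \<longlonglongrightarrow>
        (\<integral>\<omega>. \<xi> \<omega> \<partial>N) * of_real (exp (- (\<theta> \<bullet> (\<Sigma> *v \<theta>)) / 2))"
    proof (rule affine_recursion_limit[where L="\<lambda>n \<theta>. \<integral>\<omega>. \<xi> \<omega> * cis (\<theta> \<bullet> X n \<omega>) \<partial>N"])
      show "(\<lambda>r. \<Prod>j<r. c (transpose (matrix_power P j) *v \<theta>)) \<longlonglongrightarrow> of_real (exp (- (\<theta> \<bullet> (\<Sigma> *v \<theta>)) / 2))"
        using gaussian_char_product_limit[OF iii(2)] unfolding c_def[abs_def] \<Sigma>_def .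
    qed (rule step[OF \<xi>] matrix_power_tendsto_0[OF iii(2)] N.weighted_char_near_0[OF \<xi>(1) _ tightX], measurable)+
    also have "(\<integral>\<omega>. \<xi> \<omega> \<partial>N) * of_real (exp (- (\<theta> \<bullet> (\<Sigma> *v \<theta>)) / 2)) = (\<integral>\<omega>. \<xi> \<omega> * cis (\<theta> \<bullet> Z \<omega>) \<partial>N)"
      using N.integral_mult_indep_of_algebra[OF subN _ indepN \<xi>, of "\<lambda>z. cis (\<theta> \<bullet> z)"] by (simp add: charZ)
    finally show ?thesis .
  qed

  \<comment> \<open>Stable convergence of the two sequences\<close>
  have stableX: "converges_stably N H X Z"
  proof (rule N.converges_stablyI[OF subN])
    fix \<xi> :: "'a \<Rightarrow> real" and h :: "real ^ 'd \<Rightarrow> real" and C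
    assume \<xi>: "integrable N \<xi>" "\<xi> \<in> borel_measurable H"
      and h: "continuous_on UNIV h" "\<And>x. \<bar>h x\<bar> \<le> C"
    show "(\<lambda>n. \<integral>\<omega>. \<xi> \<omega> * h (X n \<omega>) \<partial>N) \<longlonglongrightarrow> (\<integral>\<omega>. \<xi> \<omega> * h (Z \<omega>) \<partial>N)"
      using \<xi> by (intro N.weighted_convergence_of_char[OF \<xi>(1) _ _ tightX _ h] charX) measurable
  qed measurable

  have joint: "(\<lambda>n. \<integral>\<omega>. \<xi> \<omega> * h (\<eta> \<omega>, X n \<omega>) \<partial>N) \<longlonglongrightarrow> (\<integral>\<omega>. \<xi> \<omega> * h (\<eta> \<omega>, Z \<omega>) \<partial>N)"
    if \<xi>: "integrable N \<xi>" "\<xi> \<in> borel_measurable H"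
      and h: "continuous_on UNIV h" "\<And>y. \<bar>h y\<bar> \<le> C" for \<xi> :: "'a \<Rightarrow> real" and h :: "(real ^ 'd ^ 'd) \<times> (real ^ 'd) \<Rightarrow> real" and C
  proof (rule N.weighted_convergence_of_char[OF \<xi>(1) _ _ _ _ h])
    show "asymptotically_tight N (\<lambda>n \<omega>. (\<eta> \<omega>, X n \<omega>))"
      by (rule N.asymptotically_tight_Pair[OF N.asymptotically_tight_const tightX]) measurable
    fix t :: "(real ^ 'd ^ 'd) \<times> (real ^ 'd)"
    \<comment> \<open>The \<eta>-part of the phase is bounded and \<open>H\<close>-measurable, so it
      joins the weight; this is why \<open>charX\<close> is stated for complex weights.\<close>
    let ?\<xi> = "\<lambda>\<omega>. complex_of_real (\<xi> \<omega>) * cis (fst t \<bullet> \<eta> \<omega>)"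
    have "integrable N ?\<xi>" using \<xi>(1) by (intro N.integrable_mult_bounded[where C=1]) auto
    moreover have "?\<xi> \<in> borel_measurable H" using \<xi>(2) \<eta>H by measurable
    ultimately have "(\<lambda>n. \<integral>\<omega>. ?\<xi> \<omega> * cis (snd t \<bullet> X n \<omega>) \<partial>N) \<longlonglongrightarrow> (\<integral>\<omega>. ?\<xi> \<omega> * cis (snd t \<bullet> Z \<omega>) \<partial>N)"
      by (rule charX)
    moreover have "cis (t \<bullet> (a, b)) = cis (fst t \<bullet> a) * cis (snd t \<bullet> b)" for a b
      by (simp add: inner_prod_def cis_mult)
    ultimately show "(\<lambda>n. \<integral>\<omega>. of_real (\<xi> \<omega>) * cis (t \<bullet> (\<eta> \<omega>, X n \<omega>)) \<partial>N)
        \<longlonglongrightarrow> (\<integral>\<omega>. of_real (\<xi> \<omega>) * cis (t \<bullet> (\<eta> \<omega>, Z \<omega>)) \<partial>N)"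
      by (simp add: mult.assoc)
  qed measurable

  have stableS: "converges_stably N H S (\<lambda>\<omega>. \<eta> \<omega> *v Z \<omega>)"
  proof (rule N.converges_stablyI[OF subN])
    fix \<xi> :: "'a \<Rightarrow> real" and h :: "real ^ 'd \<Rightarrow> real" and C
    assume \<xi>: "integrable N \<xi>" "\<xi> \<in> borel_measurable H"
      and h: "continuous_on UNIV h" "\<And>x. \<bar>h x\<bar> \<le> C"
    show "(\<lambda>n. \<integral>\<omega>. \<xi> \<omega> * h (S n \<omega>) \<partial>N) \<longlonglongrightarrow> (\<integral>\<omega>. \<xi> \<omega> * h (\<eta> \<omega> *v Z \<omega>) \<partial>N)"
    proof (rule N.weighted_convergence_of_char[OF \<xi>(1) _ _ tightS _ h])
      fix t :: "real ^ 'd"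
      \<comment> \<open>The product of matrix and vector is continuous but unbounded. Cosine and
        sine of its projections are bounded, so joint convergence applies to them and yields the
        characteristic function of \<eta> X_n.\<close>
      have cont: "continuous_on UNIV (\<lambda>y :: (real ^ 'd ^ 'd) \<times> (real ^ 'd). t \<bullet> (fst y *v snd y))"
        by (intro continuous_intros bounded_bilinear.continuous_on[OF bounded_bilinear_matrix_vector_mult])
      have "(\<lambda>n. \<integral>\<omega>. \<xi> \<omega> * cos (t \<bullet> (\<eta> \<omega> *v X n \<omega>)) \<partial>N) \<longlonglongrightarrow> (\<integral>\<omega>. \<xi> \<omega> * cos (t \<bullet> (\<eta> \<omega> *v Z \<omega>)) \<partial>N)"
        using joint[OF \<xi>, of "\<lambda>y. cos (t \<bullet> (fst y *v snd y))" 1] continuous_on_cos[OF cont] by simp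
      moreover have "(\<lambda>n. \<integral>\<omega>. \<xi> \<omega> * sin (t \<bullet> (\<eta> \<omega> *v X n \<omega>)) \<partial>N) \<longlonglongrightarrow> (\<integral>\<omega>. \<xi> \<omega> * sin (t \<bullet> (\<eta> \<omega> *v Z \<omega>)) \<partial>N)"
        using joint[OF \<xi>, of "\<lambda>y. sin (t \<bullet> (fst y *v snd y))" 1] continuous_on_sin[OF cont] by simp
      ultimately have 1: "(\<lambda>n. \<integral>\<omega>. complex_of_real (\<xi> \<omega>) * cis (t \<bullet> (\<eta> \<omega> *v X n \<omega>)) \<partial>N)
          \<longlonglongrightarrow> (\<integral>\<omega>. complex_of_real (\<xi> \<omega>) * cis (t \<bullet> (\<eta> \<omega> *v Z \<omega>)) \<partial>N)"
        by (simp add: N.integral_of_real_mult_cis[OF \<xi>(1)] tendsto_Complex)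
      \<comment> \<open>For large n, S_n = R_n X_n almost everywhere. Since R_n - \<eta> vanishes in
        probability and X_n is tight, \<eta> X_n may replace S_n in the phase.\<close>
      have 2: "(\<lambda>n. (\<integral>\<omega>. complex_of_real (\<xi> \<omega>) * cis (t \<bullet> S n \<omega>) \<partial>N)
          - (\<integral>\<omega>. complex_of_real (\<xi> \<omega>) * cis (t \<bullet> (\<eta> \<omega> *v X n \<omega>)) \<partial>N)) \<longlonglongrightarrow> 0"
      proof (rule N.weighted_integral_diff_tendsto_0[where C=1])
        let ?D = "\<lambda>n \<omega>. dist (R n \<omega>) (\<eta> \<omega>) * norm (X n \<omega>)"
        have "vanishes_in_prob N ?D"
          by (rule N.vanishes_in_prob_tight_mult[OF vanR tightX _ _ zero_le_dist]) measurable
        then have vanD: "vanishes_in_prob N (\<lambda>n \<omega>. (norm t * k) * ?D n \<omega>)"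
          using k(1) by (intro N.vanishes_in_prob_cmult) auto
        show "vanishes_in_prob N (\<lambda>n \<omega>. norm (cis (t \<bullet> S n \<omega>) - cis (t \<bullet> (\<eta> \<omega> *v X n \<omega>))))"
        proof (rule N.vanishes_in_prob_mono[OF vanD])
          show "\<forall>\<^sub>F n in sequentially. AE \<omega> in N.
              norm (cis (t \<bullet> S n \<omega>) - cis (t \<bullet> (\<eta> \<omega> *v X n \<omega>))) \<le> (norm t * k) * ?D n \<omega>"
            using invN
          proof eventually_elim
            case (elim n)
            then show ?case
            proof eventually_elim
              case (elim \<omega>)
              have S: "S n \<omega> = R n \<omega> *v X n \<omega>"
                by (simp add: S_def R_def X_def matrix_vector_mul_assoc matrix_mul_assoc[symmetric] matrix_inv(2)[OF elim])
              have "norm (cis (t \<bullet> S n \<omega>) - cis (t \<bullet> (\<eta> \<omega> *v X n \<omega>))) \<le> \<bar>t \<bullet> S n \<omega> - t \<bullet> (\<eta> \<omega> *v X n \<omega>)\<bar>"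
                by (rule norm_cis_diff_le)
              also have "t \<bullet> S n \<omega> - t \<bullet> (\<eta> \<omega> *v X n \<omega>) = t \<bullet> ((R n \<omega> - \<eta> \<omega>) *v X n \<omega>)"
                by (simp add: S matrix_vector_mult_diff_rdistrib inner_diff_right)
              also have "\<bar>\<dots>\<bar> \<le> norm t * norm ((R n \<omega> - \<eta> \<omega>) *v X n \<omega>)" by (rule Cauchy_Schwarz_ineq2)
              also have "\<dots> \<le> norm t * (norm (R n \<omega> - \<eta> \<omega>) * norm (X n \<omega>) * k)"
                by (intro mult_left_mono k) simp
              also have "\<dots> = (norm t * k) * ?D n \<omega>" by (simp add: dist_norm)
              finally show ?case .
            qed
          qed
        qed measurable
      qed (use \<xi>(1) in auto)
      from tendsto_add[OF 2 1]
      show "(\<lambda>n. \<integral>\<omega>. of_real (\<xi> \<omega>) * cis (t \<bullet> S n \<omega>) \<partial>N)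
          \<longlonglongrightarrow> (\<integral>\<omega>. of_real (\<xi> \<omega>) * cis (t \<bullet> (\<eta> \<omega> *v Z \<omega>)) \<partial>N)" by simp
    qed measurable
  qed measurable

  from stableX indepN stableS show ?thesis
    unfolding converges_mixing_def N_def A_def H_def X_def[abs_def] S_def[abs_def] by blast
qed

end
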